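(* There exists a set $X\subset(0,1)$ such that $C_w(I_X)$ is not homeomorphic to $C_w(I_X)\times C_w(I_X)$ and $C_p(I_X)$ is not homeomorphic to $C_p(I_X)\times C_p(I_X)$.
   Context: $I=[0,1]$. For $A\subset I$, $I_A=(I\times\{0\})\cup(A\times\{1\})$ with the order topology of the lexicographic order (a separable compact space). For compact $K$, $C_p(K)$ is the set $C(K)$ of continuous real-valued functions on $K$ with the topology of pointwise convergence, and $C_w(K)$ is $C(K)$ with the weak topology of the Banach space $C(K)$ (supremum norm). Homeomorphisms are not assumed to be linear. The result is in $\mathsf{ZFC}$. *)

theory Defs
  imports "HOL-Analysis.Analysis"
begin

(* r is a strict order relation, x below y iff (x, y) is in r. The set S itself is added
   to the subbasis so that the space is S also when S has a single point. *)
definition order_topology_on :: "'a set \<Rightarrow> ('a \<times> 'a) set \<Rightarrow> 'a topology" where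
  "order_topology_on S r = topology_generated_by
     (insert S ((\<lambda>a. {x \<in> S. (x, a) \<in> r}) ` S \<union> (\<lambda>a. {x \<in> S. (a, x) \<in> r}) ` S))"

definition lex_less :: "((real \<times> nat) \<times> (real \<times> nat)) set" where
  "lex_less = {(s, t). s < t} <*lex*> {(i, j). i < j}"

definition split_interval :: "real set \<Rightarrow> (real \<times> nat) topology" where
  "split_interval A = order_topology_on ({0..1} \<times> {0} \<union> A \<times> {1}) lex_less"

(* A function on K is represented by its extension with value undefined outside K, so that
   equality of elements of cfun K is equality of functions on K. *)
definition cfun :: "'a topology \<Rightarrow> ('a \<Rightarrow> real) set" where
  "cfun K = {f \<in> extensional (topspace K). continuous_map K euclideanreal f}"

definition C_p :: "'a topology \<Rightarrow> ('a \<Rightarrow> real) topology" where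
  "C_p K = subtopology (product_topology (\<lambda>_. euclideanreal) (topspace K)) (cfun K)"

(* Meaningful for f in cfun K with K compact and nonempty. *)
definition sup_norm :: "'a topology \<Rightarrow> ('a \<Rightarrow> real) \<Rightarrow> real" where
  "sup_norm K f = (SUP x\<in>topspace K. \<bar>f x\<bar>)"

(* The bounded linear functionals on the Banach space C(K); only the values on cfun K
   matter. *)
definition cfun_dual :: "'a topology \<Rightarrow> (('a \<Rightarrow> real) \<Rightarrow> real) set" where
  "cfun_dual K = {\<phi>.
     (\<forall>f\<in>cfun K. \<forall>g\<in>cfun K. \<phi> (\<lambda>x\<in>topspace K. f x + g x) = \<phi> f + \<phi> g) \<and>
     (\<forall>c. \<forall>f\<in>cfun K. \<phi> (\<lambda>x\<in>topspace K. c * f x) = c * \<phi> f) \<and>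
     (\<exists>B. \<forall>f\<in>cfun K. \<bar>\<phi> f\<bar> \<le> sup_norm K f * B)}"

definition C_w :: "'a topology \<Rightarrow> ('a \<Rightarrow> real) topology" where
  "C_w K = topology_generated_by
     {{f \<in> cfun K. \<phi> f \<in> U} | \<phi> U. \<phi> \<in> cfun_dual K \<and> open U}"

lemma topspace_order_topology_on [simp]: "topspace (order_topology_on S r) = S"
  by (auto simp: order_topology_on_def topology_generated_by_topspace)

lemma topspace_split_interval:
  "topspace (split_interval A) = {0..1} \<times> {0} \<union> A \<times> {1}"
  by (simp add: split_interval_def)

lemma topspace_C_p [simp]: "topspace (C_p K) = cfun K"
  by (auto simp: C_p_def cfun_def PiE_def)

lemma topspace_C_w [simp]: "topspace (C_w K) = cfun K"
proof -
  have "(\<lambda>_. 0) \<in> cfun_dual K"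
    by (auto simp: cfun_dual_def intro: exI[of _ 0])
  then have "cfun K \<in> {{f \<in> cfun K. \<phi> f \<in> U} | \<phi> U. \<phi> \<in> cfun_dual K \<and> open U}"
    by (intro CollectI exI[of _ "\<lambda>_. 0"] exI[of _ UNIV]) auto
  then show ?thesis
    unfolding C_w_def topology_generated_by_topspace by blast
qed

end

theory Submission
  imports Defs
begin

text \<open>
  A continuous function \<open>f\<close> on the split interval \<open>K\<close> over \<open>X\<close> is a regulated function on \<open>[0, 1]\<close> that
  may jump only at points of \<open>X\<close>; write \<open>E(S)\<close> for the closed subspace of those that jump only at
  points of \<open>S\<close>.  For \<open>x \<notin> S\<close> the space \<open>E(S)\<close> is the kernel of the jump functional at \<open>x\<close> inside
  \<open>E(S \<union> {x})\<close>, so its complement there is disconnected, while \<open>E(S)\<^sup>2\<close> has codimension two in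
  \<open>E(S \<union> {x})\<^sup>2\<close> and its complement is connected.  Hence no homeomorphism of the function space
  with its square can carry both \<open>E(S)\<close> onto \<open>E(S)\<^sup>2\<close> and \<open>E(S \<union> {x})\<close> onto \<open>E(S \<union> {x})\<^sup>2\<close>.  The set
  \<open>X\<close> is built so that every homeomorphism does this for some \<open>S\<close> and \<open>x\<close>.

  For countable \<open>S\<close> the space \<open>E(S)\<close> is separable: rational polynomials plus rational combinations of
  the steps at points of \<open>S\<close> are uniformly dense (\<open>simple_funs_dense\<close>).  The dense set of
  \<open>E(S \<union> {x})\<close> consists of the functions \<open>d + c * step x\<close> with \<open>d\<close> in the dense set of \<open>E(S)\<close> and
  \<open>c\<close> rational.  So everything depends on countably many curves \<open>x \<mapsto> h(d + c * step x)\<close>.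

  The curve \<open>x \<mapsto> step x\<close> is not continuous, but each bounded functional is of bounded variation along
  it, hence continuous at all but countably many points (\<open>countable_discontinuities_dual_step\<close>).  A
  continuous function that depends on the functionals only through finitely many of them at a time,
  with small error, inherits this property; here the functionals have to be finitely independent, which
  is arranged by passing to a maximal independent family (\<open>initially_continuous_along_curve\<close>,
  \<open>free_basis_exists\<close>).  Consequently, for a fixed curve, the relation "the value of the curve at \<open>x\<close>
  has a jump at \<open>y\<close>" between points \<open>x\<close> of \<open>X\<close> and points \<open>y\<close> is, up to countably many \<open>x\<close> and
  \<open>y\<close>, a countable union of G-delta sets of the plane.  If \<open>x \<in> X\<close>, then \<open>y \<in> X\<close>, because functions
  on \<open>K\<close> jump only at points of \<open>X\<close>.

  The set \<open>X\<close> is constructed by transfinite recursion such that a G-delta set off the diagonal which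
  relates points of \<open>X\<close> only to points of \<open>X\<close> is trivial over \<open>X\<close>, namely covered by countably many
  vertical and horizontal lines (\<open>gdelta_rigid_exists\<close>).  There are only continuum many G-delta sets,
  and one with a subset that is not covered in this way contains continuum many points with pairwise
  distinct first and pairwise distinct second coordinates (\<open>not_line_coverable_matching\<close>); so at each
  stage a fresh such point \<open>(x, y)\<close> is left whose first coordinate can be put into \<open>X\<close> and whose second
  coordinate can be kept out of it.

  For this \<open>X\<close> each curve \<open>\<gamma>\<close> has, apart from countably many exceptional \<open>x\<close>, jumps of \<open>\<gamma>(x)\<close> only at
  \<open>x\<close> and at points of a countable set (\<open>jumps_of_curve\<close>).  Closing off a countable \<open>S\<close> under these
  exceptional jump points, and choosing \<open>x \<in> X\<close> outside of \<open>S\<close> and outside of the exceptional sets,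
  gives the required pair.  The argument uses the topology only through a set of bounded functionals that
  contains the evaluations at points, so it covers the pointwise and the weak topology at once.
\<close>

section \<open>Sets of the plane coverable by countably many lines\<close>

definition line_coverable :: "('a \<times> 'b) set \<Rightarrow> bool" where
  "line_coverable Z \<longleftrightarrow> (\<exists>A B. countable A \<and> countable B \<and> Z \<subseteq> A \<times> UNIV \<union> UNIV \<times> B)"

lemma line_coverable_subset: "line_coverable Z \<Longrightarrow> Y \<subseteq> Z \<Longrightarrow> line_coverable Y"
  unfolding line_coverable_def by blast

lemma line_coverable_UN:
  assumes "countable I" and cov: "\<And>i. i \<in> I \<Longrightarrow> line_coverable (Z i)"
  shows "line_coverable (\<Union>i\<in>I. Z i)"
proof -
  obtain A B where "\<And>i. i \<in> I \<Longrightarrow> countable (A i) \<and> countable (B i) \<and> Z i \<subseteq> A i \<times> UNIV \<union> UNIV \<times> B i"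
    using cov unfolding line_coverable_def by metis
  then have "countable (\<Union>i\<in>I. A i)" "countable (\<Union>i\<in>I. B i)"
    "(\<Union>i\<in>I. Z i) \<subseteq> (\<Union>i\<in>I. A i) \<times> UNIV \<union> UNIV \<times> (\<Union>i\<in>I. B i)"
    using \<open>countable I\<close> by (blast intro: countable_UN)+
  then show ?thesis unfolding line_coverable_def by blast
qed

lemma line_coverable_Un: "line_coverable Y \<Longrightarrow> line_coverable Z \<Longrightarrow> line_coverable (Y \<union> Z)"
  using line_coverable_UN[of UNIV "\<lambda>b. if b then Y else Z"] by (auto simp: UNIV_bool Un_commute)

text \<open>
  Being coverable by countably many lines is a sigma-ideal, so by second countability only a negligible
  part of a set lies in open sets that meet it in a negligible set.
\<close>

lemma not_line_coverable_condense:
  fixes Z :: "('a::second_countable_topology \<times> 'b::second_countable_topology) set"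
  assumes "\<not> line_coverable Z"
  defines "Z' \<equiv> {z \<in> Z. \<forall>V. open V \<longrightarrow> z \<in> V \<longrightarrow> \<not> line_coverable (Z \<inter> V)}"
  shows "\<not> line_coverable Z'"
proof
  assume "line_coverable Z'"
  obtain \<B> :: "('a \<times> 'b) set set" where \<B>: "countable \<B>" "topological_basis \<B>"
    using ex_countable_basis by blast
  let ?\<C> = "{V \<in> \<B>. line_coverable (Z \<inter> V)}"
  have "Z \<subseteq> Z' \<union> (\<Union>V\<in>?\<C>. Z \<inter> V)"
  proof
    fix z assume "z \<in> Z"
    show "z \<in> Z' \<union> (\<Union>V\<in>?\<C>. Z \<inter> V)"
    proof (cases "z \<in> Z'")
      case False
      then obtain V where "open V" "z \<in> V" "line_coverable (Z \<inter> V)"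
        using \<open>z \<in> Z\<close> unfolding Z'_def by blast
      moreover then obtain W where "W \<in> \<B>" "z \<in> W" "W \<subseteq> V"
        using \<B>(2) topological_basisE by metis
      ultimately have "W \<in> ?\<C>"
        using line_coverable_subset[of "Z \<inter> V" "Z \<inter> W"] by blast
      then show ?thesis using \<open>z \<in> W\<close> \<open>z \<in> Z\<close> by blast
    qed simp
  qed
  moreover have "line_coverable (Z' \<union> (\<Union>V\<in>?\<C>. Z \<inter> V))"
    by (intro line_coverable_Un \<open>line_coverable Z'\<close> line_coverable_UN) (use \<B> in auto)
  ultimately show False using assms(1) line_coverable_subset by blast
qed

lemma not_line_coverable_split:
  fixes Z :: "('a::{second_countable_topology, heine_borel, metric_space} \<times> 'b::{second_countable_topology, heine_borel, metric_space}) set"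
  assumes "\<not> line_coverable Z" and "Z \<subseteq> U" and "open U"
  obtains K L where "compact K" "compact L" "K \<subseteq> U" "L \<subseteq> U"
    "\<not> line_coverable (Z \<inter> interior K)" "\<not> line_coverable (Z \<inter> interior L)"
    "fst ` K \<inter> fst ` L = {}" "snd ` K \<inter> snd ` L = {}"
proof -
  define Z' where "Z' = {z \<in> Z. \<forall>V. open V \<longrightarrow> z \<in> V \<longrightarrow> \<not> line_coverable (Z \<inter> V)}"
  have nZ': "\<not> line_coverable Z'"
    using not_line_coverable_condense[OF assms(1)] unfolding Z'_def .
  then have "Z' \<noteq> {}" by (auto simp: line_coverable_def)
  then obtain a b where ab: "(a, b) \<in> Z'" by auto
  have "\<not> Z' \<subseteq> {a} \<times> UNIV \<union> UNIV \<times> {b}"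
    using nZ' unfolding line_coverable_def by (metis countable_empty countable_insert)
  then obtain c d where cd: "(c, d) \<in> Z'" "c \<noteq> a" "d \<noteq> b" by auto
  have inU: "(a, b) \<in> U" "(c, d) \<in> U" using ab cd \<open>Z \<subseteq> U\<close> by (auto simp: Z'_def)
  obtain r1 where r1: "r1 > 0" "cball (a, b) r1 \<subseteq> U"
    using open_contains_cball[of U] \<open>open U\<close> inU by blast
  obtain r2 where r2: "r2 > 0" "cball (c, d) r2 \<subseteq> U"
    using open_contains_cball[of U] \<open>open U\<close> inU by blast
  define r where "r = min (min r1 r2) (min (dist a c / 3) (dist b d / 3))"
  have r: "r > 0" "r \<le> r1" "r \<le> r2" "r \<le> dist a c / 3" "r \<le> dist b d / 3"
    using r1 r2 cd by (auto simp: r_def)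
  have dpair: "dist (fst p) (fst q) \<le> dist p q" "dist (snd p) (snd q) \<le> dist p q" for p q :: "'a \<times> 'b"
    by (simp_all add: dist_fst_le dist_snd_le)
  show ?thesis
  proof
    show "compact (cball (a, b) r)" "compact (cball (c, d) r)" by (rule compact_cball)+
    show "cball (a, b) r \<subseteq> U" "cball (c, d) r \<subseteq> U" using r r1 r2 by (auto simp: subset_eq)
    have "ball (a, b) r \<subseteq> interior (cball (a, b) r)" "ball (c, d) r \<subseteq> interior (cball (c, d) r)"
      by (rule interior_maximal[OF ball_subset_cball open_ball])+
    moreover have "\<not> line_coverable (Z \<inter> ball (a, b) r)" "\<not> line_coverable (Z \<inter> ball (c, d) r)"
      using ab cd r(1) by (auto simp: Z'_def)
    ultimately show "\<not> line_coverable (Z \<inter> interior (cball (a, b) r))"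
        "\<not> line_coverable (Z \<inter> interior (cball (c, d) r))"
      by (meson Int_mono line_coverable_subset order_refl)+
    show "fst ` cball (a, b) r \<inter> fst ` cball (c, d) r = {}"
    proof (rule ccontr)
      assume "\<not> ?thesis"
      then obtain p q where pq: "p \<in> cball (a, b) r" "q \<in> cball (c, d) r" "fst p = fst q" by blast
      have "dist a c \<le> dist a (fst p) + dist c (fst q)"
        using pq(3) dist_triangle2[of a c "fst p"] by (simp add: dist_commute)
      also have "\<dots> \<le> r + r"
        using pq dpair(1)[of "(a, b)" p] dpair(1)[of "(c, d)" q] by auto
      finally show False using r by simp
    qed
    show "snd ` cball (a, b) r \<inter> snd ` cball (c, d) r = {}"
    proof (rule ccontr)
      assume "\<not> ?thesis"
      then obtain p q where pq: "p \<in> cball (a, b) r" "q \<in> cball (c, d) r" "snd p = snd q" by blast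
      have "dist b d \<le> dist b (snd p) + dist d (snd q)"
        using pq(3) dist_triangle2[of b d "snd p"] by (simp add: dist_commute)
      also have "\<dots> \<le> r + r"
        using pq dpair(2)[of "(a, b)" p] dpair(2)[of "(c, d)" q] by auto
      finally show False using r by simp
    qed
  qed
qed

text \<open>
  A Cantor scheme: by \<open>not_line_coverable_split\<close> a compact set that meets \<open>Z\<close> in a non-coverable set
  contains two such sets, inside the next open set, whose projections to both axes are disjoint.  The points
  on different branches then differ in both coordinates.
\<close>

lemma not_line_coverable_matching:
  fixes U :: "nat \<Rightarrow> (real \<times> real) set"
  assumes op: "\<And>n. open (U n)" and ZU: "Z \<subseteq> (\<Inter>n. U n)" and nZ: "\<not> line_coverable Z"
  obtains m :: "nat set \<Rightarrow> real \<times> real"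
    where "range m \<subseteq> (\<Inter>n. U n)" "inj (fst \<circ> m)" "inj (snd \<circ> m)"
proof -
  define good where "good K \<longleftrightarrow> compact K \<and> \<not> line_coverable (Z \<inter> interior K)" for K :: "(real \<times> real) set"
  have "\<exists>K' L'. good K' \<and> good L' \<and> K' \<subseteq> interior K \<inter> U n \<and> L' \<subseteq> interior K \<inter> U n \<and>
      fst ` K' \<inter> fst ` L' = {} \<and> snd ` K' \<inter> snd ` L' = {}" if K: "good K" for K n
  proof -
    have sub: "Z \<inter> interior K \<subseteq> interior K \<inter> U n" and op': "open (interior K \<inter> U n)"
      using ZU op by auto
    obtain K' L' where KL: "compact K'" "compact L'" "K' \<subseteq> interior K \<inter> U n" "L' \<subseteq> interior K \<inter> U n"
      "\<not> line_coverable (Z \<inter> interior K \<inter> interior K')" "\<not> line_coverable (Z \<inter> interior K \<inter> interior L')"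
      "fst ` K' \<inter> fst ` L' = {}" "snd ` K' \<inter> snd ` L' = {}"
      using not_line_coverable_split[OF _ sub op'] K unfolding good_def by blast
    have big: "\<not> line_coverable (Z \<inter> interior L)" if "\<not> line_coverable (Z \<inter> interior K \<inter> interior L)" for L
      using that line_coverable_subset[of "Z \<inter> interior L" "Z \<inter> interior K \<inter> interior L"] by auto
    show ?thesis unfolding good_def using KL big by (intro exI[of _ K'] exI[of _ L']) simp
  qed
  then obtain p q where pq: "\<And>K n. good K \<Longrightarrow> good (p K n) \<and> good (q K n) \<and>
      p K n \<subseteq> interior K \<inter> U n \<and> q K n \<subseteq> interior K \<inter> U n \<and>
      fst ` p K n \<inter> fst ` q K n = {} \<and> snd ` p K n \<inter> snd ` q K n = {}"
    by metis
  define c where "c i n K = (if i then p K n else q K n)" for i n K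
  have c: "good (c i n K)" "c i n K \<subseteq> K \<inter> U n" if "good K" for K n i
    using pq[OF that, of n] interior_subset[of K] by (auto simp: c_def)
  have c_disj: "fst ` c True n K \<inter> fst ` c False n K = {}" "snd ` c True n K \<inter> snd ` c False n K = {}"
    if "good K" for K n
    using pq[OF that, of n] by (simp_all add: c_def)
  obtain K0 where K0: "good K0"
  proof -
    have "Z \<subseteq> (\<Union>n::nat. Z \<inter> interior (cball 0 (real n)))"
    proof
      fix z assume "z \<in> Z"
      moreover obtain n where "norm z < real n" using reals_Archimedean2 by blast
      ultimately show "z \<in> (\<Union>n::nat. Z \<inter> interior (cball 0 (real n)))"
        by (auto simp: interior_cball)
    qed
    then have "\<not> line_coverable (\<Union>n::nat. Z \<inter> interior (cball 0 (real n)))"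
      using nZ line_coverable_subset by metis
    then obtain n :: nat where "\<not> line_coverable (Z \<inter> interior (cball 0 (real n)))"
      using line_coverable_UN[of UNIV "\<lambda>n::nat. Z \<inter> interior (cball 0 (real n))"] by auto
    then have "good (cball 0 (real n))" unfolding good_def by (simp add: compact_cball)
    then show ?thesis by (rule that)
  qed
  define F where "F A = rec_nat K0 (\<lambda>n K. c (n \<in> A) n K)" for A :: "nat set"
  have F0: "F A 0 = K0" and FS: "F A (Suc n) = c (n \<in> A) n (F A n)" for A n
    by (simp_all add: F_def)
  have goodF: "good (F A n)" for A n
    by (induction n) (auto simp: F0 FS K0 c(1))
  have sub: "F A (Suc n) \<subseteq> F A n \<inter> U n" for A n
    using c(2)[OF goodF] by (simp add: FS)
  have "\<Inter>(range (F A)) \<noteq> {}" for A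
  proof (rule compact_nest)
    show "compact (F A n)" for n using goodF[of A n] by (simp add: good_def)
    show "F A n \<noteq> {}" for n
    proof
      assume "F A n = {}"
      then show False using goodF[of A n] line_coverable_UN[of "{}"] by (auto simp: good_def)
    qed
    show "F A n \<subseteq> F A k" if "k \<le> n" for k n
      by (rule lift_Suc_antimono_le[OF _ that]) (use sub in blast)
  qed
  then have "\<exists>z. \<forall>n. z \<in> F A n" for A by blast
  then obtain m where m: "\<And>A n. m A \<in> F A n" by metis
  have sep: "fst (m A) \<noteq> fst (m B) \<and> snd (m A) \<noteq> snd (m B)" if "A \<noteq> B" for A B
  proof -
    have "\<exists>n. (n \<in> A) \<noteq> (n \<in> B)" using that by auto
    then obtain n where n: "(n \<in> A) \<noteq> (n \<in> B)" "\<And>k. k < n \<Longrightarrow> (k \<in> A) = (k \<in> B)"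
      using exists_least_iff[of "\<lambda>n. (n \<in> A) \<noteq> (n \<in> B)"] by blast
    have eq: "F A k = F B k" if "k \<le> n" for k
      using that by (induction k) (auto simp: F0 FS n(2))
    have "m A \<in> c (n \<in> A) n (F A n)" "m B \<in> c (n \<in> B) n (F A n)"
      using m[of A "Suc n"] m[of B "Suc n"] eq[of n] by (simp_all add: FS)
    then show ?thesis using c_disj[OF goodF[of A n], of n] n(1)
      by (cases "n \<in> A"; cases "n \<in> B") (auto simp: disjoint_iff)
  qed
  show ?thesis
  proof
    show "range m \<subseteq> (\<Inter>n. U n)" using m sub by blast
    show "inj (fst \<circ> m)" "inj (snd \<circ> m)" using sep by (auto simp: inj_def)
  qed
qed

section \<open>A set rigid for all G-delta relations\<close>

definition off_diagonal :: "(real \<times> real) set" where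
  "off_diagonal = {(x, y). 0 < x \<and> x < 1 \<and> 0 < y \<and> y < 1 \<and> x \<noteq> y}"

lemma open_off_diagonal: "open off_diagonal"
proof -
  have "off_diagonal = {0<..<1} \<times> {0<..<1} \<inter> {p. fst p \<noteq> snd p}"
    by (auto simp: off_diagonal_def)
  moreover have "open {p::real \<times> real. fst p \<noteq> snd p}"
    by (intro open_Collect_neq continuous_intros)
  ultimately show ?thesis by (metis open_Int open_Times open_greaterThanLessThan)
qed

lemma uncountable_minus_nonempty:
  assumes "uncountable A" "countable B" shows "\<exists>x. x \<in> A \<and> x \<notin> B"
  using assms by (metis countable_subset subsetI)

lemma not_line_coverable_off_diagonal:
  assumes "countable C"
  shows "\<not> line_coverable {(x, y) \<in> off_diagonal. x \<notin> C}"
proof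
  assume "line_coverable {(x, y) \<in> off_diagonal. x \<notin> C}"
  then obtain A B where AB: "countable A" "countable B"
    and sub: "{(x, y) \<in> off_diagonal. x \<notin> C} \<subseteq> A \<times> UNIV \<union> UNIV \<times> B"
    unfolding line_coverable_def by blast
  have unc: "uncountable {0<..<1::real}" by (simp add: uncountable_open_interval)
  obtain x where x: "x \<in> {0<..<1}" "x \<notin> A \<union> C"
    using uncountable_minus_nonempty[OF unc, of "A \<union> C"] AB assms by auto
  obtain y where y: "y \<in> {0<..<1}" "y \<notin> insert x B"
    using uncountable_minus_nonempty[OF unc, of "insert x B"] AB by auto
  have "(x, y) \<in> {(x, y) \<in> off_diagonal. x \<notin> C}" using x y by (auto simp: off_diagonal_def)
  then have "(x, y) \<in> A \<times> UNIV \<union> UNIV \<times> B" by (rule subsetD[OF sub])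
  then show False using x y by simp
qed

text \<open>
  A G-delta set is coded by the pairs \<open>(n, i)\<close> such that the \<open>i\<close>-th basic open set lies in the \<open>n\<close>-th
  open set.
\<close>

lemma coded_gdelta_sets:
  "\<exists>G :: nat set \<Rightarrow> 'a::second_countable_topology set. \<forall>U. (\<forall>n::nat. open (U n)) \<longrightarrow> (\<Inter>n. U n) \<in> range G"
proof -
  obtain \<B> :: "'a set set" where \<B>: "countable \<B>" "topological_basis \<B>"
    using ex_countable_basis by blast
  define b where "b = from_nat_into (insert {} \<B>)"
  have b: "range b = insert {} \<B>"
    unfolding b_def by (rule range_from_nat_into) (use \<B> in auto)
  define G where "G C = (\<Inter>n. \<Union>{b i |i. prod_encode (n, i) \<in> C})" for C
  show ?thesis
  proof (intro exI[of _ G] allI impI)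
    fix U :: "nat \<Rightarrow> 'a set" assume "\<forall>n. open (U n)"
    then have op: "\<And>n. open (U n)" by blast
    define C where "C = {k. b (snd (prod_decode k)) \<subseteq> U (fst (prod_decode k))}"
    have "\<Union>{b i |i. prod_encode (n, i) \<in> C} = U n" for n
    proof
      show "\<Union>{b i |i. prod_encode (n, i) \<in> C} \<subseteq> U n" by (auto simp: C_def)
      show "U n \<subseteq> \<Union>{b i |i. prod_encode (n, i) \<in> C}"
      proof
        fix x assume "x \<in> U n"
        then obtain V where V: "V \<in> \<B>" "x \<in> V" "V \<subseteq> U n"
          by (rule topological_basisE[OF \<B>(2) op])
        have "V \<in> range b" using V(1) by (simp add: b)
        then obtain i where i: "b i = V" by (auto simp: image_iff)
        then have "prod_encode (n, i) \<in> C" using V(3) by (simp add: C_def)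
        then show "x \<in> \<Union>{b i |i. prod_encode (n, i) \<in> C}"
          using V(2) i by blast
      qed
    qed
    then show "(\<Inter>n. U n) \<in> range G" by (auto simp: G_def intro!: image_eqI[of _ _ C])
  qed
qed

text \<open>
  Transfinite recursion along a well-order of the index set all of whose initial segments are smaller than
  the index set: fewer than continuum many coordinates have been used before stage \<open>C\<close>, and each of them
  excludes at most one point of the matching \<open>M C\<close>.
\<close>

lemma diagonal_choice:
  includes cardinal_syntax
  fixes M :: "nat set \<Rightarrow> nat set \<Rightarrow> 'a \<times> 'a"
  assumes inj: "\<And>C. inj (fst \<circ> M C)" "\<And>C. inj (snd \<circ> M C)"
    and ne: "\<And>C A. fst (M C A) \<noteq> snd (M C A)"
  obtains p :: "nat set \<Rightarrow> 'a \<times> 'a"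
  where "\<And>C. p C \<in> range (M C)" "\<And>C C'. fst (p C) \<noteq> snd (p C')"
proof -
  let ?r = "|UNIV :: nat set set|"
  have co: "Card_order ?r" by (rule card_of_Card_order)
  have fld: "Field ?r = UNIV" by (rule Field_card_of)
  have wo: "Well_order ?r" using co card_order_on_def by fastforce
  define less where "less = ?r - Id"
  have wf: "wf less" using wo unfolding less_def well_order_on_def by blast
  have under: "underS ?r C = {B. (B, C) \<in> less}" for C
    by (auto simp: underS_def less_def)
  define P where "P f C q \<longleftrightarrow> q \<in> range (M C) \<and> (\<forall>B. (B, C) \<in> less \<longrightarrow> fst q \<noteq> snd (f B) \<and> snd q \<noteq> fst (f B))"
    for f :: "nat set \<Rightarrow> 'a \<times> 'a" and C q
  have "\<exists>p. \<forall>C. P p C (p C)"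
  proof (rule dependent_wf_choice[OF wf])
    show "P f C q = P g C q" if "\<And>B. (B, C) \<in> less \<Longrightarrow> f B = g B" for f g C q
      using that by (auto simp: P_def)
    fix C and f :: "nat set \<Rightarrow> 'a \<times> 'a"
    let ?S = "{B. (B, C) \<in> less}"
    define bad1 where "bad1 = {A. fst (M C A) \<in> (snd \<circ> f) ` ?S}"
    define bad2 where "bad2 = {A. snd (M C A) \<in> (fst \<circ> f) ` ?S}"
    have S: "|?S| <o ?r" using card_of_underS[OF co, of C] fld by (simp add: under)
    have le: "|A| \<le>o |?S|" if "inj_on h A" "h ` A \<subseteq> g ` ?S" for A :: "nat set set" and h :: "nat set \<Rightarrow> 'a" and g
      using that card_of_ordLeqI[of h A "g ` ?S"] card_of_image[of g ?S] ordLeq_transitive by blast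
    have "|bad1| \<le>o |?S|"
      by (rule le[of "fst \<circ> M C" _ "snd \<circ> f"]) (use inj in \<open>auto simp: bad1_def inj_on_def inj_def\<close>)
    moreover have "|bad2| \<le>o |?S|"
      by (rule le[of "snd \<circ> M C" _ "fst \<circ> f"]) (use inj in \<open>auto simp: bad2_def inj_on_def inj_def\<close>)
    moreover have "infinite (UNIV :: nat set set)" by (simp add: Finite_Set.finite_set)
    ultimately have "|bad1 \<union> bad2| <o ?r"
      using S by (intro card_of_Un_ordLess_infinite) (auto intro: ordLeq_ordLess_trans)
    then have "bad1 \<union> bad2 \<noteq> UNIV" using ordLess_irreflexive by metis
    then obtain A where "A \<notin> bad1" "A \<notin> bad2" by blast
    then show "\<exists>q. P f C q" unfolding P_def bad1_def bad2_def
      by (intro exI[of _ "M C A"]) auto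
  qed
  then obtain p where p: "\<And>C. P p C (p C)" by blast
  show ?thesis
  proof
    show 1: "p C \<in> range (M C)" for C using p by (auto simp: P_def)
    fix C C'
    have "C = C' \<or> (C, C') \<in> less \<or> (C', C) \<in> less"
      using wo fld unfolding less_def well_order_on_def linear_order_on_def total_on_def by auto
    then show "fst (p C) \<noteq> snd (p C')"
      using p[of C] p[of C'] 1[of C] ne unfolding P_def by fastforce
  qed
qed

text \<open>
  \<open>X\<close> consists of the first coordinates of the pairs chosen by \<open>diagonal_choice\<close> from the G-delta sets that contain
  a matching.  If \<open>X\<close> were countable, then the set of off-diagonal points with first coordinate outside of \<open>X\<close> would
  be one of these G-delta sets, and the pair chosen from it would have its first coordinate both in \<open>X\<close> and
  outside of \<open>X\<close>.
\<close>

lemma gdelta_rigid_set: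
  obtains X :: "real set" where "X \<subseteq> {0<..<1}"
    "\<And>U. \<lbrakk>\<And>n. open (U n); (\<Inter>n. U n) \<subseteq> off_diagonal; \<And>x y. (x, y) \<in> (\<Inter>n. U n) \<Longrightarrow> x \<in> X \<Longrightarrow> y \<in> X\<rbrakk>
         \<Longrightarrow> line_coverable {(x, y) \<in> \<Inter>n::nat. U n. x \<in> X}"
    "uncountable X"
proof -
  obtain G :: "nat set \<Rightarrow> (real \<times> real) set"
    where G: "\<forall>U. (\<forall>n::nat. open (U n)) \<longrightarrow> (\<Inter>n. U n) \<in> range G"
    using coded_gdelta_sets by (rule exE)
  (* A matching is a set of continuum many points in which each line meets at most one point. *)
  define matching where "matching m W \<longleftrightarrow> range m \<subseteq> W \<and> inj (fst \<circ> m) \<and> inj (snd \<circ> m)"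
    for m :: "nat set \<Rightarrow> real \<times> real" and W
  have ndiag: "\<not> line_coverable off_diagonal"
    using not_line_coverable_off_diagonal[of "{}"] by simp
  have matchingI: "\<exists>m. matching m (\<Inter>n. U n)"
    if "\<And>n::nat. open (U n)" "Z \<subseteq> (\<Inter>n. U n)" "\<not> line_coverable Z" for U Z
    using not_line_coverable_matching[OF that] unfolding matching_def by metis
  obtain m0 where m0: "matching m0 off_diagonal"
    using matchingI[of "\<lambda>_. off_diagonal" off_diagonal] ndiag open_off_diagonal by auto
  have "\<exists>m. matching m off_diagonal \<and> (\<forall>m'. matching m' (G C \<inter> off_diagonal) \<longrightarrow> range m \<subseteq> G C)" for C
  proof (cases "\<exists>m'. matching m' (G C \<inter> off_diagonal)")
    case True
    then obtain m' where "matching m' (G C \<inter> off_diagonal)" by blast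
    then have "matching m' off_diagonal" "range m' \<subseteq> G C" unfolding matching_def by auto
    then show ?thesis by blast
  next
    case False
    then show ?thesis using m0 by blast
  qed
  then obtain M where M: "\<And>C. matching (M C) off_diagonal"
    and MG: "\<And>C m'. matching m' (G C \<inter> off_diagonal) \<Longrightarrow> range (M C) \<subseteq> G C"
    by metis
  have "fst (M C A) \<noteq> snd (M C A)" for C A
  proof -
    have "M C A \<in> off_diagonal" using M[of C] by (auto simp: matching_def)
    then show ?thesis by (auto simp: off_diagonal_def split_beta)
  qed
  moreover have "inj (fst \<circ> M C)" "inj (snd \<circ> M C)" for C
    using M[of C] by (auto simp: matching_def)
  ultimately obtain p where p: "\<And>C. p C \<in> range (M C)" "\<And>C C'. fst (p C) \<noteq> snd (p C')"
    using diagonal_choice[of M] by metis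
  define X where "X = range (fst \<circ> p)"
  have pD: "p C \<in> off_diagonal" for C using p(1)[of C] M[of C] unfolding matching_def by blast
  have main: "\<exists>x y. (x, y) \<in> (\<Inter>n. U n) \<and> x \<in> X \<and> y \<notin> X"
    if op: "\<And>n::nat. open (U n)" and sub: "(\<Inter>n. U n) \<subseteq> off_diagonal"
      and Z: "Z \<subseteq> (\<Inter>n. U n)" "\<not> line_coverable Z" for U Z
  proof -
    have "(\<Inter>n. U n) \<in> range G" using G op by simp
    then obtain C where C: "(\<Inter>n. U n) = G C" by (rule rangeE)
    obtain m where "matching m (\<Inter>n. U n)" using matchingI[OF op Z] by blast
    then have "range (M C) \<subseteq> (\<Inter>n. U n)" using MG[of m C] C sub by (simp add: Int_absorb2)
    then have "p C \<in> (\<Inter>n. U n)" using p(1) by (rule subsetD)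
    moreover have "fst (p C) \<in> X" "snd (p C) \<notin> X" using p(2) by (auto simp: X_def dest: sym)
    ultimately show ?thesis by (metis prod.collapse)
  qed
  show ?thesis
  proof
    show "X \<subseteq> {0<..<1}"
      using pD by (force simp: X_def off_diagonal_def split_beta)
    show "line_coverable {(x, y) \<in> \<Inter>n. U n. x \<in> X}"
      if "\<And>n::nat. open (U n)" "(\<Inter>n. U n) \<subseteq> off_diagonal"
        "\<And>x y. (x, y) \<in> (\<Inter>n. U n) \<Longrightarrow> x \<in> X \<Longrightarrow> y \<in> X" for U
    proof (rule ccontr)
      assume "\<not> line_coverable {(x, y) \<in> \<Inter>n. U n. x \<in> X}"
      moreover have "{(x, y) \<in> \<Inter>n. U n. x \<in> X} \<subseteq> (\<Inter>n. U n)" by (intro subsetI) (simp add: split_beta)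
      ultimately have "\<exists>x y. (x, y) \<in> (\<Inter>n. U n) \<and> x \<in> X \<and> y \<notin> X"
        by (intro main[OF that(1,2)])
      then show False using that(3) by metis
    qed
    show "uncountable X"
    proof
      assume cX: "countable X"
      define e where "e = from_nat_into X"
      have "X \<noteq> {}" by (auto simp: X_def)
      then have e: "range e = X" using cX unfolding e_def by (simp add: range_from_nat_into)
      define U where "U n = off_diagonal \<inter> {p. fst p \<noteq> e n}" for n
      have op: "open (U n)" for n unfolding U_def
        by (intro open_Int open_off_diagonal open_Collect_neq continuous_intros)
      have U: "(\<Inter>n. U n) = {(x, y) \<in> off_diagonal. x \<notin> X}" by (auto simp: U_def simp flip: e)
      show False
      proof -
        have "(\<Inter>n. U n) \<subseteq> off_diagonal" by (auto simp: U_def)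
        then have "\<exists>x y. (x, y) \<in> (\<Inter>n. U n) \<and> x \<in> X \<and> y \<notin> X"
          using not_line_coverable_off_diagonal[OF cX] unfolding U[symmetric]
          by (intro main[of U, OF op _ order_refl])
        then show False unfolding U by auto
      qed
    qed
  qed
qed

definition gdelta_rigid :: "real set \<Rightarrow> bool" where
  "gdelta_rigid X \<longleftrightarrow> (\<forall>\<U>. countable \<U> \<longrightarrow> (\<forall>U\<in>\<U>. open U) \<longrightarrow> \<Inter>\<U> \<subseteq> off_diagonal \<longrightarrow>
     (\<forall>x y. (x, y) \<in> \<Inter>\<U> \<longrightarrow> x \<in> X \<longrightarrow> y \<in> X) \<longrightarrow> line_coverable {p \<in> \<Inter>\<U>. fst p \<in> X})"

lemma gdelta_rigidD:
  assumes "gdelta_rigid X" "countable \<U>" "\<And>U. U \<in> \<U> \<Longrightarrow> open U" "\<Inter>\<U> \<subseteq> off_diagonal"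
    "\<And>x y. (x, y) \<in> \<Inter>\<U> \<Longrightarrow> x \<in> X \<Longrightarrow> y \<in> X"
  shows "line_coverable {p \<in> \<Inter>\<U>. fst p \<in> X}"
proof -
  have "\<forall>U\<in>\<U>. open U" "\<forall>x y. (x, y) \<in> \<Inter>\<U> \<longrightarrow> x \<in> X \<longrightarrow> y \<in> X" using assms(3,5) by fast+
  with assms(1,2,4) show ?thesis unfolding gdelta_rigid_def by simp
qed

lemma gdelta_rigid_exists:
  obtains X :: "real set" where "X \<subseteq> {0<..<1}" "gdelta_rigid X" "uncountable X"
proof -
  obtain X :: "real set" where X: "X \<subseteq> {0<..<1}"
    "\<And>U. \<lbrakk>\<And>n. open (U n); (\<Inter>n. U n) \<subseteq> off_diagonal; \<And>x y. (x, y) \<in> (\<Inter>n. U n) \<Longrightarrow> x \<in> X \<Longrightarrow> y \<in> X\<rbrakk>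
         \<Longrightarrow> line_coverable {(x, y) \<in> \<Inter>n::nat. U n. x \<in> X}"
    "uncountable X" by (rule gdelta_rigid_set) blast
  have "gdelta_rigid X" unfolding gdelta_rigid_def
  proof (intro allI impI)
    fix \<U> :: "(real \<times> real) set set"
    assume \<U>: "countable \<U>" "\<forall>U\<in>\<U>. open U" "\<Inter>\<U> \<subseteq> off_diagonal"
      "\<forall>x y. (x, y) \<in> \<Inter>\<U> \<longrightarrow> x \<in> X \<longrightarrow> y \<in> X"
    have ne: "\<U> \<noteq> {}" using \<U>(3) by (auto simp: off_diagonal_def)
    have r: "range (from_nat_into \<U>) = \<U>" by (rule range_from_nat_into[OF ne \<U>(1)])
    have "line_coverable {(x, y) \<in> \<Inter>n. from_nat_into \<U> n. x \<in> X}"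
    proof (rule X(2))
      show "open (from_nat_into \<U> n)" for n using \<U>(2) from_nat_into[OF ne] by blast
    qed (use \<U>(3,4) in \<open>simp_all add: r\<close>)
    moreover have "{p \<in> \<Inter>\<U>. fst p \<in> X} = {(x, y) \<in> \<Inter>n. from_nat_into \<U> n. x \<in> X}" unfolding r by auto
    ultimately show "line_coverable {p \<in> \<Inter>\<U>. fst p \<in> X}" by (simp only:)
  qed
  then show ?thesis by (rule that[OF X(1) _ X(3)])
qed

section \<open>Continuous functions along curves\<close>

definition discontinuities :: "real set \<Rightarrow> (real \<Rightarrow> real) \<Rightarrow> real set" where
  "discontinuities X f = {x \<in> X. \<not> continuous (at x within X) f}"

text \<open>
  Continuity of \<open>\<phi>\<close> on \<open>V\<close> for the initial topology of the family \<open>ev\<close>, without reference to a topology on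
  \<open>V\<close>.
\<close>

definition initially_continuous :: "'i set \<Rightarrow> ('i \<Rightarrow> 'v \<Rightarrow> real) \<Rightarrow> 'v set \<Rightarrow> ('v \<Rightarrow> real) \<Rightarrow> bool" where
  "initially_continuous I ev V \<phi> \<longleftrightarrow>
     (\<forall>v\<in>V. \<forall>\<epsilon>>0. \<exists>F \<delta>. finite F \<and> F \<subseteq> I \<and> \<delta> > 0 \<and>
        (\<forall>w\<in>V. (\<forall>b\<in>F. \<bar>ev b w - ev b v\<bar> < \<delta>) \<longrightarrow> \<bar>\<phi> w - \<phi> v\<bar> < \<epsilon>))"

text \<open>
  For linear functionals on a vector space this is linear independence; this form also makes sense for the
  pairs of functions used for the square.
\<close>

definition finitely_free :: "'i set \<Rightarrow> ('i \<Rightarrow> 'v \<Rightarrow> real) \<Rightarrow> 'v set \<Rightarrow> bool" where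
  "finitely_free I ev V \<longleftrightarrow> (\<forall>F c. finite F \<longrightarrow> F \<subseteq> I \<longrightarrow> (\<exists>v\<in>V. \<forall>b\<in>F. ev b v = c b))"

lemma uncountable_fibre:
  fixes g :: "'a \<Rightarrow> 'b::countable"
  assumes "uncountable A"
  obtains n where "uncountable {a \<in> A. g a = n}"
proof (rule ccontr)
  assume "\<not> thesis"
  then have "countable {a \<in> A. g a = n}" for n using that by blast
  then have "countable (\<Union>n. {a \<in> A. g a = n})" by (intro countable_UN) auto
  moreover have "(\<Union>n. {a \<in> A. g a = n}) = A" by auto
  ultimately show False using assms by simp
qed

text \<open>
  The diagonal copy of \<open>T\<close> in the plane is coverable by countably many lines exactly if \<open>T\<close> is
  countable.
\<close>

lemma condensation_point:
  fixes T :: "real set"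
  assumes "uncountable T"
  obtains x where "x \<in> T" "\<And>\<eta>. \<eta> > 0 \<Longrightarrow> uncountable (T \<inter> ball x \<eta>)"
proof -
  define Z where "Z = (\<lambda>t. (t, t)) ` T"
  have cov: "countable (T \<inter> S)" if cov: "line_coverable (Z \<inter> S \<times> UNIV)" for S
  proof -
    obtain A B where AB: "countable A" "countable B" "Z \<inter> S \<times> UNIV \<subseteq> A \<times> UNIV \<union> UNIV \<times> B"
      using cov unfolding line_coverable_def by metis
    have "t \<in> A \<union> B" if "t \<in> T \<inter> S" for t
      using subsetD[OF AB(3), of "(t, t)"] that by (auto simp: Z_def)
    then show ?thesis using AB(1,2) by (meson countable_Un countable_subset subsetI)
  qed
  have "\<not> line_coverable Z" using cov[of UNIV] assms by auto
  then have "\<not> line_coverable {z \<in> Z. \<forall>V. open V \<longrightarrow> z \<in> V \<longrightarrow> \<not> line_coverable (Z \<inter> V)}"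
    by (rule not_line_coverable_condense)
  then have "{z \<in> Z. \<forall>V. open V \<longrightarrow> z \<in> V \<longrightarrow> \<not> line_coverable (Z \<inter> V)} \<noteq> {}"
    by (metis countable_empty empty_subsetI line_coverable_def)
  then obtain z where z: "z \<in> Z" "\<And>V. open V \<Longrightarrow> z \<in> V \<Longrightarrow> \<not> line_coverable (Z \<inter> V)" by auto
  then obtain x where x: "x \<in> T" "z = (x, x)" by (auto simp: Z_def)
  show ?thesis
  proof
    show "x \<in> T" by fact
    show "uncountable (T \<inter> ball x \<eta>)" if "\<eta> > 0" for \<eta>
    proof
      assume c: "countable (T \<inter> ball x \<eta>)"
      have "Z \<inter> ball x \<eta> \<times> UNIV \<subseteq> (T \<inter> ball x \<eta>) \<times> UNIV \<union> UNIV \<times> {}" by (auto simp: Z_def)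
      then have "line_coverable (Z \<inter> ball x \<eta> \<times> UNIV)"
        unfolding line_coverable_def using c countable_empty by metis
      moreover have "open (ball x \<eta> \<times> (UNIV :: real set))" by (intro open_Times open_ball open_UNIV)
      moreover have "z \<in> ball x \<eta> \<times> (UNIV :: real set)" using x that by simp
      ultimately show False using z(2) by metis
    qed
  qed
qed

text \<open>
  A weak form of the Delta-system lemma: \<open>R\<close> is a set of maximal size among those contained in uncountably
  many \<open>F t\<close>, where all \<open>F t\<close> have the same size.  Disjointness outside of \<open>R\<close> is replaced by the weaker
  statement that each other element lies in only countably many of the sets.
\<close>

lemma common_root:
  fixes F :: "'a \<Rightarrow> 'b set"
  assumes T: "uncountable T" and fin: "\<And>t. t \<in> T \<Longrightarrow> finite (F t)"
  obtains R T' where "finite R" "T' \<subseteq> T" "uncountable T'" "\<And>t. t \<in> T' \<Longrightarrow> R \<subseteq> F t"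
    "\<And>b. b \<notin> R \<Longrightarrow> countable {t \<in> T'. b \<in> F t}"
proof -
  obtain n where n: "uncountable {t \<in> T. card (F t) = n}" by (rule uncountable_fibre[OF T])
  define S where "S R = {t \<in> T. card (F t) = n \<and> R \<subseteq> F t}" for R
  define P where "P R \<longleftrightarrow> finite R \<and> uncountable (S R)" for R
  have "P {}" using n by (simp add: P_def S_def)
  moreover have "card R \<le> n" if "P R" for R
  proof -
    have "S R \<noteq> {}" using that unfolding P_def by (metis countable_empty)
    then obtain t where "t \<in> T" "card (F t) = n" "R \<subseteq> F t" by (auto simp: S_def)
    then show ?thesis using card_mono[OF fin] by blast
  qed
  then have "\<forall>R. P R \<longrightarrow> card R < Suc n" by (simp add: less_Suc_eq_le)
  ultimately obtain R where R: "P R" and max: "\<And>R'. P R' \<Longrightarrow> card R' \<le> card R"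
    using ex_has_greatest_nat[of P "{}" card "Suc n"] by metis
  show ?thesis
  proof
    show "finite R" "uncountable (S R)" using R by (auto simp: P_def)
    show "S R \<subseteq> T" "\<And>t. t \<in> S R \<Longrightarrow> R \<subseteq> F t" by (auto simp: S_def)
    fix b assume b: "b \<notin> R"
    have "\<not> P (insert b R)" using max[of "insert b R"] b \<open>finite R\<close> by auto
    then have "countable (S (insert b R))" using \<open>finite R\<close> by (simp add: P_def)
    moreover have "S (insert b R) = {t \<in> S R. b \<in> F t}" by (auto simp: S_def)
    ultimately show "countable {t \<in> S R. b \<in> F t}" by simp
  qed
qed

lemma floor_eq_imp_near:
  fixes a b c :: real
  assumes "\<lfloor>a / c\<rfloor> = \<lfloor>b / c\<rfloor>" "c > 0"
  shows "\<bar>a - b\<bar> < c"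
  using floor_divide_lower[of c a] floor_divide_upper[of c a]
    floor_divide_lower[of c b] floor_divide_upper[of c b] assms
  by (simp add: algebra_simps)

text \<open>
  If \<open>\<phi>\<close> oscillated by \<open>\<epsilon>\<close> along the curve at uncountably many points, then uncountably many of these points
  would have nearly equal values of \<open>\<phi>\<close>, a common tolerance \<open>\<delta>\<close> and a common root \<open>R\<close> of the finite sets of
  functionals that determine \<open>\<phi>\<close> up to \<open>\<epsilon> / 4\<close>.  Let \<open>x\<close> be a condensation point of them, at which the functionals
  in \<open>R\<close> are continuous, and \<open>x'\<close> a nearby point with \<open>\<phi> (\<gamma> x')\<close> far from \<open>\<phi> (\<gamma> x)\<close>.  Some further point
  \<open>t\<close> near \<open>x\<close> has a set of functionals that meets the one of \<open>x'\<close> only in \<open>R\<close>.  By freeness an element \<open>w\<close>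
  imitates \<open>\<gamma> x'\<close> and \<open>\<gamma> t\<close> simultaneously, so \<open>\<phi> w\<close> is close to two values that are far apart.
\<close>

lemma initially_continuous_along_curve:
  fixes \<gamma> :: "real \<Rightarrow> 'v" and ev :: "'i \<Rightarrow> 'v \<Rightarrow> real"
  assumes cont: "initially_continuous I ev V \<phi>" and free: "finitely_free I ev V"
    and \<gamma>: "\<And>x. x \<in> X \<Longrightarrow> \<gamma> x \<in> V"
    and ev: "\<And>b. b \<in> I \<Longrightarrow> countable (discontinuities X (\<lambda>x. ev b (\<gamma> x)))"
  shows "countable (discontinuities X (\<lambda>x. \<phi> (\<gamma> x)))"
proof (rule ccontr)
  assume unc: "uncountable (discontinuities X (\<lambda>x. \<phi> (\<gamma> x)))"
  let ?D = "discontinuities X (\<lambda>x. \<phi> (\<gamma> x))"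
  have osc: "\<exists>e>0. \<forall>d>0. \<exists>x'\<in>X. \<bar>x' - x\<bar> < d \<and> \<bar>\<phi> (\<gamma> x') - \<phi> (\<gamma> x)\<bar> \<ge> e" if "x \<in> ?D" for x
    using that unfolding discontinuities_def continuous_within_eps_delta dist_real_def
    by (simp add: not_less) (meson not_le)
  have "\<exists>n. \<forall>d>0. \<exists>x'\<in>X. \<bar>x' - x\<bar> < d \<and> \<bar>\<phi> (\<gamma> x') - \<phi> (\<gamma> x)\<bar> \<ge> inverse (real (Suc n))"
    if xD: "x \<in> ?D" for x
  proof -
    obtain e where e: "e > 0" "\<And>d. d > 0 \<Longrightarrow> \<exists>x'\<in>X. \<bar>x' - x\<bar> < d \<and> \<bar>\<phi> (\<gamma> x') - \<phi> (\<gamma> x)\<bar> \<ge> e"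
      using osc[OF xD] by metis
    obtain n where "inverse (real (Suc n)) < e" using reals_Archimedean[OF e(1)] by blast
    then show ?thesis using e(2) by (meson less_imp_le order_trans)
  qed
  then obtain N :: "real \<Rightarrow> nat" where N: "\<And>x d. x \<in> ?D \<Longrightarrow> d > 0 \<Longrightarrow>
      \<exists>x'\<in>X. \<bar>x' - x\<bar> < d \<and> \<bar>\<phi> (\<gamma> x') - \<phi> (\<gamma> x)\<bar> \<ge> inverse (real (Suc (N x)))"
    by metis
  obtain n where n: "uncountable {x \<in> ?D. N x = n}" by (rule uncountable_fibre[OF unc])
  define \<epsilon> where "\<epsilon> = inverse (real (Suc n))"
  have \<epsilon>: "\<epsilon> > 0" by (simp add: \<epsilon>_def)
  (* Sorting by this integer makes the values of \<phi> differ by less than \<epsilon> / 4. *)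
  define k where "k x = \<lfloor>\<phi> (\<gamma> x) / (\<epsilon> / 4)\<rfloor>" for x
  obtain l where l: "uncountable {x \<in> {x \<in> ?D. N x = n}. k x = l}" by (rule uncountable_fibre[OF n])
  define D1 where "D1 = {x \<in> {x \<in> ?D. N x = n}. k x = l}"
  have D1: "x \<in> X" if "x \<in> D1" for x using that by (simp add: D1_def discontinuities_def)
  have jump: "\<exists>x'\<in>X. \<bar>x' - x\<bar> < d \<and> \<bar>\<phi> (\<gamma> x') - \<phi> (\<gamma> x)\<bar> \<ge> \<epsilon>" if "x \<in> D1" "d > 0" for x d
    using N[of x d] that by (simp add: D1_def \<epsilon>_def)
  have near: "\<bar>\<phi> (\<gamma> x) - \<phi> (\<gamma> y)\<bar> < \<epsilon> / 4" if "x \<in> D1" "y \<in> D1" for x y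
  proof -
    have "\<lfloor>\<phi> (\<gamma> x) / (\<epsilon> / 4)\<rfloor> = \<lfloor>\<phi> (\<gamma> y) / (\<epsilon> / 4)\<rfloor>" using that by (simp add: D1_def k_def)
    then show ?thesis using \<epsilon> by (intro floor_eq_imp_near) auto
  qed
  have "\<epsilon> / 4 > 0" using \<epsilon> by simp
  have nbhd: "\<exists>F \<delta>. finite F \<and> F \<subseteq> I \<and> \<delta> > 0 \<and>
        (\<forall>w\<in>V. (\<forall>b\<in>F. \<bar>ev b w - ev b (\<gamma> x)\<bar> < \<delta>) \<longrightarrow> \<bar>\<phi> w - \<phi> (\<gamma> x)\<bar> < \<epsilon> / 4)" if "x \<in> X" for x
    using cont \<gamma>[OF that] \<open>\<epsilon> / 4 > 0\<close> unfolding initially_continuous_def by blast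
  have "\<exists>F n. finite F \<and> F \<subseteq> I \<and>
        (\<forall>w\<in>V. (\<forall>b\<in>F. \<bar>ev b w - ev b (\<gamma> x)\<bar> < inverse (real (Suc n))) \<longrightarrow> \<bar>\<phi> w - \<phi> (\<gamma> x)\<bar> < \<epsilon> / 4)"
    if xX: "x \<in> X" for x
  proof -
    obtain F \<delta> where F: "finite F" "F \<subseteq> I" "\<delta> > 0"
      "\<And>w. w \<in> V \<Longrightarrow> (\<forall>b\<in>F. \<bar>ev b w - ev b (\<gamma> x)\<bar> < \<delta>) \<Longrightarrow> \<bar>\<phi> w - \<phi> (\<gamma> x)\<bar> < \<epsilon> / 4"
      using nbhd[OF xX] by metis
    obtain n where "inverse (real (Suc n)) < \<delta>" using reals_Archimedean \<open>\<delta> > 0\<close> by blast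
    then show ?thesis using F by (intro exI[of _ F] exI[of _ n]) force
  qed
  then obtain F :: "real \<Rightarrow> 'i set" and m :: "real \<Rightarrow> nat" where F: "\<And>x. x \<in> X \<Longrightarrow> finite (F x)" "\<And>x. x \<in> X \<Longrightarrow> F x \<subseteq> I"
      "\<And>x w. x \<in> X \<Longrightarrow> w \<in> V \<Longrightarrow> (\<And>b. b \<in> F x \<Longrightarrow> \<bar>ev b w - ev b (\<gamma> x)\<bar> < inverse (real (Suc (m x)))) \<Longrightarrow>
        \<bar>\<phi> w - \<phi> (\<gamma> x)\<bar> < \<epsilon> / 4"
    by metis
  obtain j where j: "uncountable {x \<in> D1. m x = j}" using uncountable_fibre l unfolding D1_def[symmetric] by metis
  define \<delta> where "\<delta> = inverse (real (Suc j))"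
  have \<delta>: "\<delta> > 0" by (simp add: \<delta>_def)
  obtain R T where R: "finite R" "T \<subseteq> {x \<in> D1. m x = j}" "uncountable T" "\<And>t. t \<in> T \<Longrightarrow> R \<subseteq> F t"
    "\<And>b. b \<notin> R \<Longrightarrow> countable {t \<in> T. b \<in> F t}"
    by (rule common_root[OF j, of F]) (use F(1) D1 in auto)
  have "T \<noteq> {}" using R(3) by auto
  then obtain t0 where "t0 \<in> T" by blast
  then have "R \<subseteq> F t0" "t0 \<in> X" using R(2,4) D1 by auto
  then have RI: "R \<subseteq> I" using F(2)[of t0] by simp
  define T' where "T' = T - (\<Union>b\<in>R. discontinuities X (\<lambda>x. ev b (\<gamma> x)))"
  have "countable (\<Union>b\<in>R. discontinuities X (\<lambda>x. ev b (\<gamma> x)))"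
    using R(1) RI ev by (intro countable_UN[OF countable_finite]) auto
  then have "uncountable T'" unfolding T'_def by (rule uncountable_minus_countable[OF R(3)])
  then obtain x where x: "x \<in> T'" "\<And>\<eta>. \<eta> > 0 \<Longrightarrow> uncountable (T' \<inter> ball x \<eta>)"
    using condensation_point by metis
  have xX: "x \<in> D1" "x \<in> X" using x(1) R(2) D1 by (auto simp: T'_def)
  have "\<exists>\<eta>>0. \<forall>x'\<in>X. \<bar>x' - x\<bar> < \<eta> \<longrightarrow> \<bar>ev b (\<gamma> x') - ev b (\<gamma> x)\<bar> < \<delta> / 2" if "b \<in> R" for b
  proof -
    have "continuous (at x within X) (\<lambda>x. ev b (\<gamma> x))"
      using x(1) xX that by (auto simp: T'_def discontinuities_def)
    then show ?thesis using \<delta> unfolding continuous_within_eps_delta dist_real_def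
      by (metis half_gt_zero)
  qed
  then obtain h where h: "\<And>b. b \<in> R \<Longrightarrow> h b > 0"
    "\<And>b x'. b \<in> R \<Longrightarrow> x' \<in> X \<Longrightarrow> \<bar>x' - x\<bar> < h b \<Longrightarrow> \<bar>ev b (\<gamma> x') - ev b (\<gamma> x)\<bar> < \<delta> / 2"
    by metis
  define \<eta> where "\<eta> = Min (insert 1 (h ` R))"
  have \<eta>: "\<eta> > 0" using R(1) h(1) by (simp add: \<eta>_def)
  have \<eta>h: "\<eta> \<le> h b" if "b \<in> R" for b using R(1) that by (simp add: \<eta>_def)
  have close: "\<bar>ev b (\<gamma> x') - ev b (\<gamma> x)\<bar> < \<delta> / 2" if "b \<in> R" "x' \<in> X" "\<bar>x' - x\<bar> < \<eta>" for b x'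
    using h(2)[OF that(1,2)] \<eta>h[OF that(1)] that(3) by simp
  obtain x' where x': "x' \<in> X" "\<bar>x' - x\<bar> < \<eta>" "\<bar>\<phi> (\<gamma> x') - \<phi> (\<gamma> x)\<bar> \<ge> \<epsilon>"
    using jump[OF xX(1) \<eta>] by metis
  have "countable (\<Union>b\<in>F x' - R. {t \<in> T. b \<in> F t})"
    using F(1)[OF x'(1)] R(5) by (intro countable_UN[OF countable_finite]) auto
  then obtain t where tt: "t \<in> T' \<inter> ball x \<eta>" and tF: "t \<notin> (\<Union>b\<in>F x' - R. {t \<in> T. b \<in> F t})"
    using uncountable_minus_nonempty[OF x(2)[OF \<eta>]] by blast
  have t: "t \<in> T'" "\<bar>t - x\<bar> < \<eta>"
    using tt by (simp_all add: dist_real_def abs_minus_commute)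
  have tX: "t \<in> T" "t \<in> D1" "m t = j" "t \<in> X" using t(1) R(2) D1 by (auto simp: T'_def)
  have disj: "b \<in> R" if "b \<in> F t" "b \<in> F x'" for b using tF tX(1) that by blast
  have "\<exists>w\<in>V. \<forall>b\<in>F t \<union> F x'. ev b w = (if b \<in> F x' \<union> R then ev b (\<gamma> x') else ev b (\<gamma> t))"
  proof -
    have "finite (F t \<union> F x')" "F t \<union> F x' \<subseteq> I" using F(1,2) tX x' by auto
    then show ?thesis by (rule free[unfolded finitely_free_def, rule_format])
  qed
  then obtain w where w: "w \<in> V" "\<And>b. b \<in> F t \<union> F x' \<Longrightarrow> ev b w = (if b \<in> F x' \<union> R then ev b (\<gamma> x') else ev b (\<gamma> t))"
    by metis
  have 1: "\<bar>\<phi> w - \<phi> (\<gamma> x')\<bar> < \<epsilon> / 4"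
    by (rule F(3)[OF x'(1) w(1)]) (use w(2) in simp)
  have 2: "\<bar>\<phi> w - \<phi> (\<gamma> t)\<bar> < \<epsilon> / 4"
  proof (rule F(3)[OF tX(4) w(1)])
    fix b assume b: "b \<in> F t"
    show "\<bar>ev b w - ev b (\<gamma> t)\<bar> < inverse (real (Suc (m t)))"
    proof (cases "b \<in> R")
      case True
      then have "ev b w = ev b (\<gamma> x')" using w(2) b by simp
      moreover have "\<bar>ev b (\<gamma> x') - ev b (\<gamma> x)\<bar> < \<delta> / 2" "\<bar>ev b (\<gamma> t) - ev b (\<gamma> x)\<bar> < \<delta> / 2"
        using close True x' t tX by auto
      ultimately show ?thesis unfolding tX(3) \<delta>_def[symmetric] by linarith
    next
      case False
      then have "ev b w = ev b (\<gamma> t)" using w(2) b disj by auto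
      then show ?thesis by simp
    qed
  qed
  have "\<bar>\<phi> (\<gamma> t) - \<phi> (\<gamma> x)\<bar> < \<epsilon> / 4" by (rule near[OF tX(2) xX(1)])
  then show False using 1 2 x'(3) \<epsilon> by linarith
qed

section \<open>Linear algebra in spaces of continuous functions\<close>

text \<open>
  The one linear operation \<open>f + c * g\<close> on functions represented with value \<open>undefined\<close> outside of the space;
  all vector space arguments below are expressed by it.
\<close>

definition add_scaled :: "'a topology \<Rightarrow> ('a \<Rightarrow> real) \<Rightarrow> real \<Rightarrow> ('a \<Rightarrow> real) \<Rightarrow> 'a \<Rightarrow> real" where
  "add_scaled K f c g = (\<lambda>x\<in>topspace K. f x + c * g x)"

lemma add_scaled_apply [simp]: "x \<in> topspace K \<Longrightarrow> add_scaled K f c g x = f x + c * g x"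
  by (simp add: add_scaled_def)

lemma restrict_in_cfun: "continuous_map K euclideanreal f \<Longrightarrow> restrict f (topspace K) \<in> cfun K"
  by (auto simp: cfun_def intro: continuous_map_eq)

lemma cfun_continuous: "f \<in> cfun K \<Longrightarrow> continuous_map K euclideanreal f"
  by (simp add: cfun_def)

lemma cfun_eqI: "f \<in> cfun K \<Longrightarrow> g \<in> cfun K \<Longrightarrow> (\<And>x. x \<in> topspace K \<Longrightarrow> f x = g x) \<Longrightarrow> f = g"
  by (auto simp: cfun_def intro: extensionalityI)

lemma add_scaled_in_cfun [intro]: "f \<in> cfun K \<Longrightarrow> g \<in> cfun K \<Longrightarrow> add_scaled K f c g \<in> cfun K"
  unfolding add_scaled_def
  by (intro restrict_in_cfun continuous_intros cfun_continuous)

lemma dual_add_scaled: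
  assumes \<phi>: "\<phi> \<in> cfun_dual K" and fg: "f \<in> cfun K" "g \<in> cfun K"
  shows "\<phi> (add_scaled K f c g) = \<phi> f + c * \<phi> g"
proof -
  let ?g = "\<lambda>x\<in>topspace K. c * g x"
  have "?g \<in> cfun K" by (intro restrict_in_cfun continuous_intros cfun_continuous fg)
  then have "\<phi> (\<lambda>x\<in>topspace K. f x + ?g x) = \<phi> f + \<phi> ?g"
    using \<phi> fg unfolding cfun_dual_def by blast
  moreover have "(\<lambda>x\<in>topspace K. f x + ?g x) = add_scaled K f c g"
    by (auto simp: add_scaled_def)
  moreover have "\<phi> ?g = c * \<phi> g" using \<phi> fg unfolding cfun_dual_def by blast
  ultimately show ?thesis by simp
qed

lemma sup_norm_le:
  assumes "topspace K \<noteq> {}" "\<And>x. x \<in> topspace K \<Longrightarrow> \<bar>f x\<bar> \<le> b"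
  shows "sup_norm K f \<le> b"
  unfolding sup_norm_def by (rule cSUP_least) (use assms in auto)

lemma dual_bounded:
  assumes "topspace K \<noteq> {}" and \<phi>: "\<phi> \<in> cfun_dual K"
  obtains B where "B > 0" "\<And>f b. f \<in> cfun K \<Longrightarrow> (\<And>x. x \<in> topspace K \<Longrightarrow> \<bar>f x\<bar> \<le> b) \<Longrightarrow> \<bar>\<phi> f\<bar> \<le> b * B"
proof -
  obtain B where B: "\<And>f. f \<in> cfun K \<Longrightarrow> \<bar>\<phi> f\<bar> \<le> sup_norm K f * B"
    using \<phi> unfolding cfun_dual_def by blast
  show ?thesis
  proof (rule that[of "\<bar>B\<bar> + 1"])
    show "\<bar>B\<bar> + 1 > 0" by linarith
    fix f b assume f: "f \<in> cfun K" "\<And>x. x \<in> topspace K \<Longrightarrow> \<bar>f x\<bar> \<le> b"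
    obtain x0 where "x0 \<in> topspace K" using assms(1) by blast
    then have b0: "0 \<le> b" using f(2)[of x0] by linarith
    show "\<bar>\<phi> f\<bar> \<le> b * (\<bar>B\<bar> + 1)"
    proof -
      have bdd: "bdd_above ((\<lambda>x. \<bar>f x\<bar>) ` topspace K)" using f(2) by (intro bdd_aboveI[of _ b]) auto
      have "0 \<le> \<bar>f x0\<bar>" by simp
      also have "\<dots> \<le> sup_norm K f"
        unfolding sup_norm_def by (rule cSUP_upper[OF \<open>x0 \<in> topspace K\<close> bdd])
      finally have s0: "0 \<le> sup_norm K f" .
      have "\<bar>\<phi> f\<bar> \<le> sup_norm K f * B" by (rule B[OF f(1)])
      also have "\<dots> \<le> sup_norm K f * (\<bar>B\<bar> + 1)" using s0 by (intro mult_left_mono) auto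
      also have "\<dots> \<le> b * (\<bar>B\<bar> + 1)"
        using sup_norm_le[OF assms(1) f(2)] by (intro mult_right_mono) auto
      finally show ?thesis .
    qed
  qed
qed

lemma dual_sum:
  assumes \<phi>: "\<phi> \<in> cfun_dual K" and "finite F" and h: "\<And>i. i \<in> F \<Longrightarrow> h i \<in> cfun K"
  shows "(\<lambda>p\<in>topspace K. \<Sum>i\<in>F. c i * h i p) \<in> cfun K \<and>
    \<phi> (\<lambda>p\<in>topspace K. \<Sum>i\<in>F. c i * h i p) = (\<Sum>i\<in>F. c i * \<phi> (h i))"
  using \<open>finite F\<close> h
proof (induction F)
  case empty
  let ?z = "\<lambda>p\<in>topspace K. 0 :: real"
  have z: "?z \<in> cfun K" by (intro restrict_in_cfun continuous_intros) simp
  have "add_scaled K ?z 1 ?z = ?z" by (auto simp: add_scaled_def)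
  then have "\<phi> ?z = \<phi> ?z + 1 * \<phi> ?z" using dual_add_scaled[OF \<phi> z z, of 1] by simp
  then have "\<phi> ?z = 0" by linarith
  then show ?case unfolding sum.empty using z by blast
next
  case (insert i F)
  let ?s = "\<lambda>p\<in>topspace K. \<Sum>i\<in>F. c i * h i p"
  have s: "?s \<in> cfun K" "\<phi> ?s = (\<Sum>i\<in>F. c i * \<phi> (h i))"
    using insert.IH[OF insert.prems[OF insertI2]] by blast+
  have hi: "h i \<in> cfun K" by (rule insert.prems) simp
  have "(\<lambda>p\<in>topspace K. \<Sum>i\<in>insert i F. c i * h i p) = add_scaled K ?s (c i) (h i)"
    using insert.hyps by (auto simp: add_scaled_def)
  then show ?case
    using add_scaled_in_cfun[OF s(1) hi, of "c i"] dual_add_scaled[OF \<phi> s(1) hi, of "c i"] s(2) insert.hyps by simp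
qed

section \<open>Continuous functions on a split interval\<close>

definition jump :: "real \<Rightarrow> (real \<times> nat \<Rightarrow> real) \<Rightarrow> real" where
  "jump y f = f (y, 1) - f (y, 0)"

definition step :: "real set \<Rightarrow> real \<Rightarrow> real \<times> nat \<Rightarrow> real" where
  "step X x = (\<lambda>p\<in>topspace (split_interval X). if x < fst p \<or> x = fst p \<and> 0 < snd p then 1 else 0)"

text \<open>
  The larger one of the points over \<open>x\<close>; it is the limit of the points to the right of \<open>x\<close>, as \<open>(x, 0)\<close> is
  the limit of those to the left.
\<close>

definition right_twin :: "real set \<Rightarrow> real \<Rightarrow> real \<times> nat" where
  "right_twin X x = (if x \<in> X then (x, 1) else (x, 0))"

lemma split_interval_ray:
  assumes "a \<in> topspace (split_interval X)"
  shows "openin (split_interval X) {p \<in> topspace (split_interval X). (p, a) \<in> lex_less}"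
    and "openin (split_interval X) {p \<in> topspace (split_interval X). (a, p) \<in> lex_less}"
  using assms unfolding topspace_split_interval unfolding split_interval_def order_topology_on_def
  by (auto intro!: topology_generated_by_Basis)

lemma lex_less_iff: "((s, i), (t, j)) \<in> lex_less \<longleftrightarrow> s < t \<or> s = t \<and> i < j"
  by (simp add: lex_less_def)

lemma fst_split_interval: "X \<subseteq> {0<..<1} \<Longrightarrow> p \<in> topspace (split_interval X) \<Longrightarrow> 0 \<le> fst p \<and> fst p \<le> 1"
  by (auto simp: topspace_split_interval)

lemma continuous_map_fst_split_interval:
  assumes X: "X \<subseteq> {0<..<1}"
  shows "continuous_map (split_interval X) euclideanreal fst"
proof -
  let ?K = "split_interval X"
  have "openin ?K {p \<in> topspace ?K. a < fst p}" for a
  proof -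
    consider "a < 0" | "a > 1" | "0 \<le> a" "a \<le> 1" by linarith
    then show ?thesis
    proof cases
      case 1
      have "a < fst p" if "p \<in> topspace ?K" for p using fst_split_interval[OF X that] 1 by linarith
      then have "{p \<in> topspace ?K. a < fst p} = topspace ?K" by blast
      then show ?thesis by (simp only: openin_topspace)
    next
      case 2
      have "\<not> a < fst p" if "p \<in> topspace ?K" for p using fst_split_interval[OF X that] 2 by linarith
      then have "{p \<in> topspace ?K. a < fst p} = {}" by blast
      then show ?thesis by (simp only: openin_empty)
    next
      case 3
      have "{p \<in> topspace ?K. a < fst p} = {p \<in> topspace ?K. (right_twin X a, p) \<in> lex_less}"
        by (auto simp: right_twin_def lex_less_iff topspace_split_interval)
      moreover have "right_twin X a \<in> topspace ?K" using 3 by (auto simp: right_twin_def topspace_split_interval)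
      ultimately show ?thesis by (simp only: split_interval_ray)
    qed
  qed
  moreover have "openin ?K {p \<in> topspace ?K. fst p < a}" for a
  proof -
    consider "a < 0" | "a > 1" | "0 \<le> a" "a \<le> 1" by linarith
    then show ?thesis
    proof cases
      case 1
      have "\<not> fst p < a" if "p \<in> topspace ?K" for p using fst_split_interval[OF X that] 1 by linarith
      then have "{p \<in> topspace ?K. fst p < a} = {}" by blast
      then show ?thesis by (simp only: openin_empty)
    next
      case 2
      have "fst p < a" if "p \<in> topspace ?K" for p using fst_split_interval[OF X that] 2 by linarith
      then have "{p \<in> topspace ?K. fst p < a} = topspace ?K" by blast
      then show ?thesis by (simp only: openin_topspace)
    next
      case 3
      have "{p \<in> topspace ?K. fst p < a} = {p \<in> topspace ?K. (p, (a, 0)) \<in> lex_less}"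
        by (auto simp: lex_less_iff topspace_split_interval)
      moreover have "(a, 0) \<in> topspace ?K" using 3 by (auto simp: topspace_split_interval)
      ultimately show ?thesis by (simp only: split_interval_ray)
    qed
  qed
  ultimately show ?thesis by (simp add: continuous_map_upper_lower_semicontinuous_lt)
qed

lemma step_in_cfun:
  assumes x: "x \<in> X" and X: "X \<subseteq> {0<..<1}"
  shows "step X x \<in> cfun (split_interval X)"
proof -
  let ?K = "split_interval X"
  let ?f = "\<lambda>p::real \<times> nat. if x < fst p \<or> x = fst p \<and> 0 < snd p then 1 else 0 :: real"
  have in_K: "(x, 0) \<in> topspace ?K" "(x, 1) \<in> topspace ?K" using x X by (auto simp: topspace_split_interval)
  have up: "{p \<in> topspace ?K. ?f p = 1} = {p \<in> topspace ?K. ((x, 0), p) \<in> lex_less}"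
    by (auto simp: lex_less_iff)
  have down: "{p \<in> topspace ?K. ?f p = 0} = {p \<in> topspace ?K. (p, (x, 1)) \<in> lex_less}"
    by (auto simp: lex_less_iff)
  have "openin ?K {p \<in> topspace ?K. a < ?f p}" for a
  proof -
    have "{p \<in> topspace ?K. a < ?f p} =
        (if a < 0 then topspace ?K else if a < 1 then {p \<in> topspace ?K. ?f p = 1} else {})" by auto
    then show ?thesis unfolding up using split_interval_ray(2)[OF in_K(1)] by simp
  qed
  moreover have "openin ?K {p \<in> topspace ?K. ?f p < a}" for a
  proof -
    have "{p \<in> topspace ?K. ?f p < a} =
        (if a > 1 then topspace ?K else if a > 0 then {p \<in> topspace ?K. ?f p = 0} else {})" by auto
    then show ?thesis unfolding down using split_interval_ray(1)[OF in_K(2)] by simp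
  qed
  ultimately have "continuous_map ?K euclideanreal ?f"
    unfolding continuous_map_upper_lower_semicontinuous_lt by blast
  then show ?thesis unfolding step_def by (rule restrict_in_cfun)
qed

lemma jump_step: "x \<in> X \<Longrightarrow> X \<subseteq> {0<..<1} \<Longrightarrow> y \<in> X \<Longrightarrow> jump y (step X x) = (if y = x then 1 else 0)"
  by (auto simp: jump_def step_def topspace_split_interval)

lemma jump_add_scaled:
  "y \<in> X \<Longrightarrow> X \<subseteq> {0<..<1} \<Longrightarrow> jump y (add_scaled (split_interval X) f c g) = jump y f + c * jump y g"
  by (auto simp: jump_def topspace_split_interval algebra_simps)

text \<open>
  Only the behaviour of neighbourhoods on the open sides of a point is recorded, which makes the property
  stable under the generation of the topology from rays.
\<close>

lemma openin_split_interval_nbhd: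
  assumes X: "X \<subseteq> {0<..<1}" and op: "openin (split_interval X) U"
  shows "(\<forall>x. (x, 0) \<in> U \<longrightarrow> (\<exists>\<delta>>0. \<forall>p\<in>topspace (split_interval X). x - \<delta> < fst p \<and> fst p < x \<longrightarrow> p \<in> U)) \<and>
    (\<forall>x. right_twin X x \<in> U \<longrightarrow> (\<exists>\<delta>>0. \<forall>p\<in>topspace (split_interval X). x < fst p \<and> fst p < x + \<delta> \<longrightarrow> p \<in> U))"
    (is "?L U \<and> ?R U")
proof -
  let ?S = "{0..1} \<times> {0} \<union> X \<times> {1::nat}"
  have "generate_topology_on (insert ?S ((\<lambda>a. {x \<in> ?S. (x, a) \<in> lex_less}) ` ?S \<union> (\<lambda>a. {x \<in> ?S. (a, x) \<in> lex_less}) ` ?S)) U"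
    using op unfolding split_interval_def order_topology_on_def by (rule openin_topology_generated_by)
  then show ?thesis
  proof (induction rule: generate_topology_on.induct)
    case Empty
    then show ?case by simp
  next
    case (Int a b)
    show ?case
    proof (intro conjI allI impI)
      fix x assume "(x, 0) \<in> a \<inter> b"
      then obtain d e where "d > 0" "e > 0"
        "\<forall>p\<in>topspace (split_interval X). x - d < fst p \<and> fst p < x \<longrightarrow> p \<in> a"
        "\<forall>p\<in>topspace (split_interval X). x - e < fst p \<and> fst p < x \<longrightarrow> p \<in> b"
        using Int.IH by (metis IntD1 IntD2)
      then show "\<exists>\<delta>>0. \<forall>p\<in>topspace (split_interval X). x - \<delta> < fst p \<and> fst p < x \<longrightarrow> p \<in> a \<inter> b"
        by (intro exI[of _ "min d e"]) auto
    next
      fix x assume "right_twin X x \<in> a \<inter> b"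
      then obtain d e where "d > 0" "e > 0"
        "\<forall>p\<in>topspace (split_interval X). x < fst p \<and> fst p < x + d \<longrightarrow> p \<in> a"
        "\<forall>p\<in>topspace (split_interval X). x < fst p \<and> fst p < x + e \<longrightarrow> p \<in> b"
        using Int.IH by (metis IntD1 IntD2)
      then show "\<exists>\<delta>>0. \<forall>p\<in>topspace (split_interval X). x < fst p \<and> fst p < x + \<delta> \<longrightarrow> p \<in> a \<inter> b"
        by (intro exI[of _ "min d e"]) auto
    qed
  next
    case (UN \<K>)
    show ?case
    proof (intro conjI allI impI)
      fix x assume "(x, 0) \<in> \<Union>\<K>"
      then obtain k where k: "k \<in> \<K>" "(x, 0) \<in> k" by (rule UnionE)
      then obtain d where "d > 0" "\<forall>p\<in>topspace (split_interval X). x - d < fst p \<and> fst p < x \<longrightarrow> p \<in> k"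
        using UN.IH[OF k(1)] by blast
      then show "\<exists>\<delta>>0. \<forall>p\<in>topspace (split_interval X). x - \<delta> < fst p \<and> fst p < x \<longrightarrow> p \<in> \<Union>\<K>"
        using k(1) by (intro exI[of _ d]) blast
    next
      fix x assume "right_twin X x \<in> \<Union>\<K>"
      then obtain k where k: "k \<in> \<K>" "right_twin X x \<in> k" by (rule UnionE)
      then obtain d where "d > 0" "\<forall>p\<in>topspace (split_interval X). x < fst p \<and> fst p < x + d \<longrightarrow> p \<in> k"
        using UN.IH[OF k(1)] by blast
      then show "\<exists>\<delta>>0. \<forall>p\<in>topspace (split_interval X). x < fst p \<and> fst p < x + \<delta> \<longrightarrow> p \<in> \<Union>\<K>"
        using k(1) by (intro exI[of _ d]) blast
    qed
  next
    case (Basis s)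
    then consider "s = ?S" | a where "a \<in> ?S" "s = {x \<in> ?S. (x, a) \<in> lex_less}"
      | a where "a \<in> ?S" "s = {x \<in> ?S. (a, x) \<in> lex_less}" by blast
    then show ?case
    proof cases
      case 1
      then show ?thesis by (auto simp: topspace_split_interval intro: exI[of _ 1])
    next
      case (2 a)
      obtain t i where a: "a = (t, i)" by (cases a)
      show ?thesis
      proof (intro conjI allI impI)
        fix x assume "(x, 0) \<in> s"
        then show "\<exists>\<delta>>0. \<forall>p\<in>topspace (split_interval X). x - \<delta> < fst p \<and> fst p < x \<longrightarrow> p \<in> s"
          unfolding 2(2) a by (auto simp: lex_less_iff topspace_split_interval intro: exI[of _ 1])
      next
        fix x assume "right_twin X x \<in> s"
        then have "x < t"
          using 2 a by (auto simp: lex_less_iff right_twin_def split: if_splits)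
        then show "\<exists>\<delta>>0. \<forall>p\<in>topspace (split_interval X). x < fst p \<and> fst p < x + \<delta> \<longrightarrow> p \<in> s"
          unfolding 2(2) a by (auto simp: lex_less_iff topspace_split_interval intro!: exI[of _ "t - x"])
      qed
    next
      case (3 a)
      obtain t i where a: "a = (t, i)" by (cases a)
      show ?thesis
      proof (intro conjI allI impI)
        fix x assume "(x, 0) \<in> s"
        then have "t < x" unfolding 3(2) a by (auto simp: lex_less_iff)
        then show "\<exists>\<delta>>0. \<forall>p\<in>topspace (split_interval X). x - \<delta> < fst p \<and> fst p < x \<longrightarrow> p \<in> s"
          unfolding 3(2) a by (auto simp: lex_less_iff topspace_split_interval intro!: exI[of _ "x - t"])
      next
        fix x assume "right_twin X x \<in> s"
        then have "t \<le> x"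
          using 3 a by (auto simp: lex_less_iff right_twin_def split: if_splits)
        then show "\<exists>\<delta>>0. \<forall>p\<in>topspace (split_interval X). x < fst p \<and> fst p < x + \<delta> \<longrightarrow> p \<in> s"
          unfolding 3(2) a by (auto simp: lex_less_iff topspace_split_interval intro: exI[of _ 1])
      qed
    qed
  qed
qed

lemma cfun_one_sided_limits:
  assumes X: "X \<subseteq> {0<..<1}" and f: "f \<in> cfun (split_interval X)" and x: "0 \<le> x" "x \<le> 1" and \<epsilon>: "\<epsilon> > 0"
  obtains \<delta> where "\<delta> > 0"
    "\<And>p. p \<in> topspace (split_interval X) \<Longrightarrow> x - \<delta> < fst p \<Longrightarrow> fst p < x \<Longrightarrow> \<bar>f p - f (x, 0)\<bar> < \<epsilon>"
    "\<And>p. p \<in> topspace (split_interval X) \<Longrightarrow> x < fst p \<Longrightarrow> fst p < x + \<delta> \<Longrightarrow> \<bar>f p - f (right_twin X x)\<bar> < \<epsilon>"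
proof -
  have op: "openin (split_interval X) {p \<in> topspace (split_interval X). f p \<in> ball a \<epsilon>}" for a
    by (rule openin_continuous_map_preimage[OF cfun_continuous[OF f]]) simp
  have in_K: "(x, 0) \<in> topspace (split_interval X)" "right_twin X x \<in> topspace (split_interval X)"
    using x by (auto simp: topspace_split_interval right_twin_def)
  obtain d where d: "d > 0" "\<forall>p\<in>topspace (split_interval X). x - d < fst p \<and> fst p < x \<longrightarrow> f p \<in> ball (f (x, 0)) \<epsilon>"
    using openin_split_interval_nbhd[OF X op[of "f (x, 0)"]] in_K \<epsilon> by auto
  obtain e where e: "e > 0" "\<forall>p\<in>topspace (split_interval X). x < fst p \<and> fst p < x + e \<longrightarrow> f p \<in> ball (f (right_twin X x)) \<epsilon>"
    using openin_split_interval_nbhd[OF X op[of "f (right_twin X x)"]] in_K \<epsilon> by auto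
  show ?thesis
    by (rule that[of "min d e"]) (use d e in \<open>auto simp: dist_real_def abs_minus_commute\<close>)
qed

lemma cfun_limit_off_X:
  assumes X: "X \<subseteq> {0<..<1}" and f: "f \<in> cfun (split_interval X)" and x: "0 \<le> x" "x \<le> 1" "x \<notin> X" and \<epsilon>: "\<epsilon> > 0"
  obtains \<delta> where "\<delta> > 0"
    "\<And>p. p \<in> topspace (split_interval X) \<Longrightarrow> \<bar>fst p - x\<bar> < \<delta> \<Longrightarrow> \<bar>f p - f (x, 0)\<bar> < \<epsilon>"
proof -
  obtain \<delta> where \<delta>: "\<delta> > 0"
    "\<And>p. p \<in> topspace (split_interval X) \<Longrightarrow> x - \<delta> < fst p \<Longrightarrow> fst p < x \<Longrightarrow> \<bar>f p - f (x, 0)\<bar> < \<epsilon>"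
    "\<And>p. p \<in> topspace (split_interval X) \<Longrightarrow> x < fst p \<Longrightarrow> fst p < x + \<delta> \<Longrightarrow> \<bar>f p - f (right_twin X x)\<bar> < \<epsilon>"
    using cfun_one_sided_limits[OF X f x(1,2) \<epsilon>] by metis
  show ?thesis
  proof (rule that[OF \<delta>(1)])
    fix p assume p: "p \<in> topspace (split_interval X)" "\<bar>fst p - x\<bar> < \<delta>"
    consider "fst p < x" | "fst p > x" | "fst p = x" by linarith
    then show "\<bar>f p - f (x, 0)\<bar> < \<epsilon>"
    proof cases
      case 1
      then show ?thesis using \<delta>(2)[OF p(1)] p(2) by linarith
    next
      case 2
      then show ?thesis using \<delta>(3)[OF p(1)] p(2) x(3) by (simp add: right_twin_def)
    next
      case 3
      then have "p = (x, 0)" using p(1) x(3) by (auto simp: topspace_split_interval)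
      then show ?thesis using \<epsilon> by simp
    qed
  qed
qed

lemma unit_interval_finite_subcover:
  fixes \<delta> :: "real \<Rightarrow> real"
  assumes "\<And>t. 0 \<le> t \<Longrightarrow> t \<le> 1 \<Longrightarrow> \<delta> t > 0"
  shows "\<exists>C. finite C \<and> C \<subseteq> {0..1} \<and> {0..1} \<subseteq> (\<Union>t\<in>C. ball t (\<delta> t))"
proof -
  have cov: "{0..1} \<subseteq> (\<Union>t\<in>{0..1}. ball t (\<delta> t))" using assms by fastforce
  show ?thesis
    by (rule compactE_image[OF compact_Icc, of "{0..1}" "\<lambda>t. ball t (\<delta> t)"]) (use cov in auto)
qed

text \<open>
  Near each \<open>t \<in> [0, 1]\<close>, but not at \<open>t\<close> itself, all jumps are small by the one-sided limits; a finite
  subcover leaves only its centres.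
\<close>

lemma cfun_finitely_many_large_jumps:
  assumes X: "X \<subseteq> {0<..<1}" and f: "f \<in> cfun (split_interval X)" and \<epsilon>: "\<epsilon> > 0"
  shows "finite {y \<in> X. \<bar>jump y f\<bar> \<ge> \<epsilon>}"
proof -
  let ?K = "split_interval X"
  have "\<exists>\<delta>>0. \<forall>y\<in>X. \<bar>y - t\<bar> < \<delta> \<and> y \<noteq> t \<longrightarrow> \<bar>jump y f\<bar> < \<epsilon>" if t: "0 \<le> t" "t \<le> 1" for t
  proof -
    have "\<epsilon> / 2 > 0" using \<epsilon> by simp
    then obtain \<delta> where \<delta>: "\<delta> > 0"
      "\<And>p. p \<in> topspace ?K \<Longrightarrow> t - \<delta> < fst p \<Longrightarrow> fst p < t \<Longrightarrow> \<bar>f p - f (t, 0)\<bar> < \<epsilon> / 2"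
      "\<And>p. p \<in> topspace ?K \<Longrightarrow> t < fst p \<Longrightarrow> fst p < t + \<delta> \<Longrightarrow> \<bar>f p - f (right_twin X t)\<bar> < \<epsilon> / 2"
      using cfun_one_sided_limits[OF X f t] by metis
    have "\<bar>jump y f\<bar> < \<epsilon>" if y: "y \<in> X" "\<bar>y - t\<bar> < \<delta>" "y \<noteq> t" for y
    proof -
      have in_K: "(y, 0) \<in> topspace ?K" "(y, 1) \<in> topspace ?K" using y X by (auto simp: topspace_split_interval)
      have "\<exists>a. \<bar>f (y, 0) - a\<bar> < \<epsilon> / 2 \<and> \<bar>f (y, 1) - a\<bar> < \<epsilon> / 2"
      proof (cases "y < t")
        case True
        then show ?thesis using \<delta>(2)[OF in_K(1)] \<delta>(2)[OF in_K(2)] y by (intro exI[of _ "f (t, 0)"]) auto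
      next
        case False
        then show ?thesis using \<delta>(3)[OF in_K(1)] \<delta>(3)[OF in_K(2)] y by (intro exI[of _ "f (right_twin X t)"]) auto
      qed
      then show ?thesis unfolding jump_def by linarith
    qed
    then show ?thesis using \<delta>(1) by blast
  qed
  then obtain \<delta> where \<delta>: "\<And>t. 0 \<le> t \<Longrightarrow> t \<le> 1 \<Longrightarrow> \<delta> t > 0"
    "\<And>t y. 0 \<le> t \<Longrightarrow> t \<le> 1 \<Longrightarrow> y \<in> X \<Longrightarrow> \<bar>y - t\<bar> < \<delta> t \<Longrightarrow> y \<noteq> t \<Longrightarrow> \<bar>jump y f\<bar> < \<epsilon>" by metis
  obtain C where C: "finite C" "C \<subseteq> {0..1}" "{0..1} \<subseteq> (\<Union>t\<in>C. ball t (\<delta> t))"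
    using unit_interval_finite_subcover[of \<delta>, OF \<delta>(1)] by blast
  have "{y \<in> X. \<bar>jump y f\<bar> \<ge> \<epsilon>} \<subseteq> C"
  proof
    fix y assume y: "y \<in> {y \<in> X. \<bar>jump y f\<bar> \<ge> \<epsilon>}"
    then have "y \<in> {0..1}" using X by auto
    then obtain t where t: "t \<in> C" "y \<in> ball t (\<delta> t)" using C(3) by blast
    then have "\<bar>y - t\<bar> < \<delta> t" by (simp add: dist_real_def abs_minus_commute)
    then have "y = t" using \<delta>(2)[of t y] y t(1) C(2) by force
    then show "y \<in> C" using t by simp
  qed
  then show ?thesis using C(1) finite_subset by blast
qed

lemma cfun_bounded:
  assumes X: "X \<subseteq> {0<..<1}" and f: "f \<in> cfun (split_interval X)"
  shows "bdd_above ((\<lambda>p. \<bar>f p\<bar>) ` topspace (split_interval X))"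
proof -
  let ?K = "split_interval X"
  have "\<exists>\<delta>>0. \<exists>B. \<forall>p\<in>topspace ?K. \<bar>fst p - t\<bar> < \<delta> \<longrightarrow> \<bar>f p\<bar> \<le> B" if t: "0 \<le> t" "t \<le> 1" for t
  proof -
    obtain \<delta> where \<delta>: "\<delta> > 0"
      "\<And>p. p \<in> topspace ?K \<Longrightarrow> t - \<delta> < fst p \<Longrightarrow> fst p < t \<Longrightarrow> \<bar>f p - f (t, 0)\<bar> < 1"
      "\<And>p. p \<in> topspace ?K \<Longrightarrow> t < fst p \<Longrightarrow> fst p < t + \<delta> \<Longrightarrow> \<bar>f p - f (right_twin X t)\<bar> < 1"
      using cfun_one_sided_limits[OF X f t zero_less_one] by metis
    have "\<bar>f p\<bar> \<le> \<bar>f (t, 0)\<bar> + \<bar>f (t, 1)\<bar> + \<bar>f (right_twin X t)\<bar> + 1"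
      if p: "p \<in> topspace ?K" "\<bar>fst p - t\<bar> < \<delta>" for p
    proof -
      consider "fst p < t" | "fst p > t" | "p = (t, 0)" | "p = (t, 1)"
        using p(1) by (cases p) (fastforce simp: topspace_split_interval)
      then show ?thesis
        using \<delta>(2)[OF p(1)] \<delta>(3)[OF p(1)] p(2) by cases auto
    qed
    then show ?thesis using \<delta>(1) by blast
  qed
  then obtain \<delta> B where \<delta>: "\<And>t. 0 \<le> t \<Longrightarrow> t \<le> 1 \<Longrightarrow> \<delta> t > 0"
    "\<And>t p. 0 \<le> t \<Longrightarrow> t \<le> 1 \<Longrightarrow> p \<in> topspace ?K \<Longrightarrow> \<bar>fst p - t\<bar> < \<delta> t \<Longrightarrow> \<bar>f p\<bar> \<le> B t" by metis
  obtain C where C: "finite C" "C \<subseteq> {0..1}" "{0..1} \<subseteq> (\<Union>t\<in>C. ball t (\<delta> t))"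
    using unit_interval_finite_subcover[of \<delta>, OF \<delta>(1)] by blast
  have "\<bar>f p\<bar> \<le> Max (B ` C)" if p: "p \<in> topspace ?K" for p
  proof -
    have "fst p \<in> {0..1}" using fst_split_interval[OF X p] by simp
    then obtain t where t: "t \<in> C" "fst p \<in> ball t (\<delta> t)" using C(3) by blast
    then have "\<bar>f p\<bar> \<le> B t"
      using \<delta>(2)[of t p] p C(2) by (auto simp: dist_real_def abs_minus_commute)
    also have "\<dots> \<le> Max (B ` C)" using C(1) t(1) by simp
    finally show ?thesis .
  qed
  then show ?thesis by (intro bdd_aboveI[of _ "Max (B ` C)"]) auto
qed

section \<open>Functionals along the step functions\<close>

lemma finite_set_separated:
  fixes F :: "real set"
  assumes "finite F"
  obtains d where "d > 0" "\<And>x x'. x \<in> F \<Longrightarrow> x' \<in> F \<Longrightarrow> x \<noteq> x' \<Longrightarrow> 2 * d \<le> \<bar>x - x'\<bar>"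
proof -
  define D where "D = insert 1 ((\<lambda>(x, x'). \<bar>x - x'\<bar>) ` (F \<times> F - Id))"
  have D: "finite D" "D \<noteq> {}" using assms by (auto simp: D_def)
  have "\<forall>u\<in>D. u > 0" by (auto simp: D_def)
  then have "Min D > 0" using D by simp
  moreover have "Min D \<le> \<bar>x - x'\<bar>" if "x \<in> F" "x' \<in> F" "x \<noteq> x'" for x x'
  proof (rule Min_le[OF D(1)])
    have "(x, x') \<in> F \<times> F - Id" using that by simp
    then show "\<bar>x - x'\<bar> \<in> D" unfolding D_def by force
  qed
  ultimately show ?thesis using that[of "Min D / 2"] by simp
qed

lemma step_differs:
  assumes "p \<in> topspace (split_interval X)" "step X y p \<noteq> step X x p" "\<bar>y - x\<bar> < d"
  shows "\<bar>fst p - x\<bar> < d"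
  using assms by (auto simp: step_def split: if_splits)

text \<open>
  If the functional oscillates by \<open>e\<close> at each point of a finite set \<open>F\<close>, then the signed sum of the differences
  of steps over disjoint short intervals at the points of \<open>F\<close> has norm at most 1 and value at least
  \<open>card F * e\<close>.  So for each \<open>e\<close> there are only finitely many such points.
\<close>

lemma countable_discontinuities_dual_step:
  assumes X: "X \<subseteq> {0<..<1}" and \<phi>: "\<phi> \<in> cfun_dual (split_interval X)"
  shows "countable (discontinuities X (\<lambda>x. \<phi> (step X x)))"
proof -
  let ?K = "split_interval X"
  let ?v = "\<lambda>x. \<phi> (step X x)"
  have ne: "topspace ?K \<noteq> {}" by (auto simp: topspace_split_interval)
  obtain B where B: "B > 0" "\<And>f b. f \<in> cfun ?K \<Longrightarrow> (\<And>x. x \<in> topspace ?K \<Longrightarrow> \<bar>f x\<bar> \<le> b) \<Longrightarrow> \<bar>\<phi> f\<bar> \<le> b * B"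
    using dual_bounded[OF ne \<phi>] by metis
  define Z where "Z e = {x \<in> X. \<forall>d>0. \<exists>y\<in>X. \<bar>y - x\<bar> < d \<and> \<bar>?v y - ?v x\<bar> \<ge> e}" for e
  have card: "real (card F) * e \<le> B" if F: "finite F" "F \<subseteq> Z e" for e F
  proof -
    obtain d where d: "d > 0" "\<And>x x'. x \<in> F \<Longrightarrow> x' \<in> F \<Longrightarrow> x \<noteq> x' \<Longrightarrow> 2 * d \<le> \<bar>x - x'\<bar>"
      by (rule finite_set_separated[OF F(1)]) metis
    have "\<forall>x\<in>F. \<exists>y\<in>X. \<bar>y - x\<bar> < d \<and> \<bar>?v y - ?v x\<bar> \<ge> e" using F(2) d(1) by (auto simp: Z_def)
    then obtain y where y: "\<And>x. x \<in> F \<Longrightarrow> y x \<in> X" "\<And>x. x \<in> F \<Longrightarrow> \<bar>y x - x\<bar> < d"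
      "\<And>x. x \<in> F \<Longrightarrow> \<bar>?v (y x) - ?v x\<bar> \<ge> e" by metis
    have FX: "x \<in> X" if "x \<in> F" for x using F(2) that by (auto simp: Z_def)
    define h where "h x = add_scaled ?K (step X (y x)) (-1) (step X x)" for x
    define \<sigma> where "\<sigma> x = sgn (?v (y x) - ?v x)" for x
    have h: "h x \<in> cfun ?K" "\<phi> (h x) = ?v (y x) - ?v x" if "x \<in> F" for x
      using step_in_cfun[OF y(1)[OF that] X] step_in_cfun[OF FX[OF that] X]
      by (auto simp: h_def dual_add_scaled[OF \<phi>])
    define g where "g = (\<lambda>p\<in>topspace ?K. \<Sum>x\<in>F. \<sigma> x * h x p)"
    have g: "g \<in> cfun ?K" "\<phi> g = (\<Sum>x\<in>F. \<sigma> x * \<phi> (h x))"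
      using dual_sum[OF \<phi> F(1), of h \<sigma>] h by (auto simp: g_def)
    have "\<bar>g p\<bar> \<le> 1" if p: "p \<in> topspace ?K" for p
    proof (cases "\<exists>x0\<in>F. h x0 p \<noteq> 0")
      case True
      then obtain x0 where x0: "x0 \<in> F" "h x0 p \<noteq> 0" by blast
      have nz: "\<bar>fst p - x\<bar> < d" if "x \<in> F" "h x p \<noteq> 0" for x
        using step_differs[OF p _ y(2)[OF that(1)]] that(2) p by (simp add: h_def)
      have zero: "h x p = 0" if x: "x \<in> F" "x \<noteq> x0" for x
      proof (rule ccontr)
        assume "h x p \<noteq> 0"
        then show False using nz[OF x(1)] nz[OF x0] d(2)[OF x(1) x0(1) x(2)] by linarith
      qed
      have "g p = (\<Sum>x\<in>F. \<sigma> x * h x p)" using p by (simp add: g_def)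
      also have "\<dots> = (\<Sum>x\<in>{x0}. \<sigma> x * h x p)"
        by (rule sum.mono_neutral_right) (use F x0 zero in auto)
      finally have "\<bar>g p\<bar> = \<bar>\<sigma> x0\<bar> * \<bar>h x0 p\<bar>" by (simp add: abs_mult)
      also have "\<dots> \<le> 1 * 1"
        by (intro mult_mono) (use p in \<open>auto simp: \<sigma>_def h_def step_def sgn_real_def\<close>)
      finally show ?thesis by simp
    next
      case False
      then show ?thesis using p by (simp add: g_def)
    qed
    then have "\<bar>\<phi> g\<bar> \<le> 1 * B" using B(2)[OF g(1)] by blast
    moreover have "real (card F) * e \<le> \<phi> g"
    proof -
      have "(\<Sum>x\<in>F. e) \<le> (\<Sum>x\<in>F. \<sigma> x * \<phi> (h x))"
      proof (rule sum_mono)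
        fix x assume x: "x \<in> F"
        have "\<sigma> x * \<phi> (h x) = \<bar>?v (y x) - ?v x\<bar>" unfolding h(2)[OF x] \<sigma>_def by (simp add: abs_sgn mult.commute)
        then show "e \<le> \<sigma> x * \<phi> (h x)" using y(3)[OF x] by simp
      qed
      then show ?thesis by (simp add: g(2))
    qed
    ultimately show ?thesis by simp
  qed
  have fin: "finite (Z e)" if e: "e > 0" for e
  proof (rule finite_if_finite_subsets_card_bdd[of _ "nat \<lceil>B / e\<rceil>", THEN conjunct1])
    fix F assume F: "F \<subseteq> Z e" "finite F"
    have "real (card F) \<le> B / e" using card[OF F(2,1)] e by (simp add: field_simps)
    then show "card F \<le> nat \<lceil>B / e\<rceil>" by linarith
  qed
  have "discontinuities X ?v \<subseteq> (\<Union>n. Z (inverse (real (Suc n))))"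
  proof
    fix x assume x: "x \<in> discontinuities X ?v"
    then have "x \<in> X" by (simp add: discontinuities_def)
    have "\<exists>e>0. \<forall>d>0. \<exists>y\<in>X. \<bar>y - x\<bar> < d \<and> \<bar>?v y - ?v x\<bar> \<ge> e"
      using x unfolding discontinuities_def continuous_within_eps_delta dist_real_def
      by (simp add: not_less) (meson not_le)
    then obtain e where e: "e > 0" "\<And>d. d > 0 \<Longrightarrow> \<exists>y\<in>X. \<bar>y - x\<bar> < d \<and> \<bar>?v y - ?v x\<bar> \<ge> e" by blast
    obtain n where n: "inverse (real (Suc n)) < e" using reals_Archimedean[OF e(1)] by blast
    have "x \<in> Z (inverse (real (Suc n)))"
      unfolding Z_def using \<open>x \<in> X\<close> e(2) n by (auto intro: order_trans less_imp_le) (meson less_imp_le order_trans)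
    then show "x \<in> (\<Union>n. Z (inverse (real (Suc n))))" by blast
  qed
  moreover have "countable (\<Union>n. Z (inverse (real (Suc n))))"
    by (rule countable_UN) (simp_all add: countable_finite fin)
  ultimately show ?thesis by (rule countable_subset)
qed

section \<open>Jumps along a curve of functions\<close>

lemma values_far_apart:
  fixes a b u v e :: real
  assumes "\<bar>a - u\<bar> < (\<bar>v - u\<bar> - e) / 2" "\<bar>b - v\<bar> < (\<bar>v - u\<bar> - e) / 2"
  shows "a - b > e \<or> b - a > e"
proof (cases "u \<le> v")
  case True
  then have 1: "\<bar>a - u\<bar> < (v - u - e) / 2" "\<bar>b - v\<bar> < (v - u - e) / 2" using assms by simp_all
  have "b - a > e"
    using le_less_trans[OF abs_ge_self 1(1)] le_less_trans[OF abs_ge_minus_self 1(2)] by argo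
  then show ?thesis ..
next
  case False
  then have 1: "\<bar>a - u\<bar> < (u - v - e) / 2" "\<bar>b - v\<bar> < (u - v - e) / 2" using assms by simp_all
  have "a - b > e"
    using le_less_trans[OF abs_ge_minus_self 1(1)] le_less_trans[OF abs_ge_self 1(2)] by argo
  then show ?thesis ..
qed

text \<open>
  For a pair of rationals \<open>r < s\<close>, the set of those \<open>x\<close> for which \<open>\<gamma> x\<close> oscillates by more than \<open>e\<close> on the rationals in
  \<open>(r, s)\<close> is open in \<open>X\<close> up to a countable set; let \<open>Op r s\<close> be an open subset of the line with the same
  trace.  A G-delta set is obtained by requiring \<open>x \<in> Op r s\<close> whenever \<open>y \<in> [r, s]\<close>.  The closed interval makes the
  condition open in \<open>(x, y)\<close>; it differs from the one for the open interval only at rational \<open>y\<close>, which are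
  added to the exceptional set \<open>B\<close>.
\<close>

lemma jumps_of_curve_aux:
  assumes X: "X \<subseteq> {0<..<1}" and rigid: "gdelta_rigid X"
    and \<gamma>: "\<And>x. x \<in> X \<Longrightarrow> \<gamma> x \<in> cfun (split_interval X)"
    and cont: "\<And>q. q \<in> \<rat> \<Longrightarrow> 0 \<le> q \<Longrightarrow> q \<le> 1 \<Longrightarrow> countable (discontinuities X (\<lambda>x. \<gamma> x (q, 0)))"
    and e: "e > 0"
  shows "\<exists>A B. countable A \<and> countable B \<and>
    (\<forall>x\<in>X - A. \<forall>y\<in>X. \<bar>jump y (\<gamma> x)\<bar> > e \<longrightarrow> y = x \<or> y \<in> B)"
proof -
  let ?K = "split_interval X"
  define A0 where "A0 = (\<Union>q\<in>\<rat> \<inter> {0..1}. discontinuities X (\<lambda>x. \<gamma> x (q, 0)))"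
  have A0: "countable A0" unfolding A0_def
    by (intro countable_UN countable_Int1 countable_rat) (use cont in auto)
  define osc where "osc r s x \<longleftrightarrow> (\<exists>q q'. q \<in> \<rat> \<inter> {0..1} \<and> q' \<in> \<rat> \<inter> {0..1} \<and> r < q \<and> q < s \<and> r < q' \<and> q' < s \<and>
     \<gamma> x (q, 0) - \<gamma> x (q', 0) > e)" for r s x
  define Op where "Op r s = \<Union>{T. open T \<and> (\<forall>x\<in>T \<inter> (X - A0). osc r s x)}" for r s
  have openO: "open (Op r s)" for r s unfolding Op_def by (rule open_Union) blast
  have O1: "osc r s x" if x: "x \<in> Op r s" "x \<in> X - A0" for r s x
    using x unfolding Op_def by blast
  have O2: "x \<in> Op r s" if x: "x \<in> X - A0" "osc r s x" for r s x
  proof -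
    obtain q q' where q: "q \<in> \<rat> \<inter> {0..1}" "q' \<in> \<rat> \<inter> {0..1}" "r < q" "q < s" "r < q'" "q' < s"
      "\<gamma> x (q, 0) - \<gamma> x (q', 0) > e" using x(2) unfolding osc_def by blast
    have "continuous (at x within X) (\<lambda>x. \<gamma> x (q, 0))" "continuous (at x within X) (\<lambda>x. \<gamma> x (q', 0))"
      using x(1) q(1,2) by (auto simp: A0_def discontinuities_def)
    then have "continuous (at x within X) (\<lambda>x. \<gamma> x (q, 0) - \<gamma> x (q', 0))" by (rule continuous_diff)
    then have "\<forall>\<epsilon>>0. \<exists>d>0. \<forall>x'\<in>X. \<bar>x' - x\<bar> < d \<longrightarrow>
        \<bar>(\<gamma> x' (q, 0) - \<gamma> x' (q', 0)) - (\<gamma> x (q, 0) - \<gamma> x (q', 0))\<bar> < \<epsilon>"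
      unfolding continuous_within_eps_delta dist_real_def .
    moreover have "\<gamma> x (q, 0) - \<gamma> x (q', 0) - e > 0" using q(7) by simp
    ultimately obtain d where d: "d > 0" "\<forall>x'\<in>X. \<bar>x' - x\<bar> < d \<longrightarrow>
        \<bar>(\<gamma> x' (q, 0) - \<gamma> x' (q', 0)) - (\<gamma> x (q, 0) - \<gamma> x (q', 0))\<bar> < \<gamma> x (q, 0) - \<gamma> x (q', 0) - e"
      by blast
    have "osc r s x'" if x': "x' \<in> ball x d \<inter> (X - A0)" for x'
    proof -
      have "\<bar>x' - x\<bar> < d" "x' \<in> X" using x' by (auto simp: dist_real_def abs_minus_commute)
      then have "\<bar>(\<gamma> x' (q, 0) - \<gamma> x' (q', 0)) - (\<gamma> x (q, 0) - \<gamma> x (q', 0))\<bar> < \<gamma> x (q, 0) - \<gamma> x (q', 0) - e"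
        using d(2) by blast
      then have "\<gamma> x' (q, 0) - \<gamma> x' (q', 0) > e" by linarith
      then show ?thesis unfolding osc_def using q(1-6) by blast
    qed
    then show ?thesis unfolding Op_def using d(1) by (intro UnionI[of "ball x d"]) auto
  qed
  define avoid where "avoid a = {p::real \<times> real. fst p \<noteq> a}" for a
  define oscs where "oscs rs = {p::real \<times> real. snd p \<notin> {fst rs..snd rs} \<or> fst p \<in> Op (fst rs) (snd rs)}" for rs
  define \<U> where "\<U> = insert off_diagonal (avoid ` A0 \<union> oscs ` (\<rat> \<times> \<rat>))"
  have U: "countable \<U>" unfolding \<U>_def
    by (intro countable_insert countable_Un countable_image A0 countable_SIGMA countable_rat)
  have "open (avoid a)" for a unfolding avoid_def by (intro open_Collect_neq continuous_intros)
  moreover have "open (oscs rs)" for rs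
  proof -
    have "oscs rs = UNIV \<times> (- {fst rs..snd rs}) \<union> Op (fst rs) (snd rs) \<times> UNIV" by (auto simp: oscs_def)
    then show ?thesis by (simp add: open_Un open_Times open_Compl openO)
  qed
  ultimately have op: "\<forall>U\<in>\<U>. open U" using open_off_diagonal by (auto simp: \<U>_def)
  have W: "(x, y) \<in> \<Inter>\<U> \<longleftrightarrow> (x, y) \<in> off_diagonal \<and> x \<notin> A0 \<and> (\<forall>r\<in>\<rat>. \<forall>s\<in>\<rat>. r \<le> y \<and> y \<le> s \<longrightarrow> x \<in> Op r s)" for x y
  proof -
    have "(x, y) \<in> \<Inter>\<U> \<longleftrightarrow> (x, y) \<in> off_diagonal \<and> (\<forall>a\<in>A0. (x, y) \<in> avoid a) \<and> (\<forall>rs\<in>\<rat> \<times> \<rat>. (x, y) \<in> oscs rs)"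
      unfolding \<U>_def by (simp add: ball_Un)
    moreover have "(\<forall>a\<in>A0. (x, y) \<in> avoid a) \<longleftrightarrow> x \<notin> A0" by (auto simp: avoid_def)
    moreover have "(x, y) \<in> oscs (r, s) \<longleftrightarrow> (r \<le> y \<and> y \<le> s \<longrightarrow> x \<in> Op r s)" for r s
      by (auto simp: oscs_def)
    ultimately show ?thesis by (simp add: Ball_def) blast
  qed
  (* Off X the function \<gamma> x is continuous, so it oscillates little near y. *)
  have inX: "y \<in> X" if xy: "(x, y) \<in> \<Inter>\<U>" "x \<in> X" for x y
  proof (rule ccontr)
    assume y: "y \<notin> X"
    note xyW = iffD1[OF W xy(1)]
    have xA: "x \<in> X - A0" using conjunct1[OF conjunct2[OF xyW]] xy(2) by simp
    have y01: "0 \<le> y" "y \<le> 1" using conjunct1[OF xyW] by (auto simp: off_diagonal_def)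
    have "e / 2 > 0" using e by simp
    then obtain \<delta> where \<delta>: "\<delta> > 0"
      "\<And>p. p \<in> topspace ?K \<Longrightarrow> \<bar>fst p - y\<bar> < \<delta> \<Longrightarrow> \<bar>\<gamma> x p - \<gamma> x (y, 0)\<bar> < e / 2"
      using cfun_limit_off_X[OF X \<gamma>[OF xy(2)] y01 y] by metis
    obtain r where r: "r \<in> \<rat>" "y - \<delta> < r" "r < y" using Rats_dense_in_real[of "y - \<delta>" y] \<delta>(1) by auto
    obtain s where s: "s \<in> \<rat>" "y < s" "s < y + \<delta>" using Rats_dense_in_real[of y "y + \<delta>"] \<delta>(1) by auto
    have "x \<in> Op r s" using conjunct2[OF conjunct2[OF xyW]] r s by simp
    then have "osc r s x" using xA by (rule O1)
    then obtain q q' where q: "q \<in> {0..1}" "q' \<in> {0..1}" "r < q" "q < s" "r < q'" "q' < s"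
      "\<gamma> x (q, 0) - \<gamma> x (q', 0) > e" unfolding osc_def by blast
    have "\<bar>\<gamma> x (q, 0) - \<gamma> x (y, 0)\<bar> < e / 2" "\<bar>\<gamma> x (q', 0) - \<gamma> x (y, 0)\<bar> < e / 2"
      by (rule \<delta>(2); use q r s in \<open>force simp: topspace_split_interval\<close>)+
    then show False using q(7) by linarith
  qed
  have "line_coverable {p \<in> \<Inter>\<U>. fst p \<in> X}"
  proof (rule gdelta_rigidD[OF rigid U])
    show "open U" if "U \<in> \<U>" for U using op that by blast
    show "\<Inter>\<U> \<subseteq> off_diagonal" by (rule Inter_lower) (simp add: \<U>_def)
    show "y \<in> X" if "(x, y) \<in> \<Inter>\<U>" "x \<in> X" for x y using that by (rule inX)
  qed
  then obtain A B where AB: "countable A" "countable B" "{p \<in> \<Inter>\<U>. fst p \<in> X} \<subseteq> A \<times> UNIV \<union> UNIV \<times> B"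
    unfolding line_coverable_def by blast
  have "y = x \<or> y \<in> B \<union> \<rat>" if x: "x \<in> X - (A0 \<union> A)" and y: "y \<in> X" and j: "\<bar>jump y (\<gamma> x)\<bar> > e" for x y
  proof (rule ccontr)
    assume n: "\<not> (y = x \<or> y \<in> B \<union> \<rat>)"
    have xX: "x \<in> X" using x by simp
    have xO: "x \<in> Op r s" if rs: "r \<in> \<rat>" "s \<in> \<rat>" "r \<le> y" "y \<le> s" for r s
    proof (rule O2)
      show "x \<in> X - A0" using x by simp
      have rs': "r < y" "y < s" using rs n by (auto simp: less_le)
      have y01: "0 < y" "y < 1" using y X by auto
      have "(\<bar>jump y (\<gamma> x)\<bar> - e) / 2 > 0" using j by simp
      then obtain \<delta> where \<delta>: "\<delta> > 0"
        "\<And>p. p \<in> topspace ?K \<Longrightarrow> y - \<delta> < fst p \<Longrightarrow> fst p < y \<Longrightarrow> \<bar>\<gamma> x p - \<gamma> x (y, 0)\<bar> < (\<bar>jump y (\<gamma> x)\<bar> - e) / 2"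
        "\<And>p. p \<in> topspace ?K \<Longrightarrow> y < fst p \<Longrightarrow> fst p < y + \<delta> \<Longrightarrow> \<bar>\<gamma> x p - \<gamma> x (right_twin X y)\<bar> < (\<bar>jump y (\<gamma> x)\<bar> - e) / 2"
        using cfun_one_sided_limits[OF X \<gamma>[OF xX] less_imp_le[OF y01(1)] less_imp_le[OF y01(2)]] by metis
      obtain q where q: "q \<in> \<rat>" "max (max r 0) (y - \<delta>) < q" "q < y"
        using Rats_dense_in_real[of "max (max r 0) (y - \<delta>)" y] rs' y01 \<delta>(1) by auto
      obtain q' where q': "q' \<in> \<rat>" "y < q'" "q' < min (min s 1) (y + \<delta>)"
        using Rats_dense_in_real[of y "min (min s 1) (y + \<delta>)"] rs' y01 \<delta>(1) by auto
      have "\<bar>\<gamma> x (q, 0) - \<gamma> x (y, 0)\<bar> < (\<bar>jump y (\<gamma> x)\<bar> - e) / 2"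
        by (rule \<delta>(2)) (use q y01 in \<open>auto simp: topspace_split_interval\<close>)
      moreover have "\<bar>\<gamma> x (q', 0) - \<gamma> x (y, 1)\<bar> < (\<bar>jump y (\<gamma> x)\<bar> - e) / 2"
        using \<delta>(3)[of "(q', 0)"] q' y01 y by (auto simp: topspace_split_interval right_twin_def)
      ultimately have "\<gamma> x (q, 0) - \<gamma> x (q', 0) > e \<or> \<gamma> x (q', 0) - \<gamma> x (q, 0) > e"
        unfolding jump_def by (rule values_far_apart)
      moreover have "q \<in> \<rat> \<inter> {0..1}" "q' \<in> \<rat> \<inter> {0..1}" "r < q" "q < s" "r < q'" "q' < s"
        using q q' rs' y01 by auto
      ultimately show "osc r s x" unfolding osc_def by blast
    qed
    have "(x, y) \<in> off_diagonal" using n xX y X by (auto simp: off_diagonal_def)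
    then have "(x, y) \<in> \<Inter>\<U>" using x xO by (intro iffD2[OF W]) simp
    then have "(x, y) \<in> {p \<in> \<Inter>\<U>. fst p \<in> X}" using x by simp
    then have "(x, y) \<in> A \<times> UNIV \<union> UNIV \<times> B" by (rule subsetD[OF AB(3)])
    then show False using x n by simp
  qed
  then show ?thesis using A0 AB(1,2) countable_rat
    by (intro exI[of _ "A0 \<union> A"] exI[of _ "B \<union> \<rat>"]) simp
qed

lemma jumps_of_curve:
  assumes X: "X \<subseteq> {0<..<1}" and rigid: "gdelta_rigid X"
    and \<gamma>: "\<And>x. x \<in> X \<Longrightarrow> \<gamma> x \<in> cfun (split_interval X)"
    and cont: "\<And>q. q \<in> \<rat> \<Longrightarrow> 0 \<le> q \<Longrightarrow> q \<le> 1 \<Longrightarrow> countable (discontinuities X (\<lambda>x. \<gamma> x (q, 0)))"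
  shows "\<exists>A B. countable A \<and> countable B \<and>
    (\<forall>x\<in>X - A. \<forall>y\<in>X. jump y (\<gamma> x) \<noteq> 0 \<longrightarrow> y = x \<or> y \<in> B)"
proof -
  have "\<exists>A B. countable A \<and> countable B \<and>
    (\<forall>x\<in>X - A. \<forall>y\<in>X. \<bar>jump y (\<gamma> x)\<bar> > inverse (real (Suc n)) \<longrightarrow> y = x \<or> y \<in> B)" for n
    by (rule jumps_of_curve_aux[OF X rigid \<gamma> cont]) auto
  then obtain A B where AB: "\<And>n. countable (A n)" "\<And>n. countable (B n)"
    "\<And>n x y. x \<in> X - A n \<Longrightarrow> y \<in> X \<Longrightarrow> \<bar>jump y (\<gamma> x)\<bar> > inverse (real (Suc n)) \<Longrightarrow> y = x \<or> y \<in> B n"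
    by metis
  have "y = x \<or> y \<in> (\<Union>n. B n)" if xy: "x \<in> X - (\<Union>n. A n)" "y \<in> X" "jump y (\<gamma> x) \<noteq> 0" for x y
  proof -
    have "\<bar>jump y (\<gamma> x)\<bar> > 0" using xy by simp
    then obtain n where "inverse (real (Suc n)) < \<bar>jump y (\<gamma> x)\<bar>" using reals_Archimedean by blast
    then show ?thesis using AB(3)[of x n y] xy by blast
  qed
  moreover have "countable (\<Union>n. A n)" "countable (\<Union>n. B n)" using AB(1,2) by auto
  ultimately show ?thesis by (intro exI[of _ "\<Union>n. A n"] exI[of _ "\<Union>n. B n"]) simp
qed

section \<open>Functions with jumps in a given set\<close>

definition jumps_within :: "real set \<Rightarrow> real set \<Rightarrow> (real \<times> nat \<Rightarrow> real) set" where
  "jumps_within X S = {f \<in> cfun (split_interval X). \<forall>y\<in>X - S. jump y f = 0}"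

text \<open>
  The Bernstein polynomial with coefficients \<open>cs\<close> plus the combination \<open>js\<close> of steps.  Lists of rationals make
  countability evident and show that each function uses only finitely many points of \<open>S\<close>.
\<close>

definition simple_fun :: "real set \<Rightarrow> rat list \<Rightarrow> (rat \<times> real) list \<Rightarrow> real \<times> nat \<Rightarrow> real" where
  "simple_fun X cs js = (\<lambda>p\<in>topspace (split_interval X).
     (\<Sum>k\<le>length cs - 1. of_rat (cs ! k) * Bernstein (length cs - 1) k (fst p)) +
     (\<Sum>(c, s)\<leftarrow>js. of_rat c * step X s p))"

definition simple_funs :: "real set \<Rightarrow> real set \<Rightarrow> (real \<times> nat \<Rightarrow> real) set" where
  "simple_funs X S = {simple_fun X cs js |cs js. snd ` set js \<subseteq> S}"

lemma countable_simple_funs: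
  assumes "countable S" shows "countable (simple_funs X S)"
proof -
  have "simple_funs X S \<subseteq> (\<lambda>(cs, js). simple_fun X cs js) ` (UNIV \<times> lists (UNIV \<times> S))"
  proof
    fix f assume "f \<in> simple_funs X S"
    then obtain cs js where f: "f = simple_fun X cs js" "snd ` set js \<subseteq> S" by (auto simp: simple_funs_def)
    then have "js \<in> lists (UNIV \<times> S)" by (auto simp: in_lists_conv_set)
    then show "f \<in> (\<lambda>(cs, js). simple_fun X cs js) ` (UNIV \<times> lists (UNIV \<times> S))" using f(1) by force
  qed
  moreover have "countable ((UNIV :: rat list set) \<times> lists ((UNIV :: rat set) \<times> S))"
    by (intro countable_SIGMA countable_lists countableI_type assms)
  ultimately show ?thesis by (meson countable_image countable_subset)
qed

lemma simple_funs_mono: "S \<subseteq> S' \<Longrightarrow> simple_funs X S \<subseteq> simple_funs X S'"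
  by (auto simp: simple_funs_def) blast

lemma simple_funs_UN:
  assumes mono: "\<And>n. S n \<subseteq> S (Suc n)" and d: "d \<in> simple_funs X (\<Union>n::nat. S n)"
  obtains n where "d \<in> simple_funs X (S n)"
proof -
  obtain cs js where f: "d = simple_fun X cs js" "snd ` set js \<subseteq> (\<Union>n. S n)" using d by (auto simp: simple_funs_def)
  have le: "S m \<subseteq> S n" if "m \<le> n" for m n using lift_Suc_mono_le[of S, OF mono that] .
  have "\<exists>n. F \<subseteq> S n" if "finite F" "F \<subseteq> (\<Union>n. S n)" for F
    using that
  proof (induction F)
    case (insert a F)
    then obtain n where n: "F \<subseteq> S n" by auto
    obtain m where m: "a \<in> S m" using insert.prems by auto
    have "insert a F \<subseteq> S (max m n)" using n m le[of n "max m n"] le[of m "max m n"] by auto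
    then show ?case ..
  qed simp
  then obtain n where "snd ` set js \<subseteq> S n" using f(2) by (metis List.finite_set finite_imageI)
  then show ?thesis using f(1) that[of n] by (auto simp: simple_funs_def)
qed

lemma simple_fun_split:
  "simple_fun X cs js = add_scaled (split_interval X) (simple_fun X cs (filter (\<lambda>cs. snd cs \<noteq> x) js))
     (of_rat (\<Sum>(c, s)\<leftarrow>filter (\<lambda>cs. snd cs = x) js. c)) (step X x)"
proof (rule ext)
  fix p
  have "(\<Sum>(c, s)\<leftarrow>js. of_rat c * step X s p) =
      (\<Sum>(c, s)\<leftarrow>filter (\<lambda>cs. snd cs \<noteq> x) js. of_rat c * step X s p) +
      of_rat (\<Sum>(c, s)\<leftarrow>filter (\<lambda>cs. snd cs = x) js. c) * step X x p"
    by (induction js) (auto simp: algebra_simps of_rat_add)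
  then show "simple_fun X cs js p = add_scaled (split_interval X) (simple_fun X cs (filter (\<lambda>cs. snd cs \<noteq> x) js))
     (of_rat (\<Sum>(c, s)\<leftarrow>filter (\<lambda>cs. snd cs = x) js. c)) (step X x) p"
    by (simp add: simple_fun_def add_scaled_def)
qed

lemma simple_funs_insert:
  assumes "d \<in> simple_funs X (insert x S)"
  obtains d' and c :: rat where "d' \<in> simple_funs X S" "d = add_scaled (split_interval X) d' (of_rat c) (step X x)"
proof -
  obtain cs js where f: "d = simple_fun X cs js" "snd ` set js \<subseteq> insert x S" using assms by (auto simp: simple_funs_def)
  have "simple_fun X cs (filter (\<lambda>cs. snd cs \<noteq> x) js) \<in> simple_funs X S"
  proof -
    have "snd ` set (filter (\<lambda>cs. snd cs \<noteq> x) js) \<subseteq> S" using f(2) by force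
    then show ?thesis unfolding simple_funs_def by blast
  qed
  then show ?thesis using that simple_fun_split[of X cs js x] f(1) by blast
qed

lemma simple_fun_in_cfun:
  assumes X: "X \<subseteq> {0<..<1}" and "snd ` set js \<subseteq> X"
  shows "simple_fun X cs js \<in> cfun (split_interval X)"
proof -
  let ?K = "split_interval X"
  have "continuous_map ?K euclideanreal (\<lambda>p. \<Sum>(c, s)\<leftarrow>js. of_rat c * step X s p)"
    using assms(2)
  proof (induction js)
    case (Cons a js)
    obtain c s where a: "a = (c, s)" by (cases a)
    have "s \<in> X" using Cons.prems a by simp
    then have "continuous_map ?K euclideanreal (\<lambda>p. of_rat c * step X s p)"
      using cfun_continuous[OF step_in_cfun[OF _ X]] by (intro continuous_map_real_mult_left) auto
    then have "continuous_map ?K euclideanreal (\<lambda>p. of_rat c * step X s p + (\<Sum>(c, s)\<leftarrow>js. of_rat c * step X s p))"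
      using Cons by (intro continuous_map_add) auto
    then show ?case by (simp add: a)
  qed simp
  moreover have "continuous_map ?K euclideanreal (\<lambda>p. \<Sum>k\<le>length cs - 1. of_rat (cs ! k) * Bernstein (length cs - 1) k (fst p))"
  proof -
    have "continuous_on UNIV (\<lambda>t::real. \<Sum>k\<le>length cs - 1. of_rat (cs ! k) * Bernstein (length cs - 1) k t)"
      unfolding Bernstein_def by (intro continuous_intros)
    then have "continuous_map euclideanreal euclideanreal (\<lambda>t. \<Sum>k\<le>length cs - 1. of_rat (cs ! k) * Bernstein (length cs - 1) k t)"
      by simp
    from continuous_map_compose[OF continuous_map_fst_split_interval[OF X] this] show ?thesis
      by (simp add: comp_def)
  qed
  ultimately have "continuous_map ?K euclideanreal (\<lambda>p.
     (\<Sum>k\<le>length cs - 1. of_rat (cs ! k) * Bernstein (length cs - 1) k (fst p)) +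
     (\<Sum>(c, s)\<leftarrow>js. of_rat c * step X s p))"
    by (intro continuous_map_add)
  then show ?thesis unfolding simple_fun_def by (rule restrict_in_cfun)
qed

lemma simple_funs_in_cfun: "X \<subseteq> {0<..<1} \<Longrightarrow> S \<subseteq> X \<Longrightarrow> simple_funs X S \<subseteq> cfun (split_interval X)"
  by (auto simp: simple_funs_def intro!: simple_fun_in_cfun)

text \<open>
  Weighted averages of values of \<open>g\<close>, with tent functions of a finite subcover as weights; near a centre \<open>t\<close>
  the values of \<open>g\<close> differ from \<open>g (t, 0)\<close> by at most \<open>2 * \<epsilon>\<close>, also beyond a jump at \<open>t\<close>.
\<close>

lemma hat_approximation:
  assumes X: "X \<subseteq> {0<..<1}" and g: "g \<in> cfun (split_interval X)" and \<epsilon>: "\<epsilon> > 0"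
    and small: "\<And>y. y \<in> X \<Longrightarrow> \<bar>jump y g\<bar> < \<epsilon>"
  obtains G where "continuous_on {0..1} G" "\<And>p. p \<in> topspace (split_interval X) \<Longrightarrow> \<bar>g p - G (fst p)\<bar> \<le> 2 * \<epsilon>"
proof -
  let ?K = "split_interval X"
  have "\<exists>\<delta>>0. \<forall>p\<in>topspace ?K. \<bar>fst p - t\<bar> < \<delta> \<longrightarrow> \<bar>g p - g (t, 0)\<bar> \<le> 2 * \<epsilon>" if t: "0 \<le> t" "t \<le> 1" for t
  proof -
    obtain \<delta> where \<delta>: "\<delta> > 0"
      "\<And>p. p \<in> topspace ?K \<Longrightarrow> t - \<delta> < fst p \<Longrightarrow> fst p < t \<Longrightarrow> \<bar>g p - g (t, 0)\<bar> < \<epsilon>"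
      "\<And>p. p \<in> topspace ?K \<Longrightarrow> t < fst p \<Longrightarrow> fst p < t + \<delta> \<Longrightarrow> \<bar>g p - g (right_twin X t)\<bar> < \<epsilon>"
      using cfun_one_sided_limits[OF X g t \<epsilon>] by metis
    have twin: "\<bar>g (right_twin X t) - g (t, 0)\<bar> < \<epsilon>"
      using small[of t] \<epsilon> by (auto simp: right_twin_def jump_def)
    have "\<bar>g p - g (t, 0)\<bar> \<le> 2 * \<epsilon>" if p: "p \<in> topspace ?K" "\<bar>fst p - t\<bar> < \<delta>" for p
    proof -
      consider "fst p < t" | "fst p > t" | "p = (t, 0)" | "p = (t, 1)" "t \<in> X"
        using p(1) by (cases p) (fastforce simp: topspace_split_interval)
      then show ?thesis
      proof cases
        case 1
        then have "\<bar>g p - g (t, 0)\<bar> < \<epsilon>" using \<delta>(2)[OF p(1)] p(2) by linarith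
        then show ?thesis using \<epsilon> by linarith
      next
        case 2
        then have "\<bar>g p - g (right_twin X t)\<bar> < \<epsilon>" using \<delta>(3)[OF p(1)] p(2) by linarith
        then show ?thesis using twin by linarith
      next
        case 3
        then show ?thesis using \<epsilon> by simp
      next
        case 4
        then show ?thesis using small[of t] \<epsilon> by (simp add: jump_def)
      qed
    qed
    then show ?thesis using \<delta>(1) by blast
  qed
  then obtain \<delta> where \<delta>: "\<And>t. 0 \<le> t \<Longrightarrow> t \<le> 1 \<Longrightarrow> \<delta> t > 0"
    "\<And>t p. 0 \<le> t \<Longrightarrow> t \<le> 1 \<Longrightarrow> p \<in> topspace ?K \<Longrightarrow> \<bar>fst p - t\<bar> < \<delta> t \<Longrightarrow> \<bar>g p - g (t, 0)\<bar> \<le> 2 * \<epsilon>" by metis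
  obtain C where C: "finite C" "C \<subseteq> {0..1}" "{0..1} \<subseteq> (\<Union>t\<in>C. ball t (\<delta> t))"
    using unit_interval_finite_subcover[of \<delta>, OF \<delta>(1)] by blast
  define hat where "hat t s = max 0 (\<delta> t - \<bar>s - t\<bar>)" for t s :: real
  define H where "H s = (\<Sum>t\<in>C. hat t s)" for s
  define G where "G s = (\<Sum>t\<in>C. hat t s * g (t, 0)) / H s" for s
  have hat0: "hat t s \<ge> 0" for t s by (simp add: hat_def)
  have Hpos: "H s > 0" if s: "s \<in> {0..1}" for s
  proof -
    obtain t where t: "t \<in> C" "s \<in> ball t (\<delta> t)" using C(3) s by blast
    then have "hat t s > 0" by (simp add: hat_def dist_real_def abs_minus_commute)
    then show ?thesis unfolding H_def by (intro sum_pos2[OF C(1) t(1)]) (auto simp: hat0)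
  qed
  show ?thesis
  proof
    show "continuous_on {0..1} G"
      unfolding G_def H_def hat_def
    proof (intro continuous_intros)
      show "\<forall>s\<in>{0..1}. (\<Sum>t\<in>C. max 0 (\<delta> t - \<bar>s - t\<bar>)) \<noteq> 0"
        using Hpos unfolding H_def hat_def by force
    qed
    fix p assume p: "p \<in> topspace ?K"
    let ?s = "fst p"
    have H: "H ?s > 0" using Hpos fst_split_interval[OF X p] by simp
    have "(g p - G ?s) * H ?s = g p * H ?s - (\<Sum>t\<in>C. hat t ?s * g (t, 0))"
      using H by (simp add: G_def left_diff_distrib)
    also have "\<dots> = (\<Sum>t\<in>C. hat t ?s * (g p - g (t, 0)))"
      by (simp add: H_def sum_distrib_left right_diff_distrib sum_subtractf mult.commute)
    finally have eq: "(g p - G ?s) * H ?s = (\<Sum>t\<in>C. hat t ?s * (g p - g (t, 0)))" .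
    have "\<bar>g p - G ?s\<bar> * H ?s = \<bar>\<Sum>t\<in>C. hat t ?s * (g p - g (t, 0))\<bar>"
      using H by (simp flip: eq add: abs_mult)
    also have "\<dots> \<le> (\<Sum>t\<in>C. \<bar>hat t ?s * (g p - g (t, 0))\<bar>)" by (rule sum_abs)
    also have "\<dots> \<le> (\<Sum>t\<in>C. hat t ?s * (2 * \<epsilon>))"
    proof (rule sum_mono)
      fix t assume t: "t \<in> C"
      show "\<bar>hat t ?s * (g p - g (t, 0))\<bar> \<le> hat t ?s * (2 * \<epsilon>)"
      proof (cases "\<bar>?s - t\<bar> < \<delta> t")
        case True
        then have "\<bar>g p - g (t, 0)\<bar> \<le> 2 * \<epsilon>" using \<delta>(2)[of t p] t C(2) p by auto
        then show ?thesis using hat0[of t ?s] by (simp add: abs_mult mult_left_mono)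
      next
        case False
        then show ?thesis by (simp add: hat_def)
      qed
    qed
    also have "\<dots> = 2 * \<epsilon> * H ?s" by (simp add: H_def sum_distrib_left mult.commute)
    finally show "\<bar>g p - G ?s\<bar> \<le> 2 * \<epsilon>" using H by simp
  qed
qed

lemma rational_near:
  fixes a \<epsilon> :: real
  assumes "\<epsilon> > 0" obtains c :: rat where "\<bar>a - of_rat c\<bar> < \<epsilon>"
proof -
  obtain c where "a - \<epsilon> < of_rat c" "of_rat c < a + \<epsilon>" using of_rat_dense[of "a - \<epsilon>" "a + \<epsilon>"] assms by auto
  then show ?thesis using that[of c] by (simp add: abs_less_iff)
qed

lemma rational_Bernstein_approximation:
  fixes G :: "real \<Rightarrow> real"
  assumes "continuous_on {0..1} G" "\<epsilon> > 0"
  obtains cs :: "rat list" where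
    "\<And>s. s \<in> {0..1} \<Longrightarrow> \<bar>G s - (\<Sum>k\<le>length cs - 1. of_rat (cs ! k) * Bernstein (length cs - 1) k s)\<bar> < 2 * \<epsilon>"
proof -
  obtain N where N: "\<And>n s. N \<le> n \<Longrightarrow> s \<in> {0..1} \<Longrightarrow> \<bar>G s - (\<Sum>k\<le>n. G (k / n) * Bernstein n k s)\<bar> < \<epsilon>"
    using Bernstein_Weierstrass[OF assms] by metis
  have "\<exists>c::rat. \<bar>G (k / N) - of_rat c\<bar> < \<epsilon>" for k :: nat
    using rational_near[OF assms(2)] by metis
  then obtain c :: "nat \<Rightarrow> rat" where c: "\<And>k. \<bar>G (k / N) - of_rat (c k)\<bar> < \<epsilon>" by metis
  define cs where "cs = map c [0..<Suc N]"
  have len: "length cs - 1 = N" by (simp add: cs_def)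
  have nth: "cs ! k = c k" if "k \<le> N" for k
    using that unfolding cs_def by (subst nth_map) (auto simp del: upt_Suc)
  show ?thesis
  proof (rule that[of cs])
    fix s :: real assume s: "s \<in> {0..1}"
    have "\<bar>(\<Sum>k\<le>N. G (k / N) * Bernstein N k s) - (\<Sum>k\<le>N. of_rat (cs ! k) * Bernstein N k s)\<bar> =
        \<bar>\<Sum>k\<le>N. (G (k / N) - of_rat (c k)) * Bernstein N k s\<bar>"
      by (simp add: nth sum_subtractf left_diff_distrib)
    also have "\<dots> \<le> (\<Sum>k\<le>N. \<bar>(G (k / N) - of_rat (c k)) * Bernstein N k s\<bar>)" by (rule sum_abs)
    also have "\<dots> \<le> (\<Sum>k\<le>N. \<epsilon> * Bernstein N k s)"
    proof (rule sum_mono)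
      fix k
      have "Bernstein N k s \<ge> 0" using s by (intro Bernstein_nonneg) auto
      then show "\<bar>(G (k / N) - of_rat (c k)) * Bernstein N k s\<bar> \<le> \<epsilon> * Bernstein N k s"
        using mult_right_mono[OF less_imp_le[OF c[of k]]] by (simp add: abs_mult)
    qed
    also have "\<dots> = \<epsilon>" by (simp flip: sum_distrib_left)
    finally show "\<bar>G s - (\<Sum>k\<le>length cs - 1. of_rat (cs ! k) * Bernstein (length cs - 1) k s)\<bar> < 2 * \<epsilon>"
      using N[OF order_refl s] unfolding len by linarith
  qed
qed

text \<open>
  Subtract the finitely many jumps of size at least \<open>\<epsilon>\<close>, approximate the rest by a continuous function on
  \<open>[0, 1]\<close>, the latter by a Bernstein polynomial, and make all coefficients rational.
\<close>

lemma simple_funs_dense: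
  assumes X: "X \<subseteq> {0<..<1}" and f: "f \<in> jumps_within X S" and \<eta>: "\<eta> > 0"
  obtains d where "d \<in> simple_funs X (S \<inter> X)" "\<And>p. p \<in> topspace (split_interval X) \<Longrightarrow> \<bar>f p - d p\<bar> \<le> \<eta>"
proof -
  let ?K = "split_interval X"
  (* Two parts for the averages, two for the rational Bernstein polynomial, one for the steps. *)
  define \<epsilon> where "\<epsilon> = \<eta> / 5"
  have \<epsilon>: "\<epsilon> > 0" using \<eta> by (simp add: \<epsilon>_def)
  have fK: "f \<in> cfun ?K" using f by (simp add: jumps_within_def)
  define J where "J = {y \<in> X. \<bar>jump y f\<bar> \<ge> \<epsilon>}"
  have J: "finite J" "J \<subseteq> X" unfolding J_def using cfun_finitely_many_large_jumps[OF X fK \<epsilon>] by auto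
  have JS: "J \<subseteq> S \<inter> X" 
  proof
    fix y assume y: "y \<in> J"
    then have "y \<in> X" "jump y f \<noteq> 0" using \<epsilon> by (auto simp: J_def)
    then show "y \<in> S \<inter> X" using f by (auto simp: jumps_within_def)
  qed
  define g where "g = (\<lambda>p\<in>topspace ?K. f p - (\<Sum>y\<in>J. jump y f * step X y p))"
  have g: "g \<in> cfun ?K" unfolding g_def
    by (intro restrict_in_cfun continuous_map_diff continuous_map_sum continuous_map_real_mult_left J(1)
        cfun_continuous fK step_in_cfun X) (use J(2) in auto)
  have small: "\<bar>jump z g\<bar> < \<epsilon>" if z: "z \<in> X" for z
  proof -
    have "(z, 0) \<in> topspace ?K" "(z, 1) \<in> topspace ?K" using z X by (auto simp: topspace_split_interval)
    then have "jump z g = jump z f - (\<Sum>y\<in>J. jump y f * jump z (step X y))"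
      by (simp add: jump_def g_def right_diff_distrib sum_subtractf)
    also have "(\<Sum>y\<in>J. jump y f * jump z (step X y)) = (\<Sum>y\<in>J. if y = z then jump y f else 0)"
      using J(2) by (intro sum.cong refl) (auto simp: jump_step[OF _ X z])
    also have "\<dots> = (if z \<in> J then jump z f else 0)" using J(1) by simp
    finally show ?thesis using \<epsilon> z by (auto simp: J_def)
  qed
  obtain G where G: "continuous_on {0..1} G" "\<And>p. p \<in> topspace ?K \<Longrightarrow> \<bar>g p - G (fst p)\<bar> \<le> 2 * \<epsilon>"
    using hat_approximation[OF X g \<epsilon> small] by metis
  obtain cs where cs: "\<And>s. s \<in> {0..1} \<Longrightarrow> \<bar>G s - (\<Sum>k\<le>length cs - 1. of_rat (cs ! k) * Bernstein (length cs - 1) k s)\<bar> < 2 * \<epsilon>"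
    using rational_Bernstein_approximation[OF G(1) \<epsilon>] by metis
  have "\<epsilon> / (card J + 1) > 0" using \<epsilon> by simp
  then have "\<exists>c::rat. \<bar>jump y f - of_rat c\<bar> < \<epsilon> / (card J + 1)" for y using rational_near by metis
  then obtain c :: "real \<Rightarrow> rat" where c: "\<And>y. \<bar>jump y f - of_rat (c y)\<bar> < \<epsilon> / (card J + 1)" by metis
  (* The errors of these coefficients add up to at most \<epsilon>. *)
  define js where "js = map (\<lambda>y. (c y, y)) (sorted_list_of_set J)"
  have js: "(\<Sum>(c, s)\<leftarrow>js. of_rat c * step X s p) = (\<Sum>y\<in>J. of_rat (c y) * step X y p)" for p
    using J(1) by (simp add: js_def comp_def sum_list_distinct_conv_sum_set)
  show ?thesis
  proof
    have "snd ` set js \<subseteq> S \<inter> X" using J JS by (auto simp: js_def)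
    then show "simple_fun X cs js \<in> simple_funs X (S \<inter> X)" unfolding simple_funs_def by blast
    fix p assume p: "p \<in> topspace ?K"
    have "\<bar>(\<Sum>y\<in>J. jump y f * step X y p) - (\<Sum>y\<in>J. of_rat (c y) * step X y p)\<bar> =
      \<bar>\<Sum>y\<in>J. (jump y f - of_rat (c y)) * step X y p\<bar>" by (simp add: left_diff_distrib sum_subtractf)
    also have "\<dots> \<le> (\<Sum>y\<in>J. \<bar>(jump y f - of_rat (c y)) * step X y p\<bar>)" by (rule sum_abs)
    also have "\<dots> \<le> (\<Sum>y\<in>J. \<epsilon> / (card J + 1) * 1)"
      unfolding abs_mult by (intro sum_mono mult_mono less_imp_le[OF c]) (use \<epsilon> p in \<open>auto simp: step_def\<close>)
    also have "\<dots> = \<epsilon> * (card J / (card J + 1))" by simp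
    also have "\<dots> \<le> \<epsilon> * 1" using \<epsilon> by (intro mult_left_mono) auto
    finally have 1: "\<bar>(\<Sum>y\<in>J. jump y f * step X y p) - (\<Sum>y\<in>J. of_rat (c y) * step X y p)\<bar> \<le> \<epsilon>" by simp
    have 2: "\<bar>g p - G (fst p)\<bar> \<le> 2 * \<epsilon>" by (rule G(2)[OF p])
    have 3: "\<bar>G (fst p) - (\<Sum>k\<le>length cs - 1. of_rat (cs ! k) * Bernstein (length cs - 1) k (fst p))\<bar> < 2 * \<epsilon>"
      by (rule cs) (use fst_split_interval[OF X p] in simp)
    have gp: "g p = f p - (\<Sum>y\<in>J. jump y f * step X y p)" using p by (simp add: g_def)
    have dp: "simple_fun X cs js p = (\<Sum>k\<le>length cs - 1. of_rat (cs ! k) * Bernstein (length cs - 1) k (fst p)) +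
        (\<Sum>y\<in>J. of_rat (c y) * step X y p)" using p by (simp add: simple_fun_def js)
    have "\<eta> = 2 * \<epsilon> + 2 * \<epsilon> + \<epsilon>" by (simp add: \<epsilon>_def)
    then show "\<bar>f p - simple_fun X cs js p\<bar> \<le> \<eta>" using 1 2 3 unfolding gp dp by linarith
  qed
qed

section \<open>Topologies generated by functionals\<close>

text \<open>
  The weak topology and the topology of pointwise convergence are the cases that \<open>\<Phi>\<close> is the dual space and the
  set of evaluations.
\<close>

definition functional_topology :: "'a topology \<Rightarrow> (('a \<Rightarrow> real) \<Rightarrow> real) set \<Rightarrow> ('a \<Rightarrow> real) topology" where
  "functional_topology K \<Phi> = topology_generated_by {{f \<in> cfun K. \<phi> f \<in> U} |\<phi> U. \<phi> \<in> \<Phi> \<and> open U}"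

lemma C_w_eq_functional_topology: "C_w K = functional_topology K (cfun_dual K)"
  by (simp add: C_w_def functional_topology_def)

definition evaluations :: "'a topology \<Rightarrow> (('a \<Rightarrow> real) \<Rightarrow> real) set" where
  "evaluations K = (\<lambda>x f. f x) ` topspace K"

lemma topspace_functional_topology:
  assumes "\<Phi> \<noteq> {}" shows "topspace (functional_topology K \<Phi>) = cfun K"
proof -
  obtain \<phi> where "\<phi> \<in> \<Phi>" using assms by blast
  then have "cfun K \<in> {{f \<in> cfun K. \<phi> f \<in> U} |\<phi> U. \<phi> \<in> \<Phi> \<and> open U}"
    by (intro CollectI exI[of _ \<phi>] exI[of _ UNIV]) auto
  then show ?thesis
    unfolding functional_topology_def topology_generated_by_topspace by blast
qed

lemma openin_functional_topology:
  assumes "\<phi> \<in> \<Phi>" "open U" shows "openin (functional_topology K \<Phi>) {f \<in> cfun K. \<phi> f \<in> U}"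
  unfolding functional_topology_def by (rule topology_generated_by_Basis) (use assms in blast)

lemma continuous_map_functional:
  assumes "\<phi> \<in> \<Phi>" shows "continuous_map (functional_topology K \<Phi>) euclideanreal \<phi>"
proof -
  have ts: "topspace (functional_topology K \<Phi>) = cfun K" using topspace_functional_topology assms by auto
  show ?thesis unfolding continuous_map_def ts using openin_functional_topology[OF assms] by auto
qed

lemma continuous_map_into_functional_topology:
  assumes "\<Phi> \<noteq> {}" and im: "\<And>t. t \<in> topspace Y \<Longrightarrow> \<gamma> t \<in> cfun K"
    and cont: "\<And>\<phi>. \<phi> \<in> \<Phi> \<Longrightarrow> continuous_map Y euclideanreal (\<lambda>t. \<phi> (\<gamma> t))"
  shows "continuous_map Y (functional_topology K \<Phi>) \<gamma>"
  unfolding functional_topology_def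
proof (rule continuous_on_generated_topo)
  fix W assume "W \<in> {{f \<in> cfun K. \<phi> f \<in> U} |\<phi> U. \<phi> \<in> \<Phi> \<and> open U}"
  then obtain \<phi> U where W: "W = {f \<in> cfun K. \<phi> f \<in> U}" "\<phi> \<in> \<Phi>" "open U" by blast
  have "\<gamma> -` W \<inter> topspace Y = {t \<in> topspace Y. \<phi> (\<gamma> t) \<in> U}" using im by (auto simp: W(1))
  then show "openin Y (\<gamma> -` W \<inter> topspace Y)"
    using openin_continuous_map_preimage[OF cont[OF W(2)], of U] W(3) by simp
next
  have "\<Union> {{f \<in> cfun K. \<phi> f \<in> U} |\<phi> U. \<phi> \<in> \<Phi> \<and> open U} = cfun K"
    using topspace_functional_topology[OF assms(1), of K]
    unfolding functional_topology_def topology_generated_by_topspace .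
  then show "\<gamma> ` topspace Y \<subseteq> \<Union> {{f \<in> cfun K. \<phi> f \<in> U} |\<phi> U. \<phi> \<in> \<Phi> \<and> open U}"
    using im by auto
qed

lemma C_p_eq_functional_topology:
  assumes "topspace K \<noteq> {}" shows "C_p K = functional_topology K (evaluations K)"
proof (rule topology_eq[THEN iffD2], intro allI iffI)
  have ne: "evaluations K \<noteq> {}" using assms by (simp add: evaluations_def)
  have ts: "topspace (functional_topology K (evaluations K)) = cfun K" by (rule topspace_functional_topology[OF ne])
  have 1: "continuous_map (functional_topology K (evaluations K)) (C_p K) (\<lambda>f. f)"
    unfolding C_p_def continuous_map_in_subtopology continuous_map_componentwise ts
  proof (intro conjI ballI)
    show "(\<lambda>f. f) ` cfun K \<subseteq> extensional (topspace K)" by (auto simp: cfun_def)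
    show "continuous_map (functional_topology K (evaluations K)) euclideanreal (\<lambda>f. f x)" if "x \<in> topspace K" for x
      by (rule continuous_map_functional) (use that in \<open>simp add: evaluations_def\<close>)
  qed auto
  have 2: "continuous_map (C_p K) (functional_topology K (evaluations K)) (\<lambda>f. f)"
  proof (rule continuous_map_into_functional_topology[OF ne])
    fix \<phi> assume "\<phi> \<in> evaluations K"
    then obtain x where x: "x \<in> topspace K" "\<phi> = (\<lambda>f. f x)" by (auto simp: evaluations_def)
    have "continuous_map (product_topology (\<lambda>_. euclideanreal) (topspace K)) euclideanreal (\<lambda>f. f x)"
      by (rule continuous_map_product_projection[OF x(1)])
    then show "continuous_map (C_p K) euclideanreal (\<lambda>f. \<phi> f)"
      unfolding x(2) C_p_def by (rule continuous_map_from_subtopology)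
  qed simp
  fix W
  show "openin (functional_topology K (evaluations K)) W" if W: "openin (C_p K) W"
  proof -
    have "{f \<in> cfun K. f \<in> W} = W" using openin_subset[OF W] by auto
    then show ?thesis using openin_continuous_map_preimage[OF 1 W] by (simp add: ts)
  qed
  show "openin (C_p K) W" if W: "openin (functional_topology K (evaluations K)) W"
  proof -
    have "{f \<in> cfun K. f \<in> W} = W" using openin_subset[OF W] by (auto simp: ts)
    then show ?thesis using openin_continuous_map_preimage[OF 2 W] by simp
  qed
qed

lemma evaluations_subset_cfun_dual:
  assumes "X \<subseteq> {0<..<1}"
  shows "evaluations (split_interval X) \<subseteq> cfun_dual (split_interval X)"
proof
  let ?K = "split_interval X"
  fix \<phi> assume "\<phi> \<in> evaluations ?K"
  then obtain x where x: "x \<in> topspace ?K" "\<phi> = (\<lambda>f. f x)" by (auto simp: evaluations_def)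
  have "\<bar>f x\<bar> \<le> sup_norm ?K f * 1" if "f \<in> cfun ?K" for f
    unfolding sup_norm_def using cSUP_upper[OF x(1) cfun_bounded[OF assms that]] by simp
  then show "\<phi> \<in> cfun_dual ?K" unfolding cfun_dual_def x(2) using x(1) by (auto intro: exI[of _ 1])
qed

lemma zero_in_cfun: "(\<lambda>x\<in>topspace K. 0) \<in> cfun K"
  by (intro restrict_in_cfun) simp

text \<open>
  If the prescribed values cannot be attained, then \<open>\<phi>\<close> vanishes on the common kernel of \<open>F\<close>: otherwise an element of
  that kernel could be used to correct the value of \<open>\<phi>\<close>.  With a dual basis \<open>e\<close> of \<open>F\<close> this expresses \<open>\<phi>\<close> in terms
  of \<open>F\<close>.
\<close>

lemma free_extension:
  assumes \<Phi>: "insert \<phi> F \<subseteq> cfun_dual K" and F: "finite F" "finitely_free F (\<lambda>b. b) (cfun K)"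
    and nfree: "\<not> (\<exists>v\<in>cfun K. \<forall>b\<in>insert \<phi> F. b v = c b)"
  shows "\<exists>a. \<forall>f\<in>cfun K. \<phi> f = (\<Sum>b\<in>F. a b * b f)"
proof -
  have solve: "\<exists>v\<in>cfun K. \<forall>b\<in>F. b v = d b" for d
    using F unfolding finitely_free_def by blast
  have ker: "\<phi> v = 0" if v: "v \<in> cfun K" "\<And>b. b \<in> F \<Longrightarrow> b v = 0" for v
  proof (rule ccontr)
    assume nz: "\<phi> v \<noteq> 0"
    obtain w where w: "w \<in> cfun K" "\<And>b. b \<in> F \<Longrightarrow> b w = c b" using solve[of c] by blast
    define u where "u = add_scaled K w ((c \<phi> - \<phi> w) / \<phi> v) v"
    have u: "u \<in> cfun K" using w(1) v(1) by (auto simp: u_def)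
    have bu: "b u = b w + (c \<phi> - \<phi> w) / \<phi> v * b v" if "b \<in> insert \<phi> F" for b
      unfolding u_def by (rule dual_add_scaled[OF subsetD[OF \<Phi> that] w(1) v(1)])
    have "b u = c b" if b: "b \<in> insert \<phi> F" for b
    proof (cases "b = \<phi>")
      case True
      then show ?thesis using bu[OF b] nz by simp
    next
      case False
      then show ?thesis using bu[OF b] b w(2) v(2) by simp
    qed
    then show False using nfree u by blast
  qed
  have "\<forall>b. \<exists>e\<in>cfun K. \<forall>b'\<in>F. b' e = (if b' = b then 1 else 0)"
    by (intro allI solve)
  then obtain e where e: "\<And>b. e b \<in> cfun K" "\<And>b b'. b' \<in> F \<Longrightarrow> b' (e b) = (if b' = b then 1 else 0)"
    by metis
  show ?thesis
  proof (intro exI ballI)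
    fix f assume f: "f \<in> cfun K"
    define s where "s = (\<lambda>p\<in>topspace K. \<Sum>b\<in>F. b f * e b p)"
    have s: "s \<in> cfun K" "\<And>\<psi>. \<psi> \<in> insert \<phi> F \<Longrightarrow> \<psi> s = (\<Sum>b\<in>F. b f * \<psi> (e b))"
    proof -
      have "s \<in> cfun K \<and> \<psi> s = (\<Sum>b\<in>F. b f * \<psi> (e b))" if "\<psi> \<in> insert \<phi> F" for \<psi>
        unfolding s_def by (rule dual_sum[OF subsetD[OF \<Phi> that] F(1) e(1)])
      then show "s \<in> cfun K" "\<And>\<psi>. \<psi> \<in> insert \<phi> F \<Longrightarrow> \<psi> s = (\<Sum>b\<in>F. b f * \<psi> (e b))" by blast+
    qed
    have u: "\<psi> (add_scaled K f (-1) s) = \<psi> f - \<psi> s" if "\<psi> \<in> insert \<phi> F" for \<psi>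
      using dual_add_scaled[of \<psi> K f s "-1"] that \<Phi> f s(1) by auto
    have "\<phi> (add_scaled K f (-1) s) = 0"
    proof (rule ker)
      show "add_scaled K f (-1) s \<in> cfun K" using f s(1) by auto
      fix b assume b: "b \<in> F"
      have "(\<Sum>b'\<in>F. b' f * b (e b')) = (\<Sum>b'\<in>F. if b = b' then b' f else 0)"
        by (rule sum.cong) (auto simp: e(2)[OF b])
      also have "\<dots> = b f" using b F(1) by simp
      finally show "b (add_scaled K f (-1) s) = 0" using u[of b] s(2)[of b] b by simp
    qed
    then have "\<phi> f = \<phi> s" using u[of \<phi>] by simp
    then show "\<phi> f = (\<Sum>b\<in>F. \<phi> (e b) * b f)" using s(2)[of \<phi>] by (simp add: mult.commute)
  qed
qed

lemma free_basis_exists: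
  assumes \<Phi>: "\<Phi> \<subseteq> cfun_dual K"
  obtains B where "B \<subseteq> \<Phi>" "finitely_free B (\<lambda>b. b) (cfun K)"
    "\<And>\<phi>. \<phi> \<in> \<Phi> \<Longrightarrow> \<exists>F a. finite F \<and> F \<subseteq> B \<and> (\<forall>f\<in>cfun K. \<phi> f = (\<Sum>b\<in>F. a b * b f))"
proof -
  define \<A> where "\<A> = {B. B \<subseteq> \<Phi> \<and> finitely_free B (\<lambda>b. b) (cfun K)}"
  have "\<exists>M\<in>\<A>. \<forall>Y\<in>\<A>. M \<subseteq> Y \<longrightarrow> Y = M"
  proof (rule subset_Zorn_nonempty)
    have "{} \<in> \<A>" using zero_in_cfun by (auto simp: \<A>_def finitely_free_def)
    then show "\<A> \<noteq> {}" by blast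
    fix \<C> assume ne: "\<C> \<noteq> {}" and chain: "subset.chain \<A> \<C>"
    have sub: "\<C> \<subseteq> \<A>" using chain by (simp add: subset_chain_def)
    have "\<exists>v\<in>cfun K. \<forall>b\<in>F. b v = c b" if F: "finite F" "F \<subseteq> \<Union>\<C>" for F c
    proof -
      obtain B where B: "B \<in> \<C>" "F \<subseteq> B"
        by (rule finite_subset_Union_chain[OF F ne chain])
      then have "finitely_free B (\<lambda>b. b) (cfun K)" using sub by (auto simp: \<A>_def)
      then show ?thesis unfolding finitely_free_def using F(1) B(2) by simp
    qed
    then show "\<Union>\<C> \<in> \<A>" using sub by (auto simp: \<A>_def finitely_free_def)
  qed
  then obtain B where BA: "B \<in> \<A>" and max: "\<And>Y. Y \<in> \<A> \<Longrightarrow> B \<subseteq> Y \<Longrightarrow> Y = B" by metis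
  have B: "B \<subseteq> \<Phi>" "finitely_free B (\<lambda>b. b) (cfun K)" using BA by (simp_all add: \<A>_def)
  show ?thesis
  proof (rule that[OF B])
    fix \<phi> assume \<phi>: "\<phi> \<in> \<Phi>"
    show "\<exists>F a. finite F \<and> F \<subseteq> B \<and> (\<forall>f\<in>cfun K. \<phi> f = (\<Sum>b\<in>F. a b * b f))"
    proof (cases "\<phi> \<in> B")
      case True
      then show ?thesis by (intro exI[of _ "{\<phi>}"] exI[of _ "\<lambda>_. 1"]) simp
    next
      case False
      then have "insert \<phi> B \<notin> \<A>" using max[of "insert \<phi> B"] by blast
      then have "\<not> finitely_free (insert \<phi> B) (\<lambda>b. b) (cfun K)" using B(1) \<phi> by (simp add: \<A>_def)
      then obtain F c where F: "finite F" "F \<subseteq> insert \<phi> B" "\<not> (\<exists>v\<in>cfun K. \<forall>b\<in>F. b v = c b)"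
        unfolding finitely_free_def by blast
      define G where "G = F - {\<phi>}"
      have G: "finite G" "G \<subseteq> B" "\<phi> \<notin> G" using F by (auto simp: G_def)
      have "finitely_free G (\<lambda>b. b) (cfun K)" using B(2) G(2) unfolding finitely_free_def by (meson order_trans)
      moreover have "insert \<phi> G \<subseteq> cfun_dual K" using G(2) B(1) \<phi> \<Phi> by auto
      moreover have "\<not> (\<exists>v\<in>cfun K. \<forall>b\<in>insert \<phi> G. b v = c b)" using F(3) by (auto simp: G_def)
      ultimately have "\<exists>a. \<forall>f\<in>cfun K. \<phi> f = (\<Sum>b\<in>G. a b * b f)"
        using free_extension[of \<phi> G K c] G by blast
      then show ?thesis using G by blast
    qed
  qed
qed

definition generated_by_functionals :: "'v topology \<Rightarrow> 'i set \<Rightarrow> ('i \<Rightarrow> 'v \<Rightarrow> real) \<Rightarrow> bool" where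
  "generated_by_functionals Y I ev \<longleftrightarrow> (\<forall>W v. openin Y W \<longrightarrow> v \<in> W \<longrightarrow>
     (\<exists>F \<delta>. finite F \<and> F \<subseteq> I \<and> \<delta> > 0 \<and> (\<forall>w\<in>topspace Y. (\<forall>b\<in>F. \<bar>ev b w - ev b v\<bar> < \<delta>) \<longrightarrow> w \<in> W)))"

lemma continuous_map_initially_continuous:
  assumes gen: "generated_by_functionals Y I ev" and \<phi>: "continuous_map Y euclideanreal \<phi>"
  shows "initially_continuous I ev (topspace Y) \<phi>"
  unfolding initially_continuous_def
proof (intro ballI allI impI)
  fix v and \<epsilon> :: real assume v: "v \<in> topspace Y" and \<epsilon>: "\<epsilon> > 0"
  let ?W = "{w \<in> topspace Y. \<phi> w \<in> ball (\<phi> v) \<epsilon>}"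
  have op: "openin Y ?W" by (rule openin_continuous_map_preimage[OF \<phi>]) simp
  have vW: "v \<in> ?W" using v \<epsilon> by simp
  obtain F \<delta> where F: "finite F" "F \<subseteq> I" "\<delta> > 0" "\<forall>w\<in>topspace Y. (\<forall>b\<in>F. \<bar>ev b w - ev b v\<bar> < \<delta>) \<longrightarrow> w \<in> ?W"
    using gen[unfolded generated_by_functionals_def, rule_format, OF op vW] by blast
  have "\<forall>w\<in>topspace Y. (\<forall>b\<in>F. \<bar>ev b w - ev b v\<bar> < \<delta>) \<longrightarrow> \<bar>\<phi> w - \<phi> v\<bar> < \<epsilon>"
    using F(4) by (simp add: dist_real_def abs_minus_commute)
  then show "\<exists>F \<delta>. finite F \<and> F \<subseteq> I \<and> 0 < \<delta> \<and> (\<forall>w\<in>topspace Y. (\<forall>b\<in>F. \<bar>ev b w - ev b v\<bar> < \<delta>) \<longrightarrow> \<bar>\<phi> w - \<phi> v\<bar> < \<epsilon>)"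
    using F(1-3) by blast
qed

text \<open>
  A finite linear combination is controlled by its members, so a spanning subfamily of \<open>\<Phi>\<close> has the same
  neighbourhoods.
\<close>

lemma functional_topology_generated_by_basis:
  assumes "\<Phi> \<noteq> {}" and
    span: "\<And>\<phi>. \<phi> \<in> \<Phi> \<Longrightarrow> \<exists>F a. finite F \<and> F \<subseteq> B \<and> (\<forall>f\<in>cfun K. \<phi> f = (\<Sum>b\<in>F. a b * b f))"
  shows "generated_by_functionals (functional_topology K \<Phi>) B (\<lambda>b. b)"
proof -
  note ts = topspace_functional_topology[OF assms(1), of K]
  have main: "v \<in> cfun K \<longrightarrow> v \<in> W \<longrightarrow>
     (\<exists>F \<delta>. finite F \<and> F \<subseteq> B \<and> \<delta> > 0 \<and> (\<forall>w\<in>cfun K. (\<forall>b\<in>F. \<bar>b w - b v\<bar> < \<delta>) \<longrightarrow> w \<in> W))"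
    if "generate_topology_on {{f \<in> cfun K. \<phi> f \<in> U} |\<phi> U. \<phi> \<in> \<Phi> \<and> open U} W" for W v
    using that
  proof (induction rule: generate_topology_on.induct)
    case Empty
    then show ?case by simp
  next
    case (Int W1 W2)
    show ?case
    proof (intro impI)
      assume v: "v \<in> cfun K" "v \<in> W1 \<inter> W2"
      obtain F d where 1: "finite F" "F \<subseteq> B" "d > 0" "\<forall>w\<in>cfun K. (\<forall>b\<in>F. \<bar>b w - b v\<bar> < d) \<longrightarrow> w \<in> W1"
        using Int.IH(1) v by blast
      obtain G e where 2: "finite G" "G \<subseteq> B" "e > 0" "\<forall>w\<in>cfun K. (\<forall>b\<in>G. \<bar>b w - b v\<bar> < e) \<longrightarrow> w \<in> W2"
        using Int.IH(2) v by blast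
      have "\<forall>w\<in>cfun K. (\<forall>b\<in>F \<union> G. \<bar>b w - b v\<bar> < min d e) \<longrightarrow> w \<in> W1 \<inter> W2" using 1(4) 2(4) by simp
      then show "\<exists>F \<delta>. finite F \<and> F \<subseteq> B \<and> \<delta> > 0 \<and> (\<forall>w\<in>cfun K. (\<forall>b\<in>F. \<bar>b w - b v\<bar> < \<delta>) \<longrightarrow> w \<in> W1 \<inter> W2)"
        using 1(1-3) 2(1-3) by (intro exI[of _ "F \<union> G"] exI[of _ "min d e"]) simp
    qed
  next
    case (UN \<K>)
    show ?case
    proof (intro impI)
      assume v: "v \<in> cfun K" "v \<in> \<Union>\<K>"
      then obtain k where k: "k \<in> \<K>" "v \<in> k" by (elim UnionE)
      obtain F d where 1: "finite F" "F \<subseteq> B" "d > 0" "\<forall>w\<in>cfun K. (\<forall>b\<in>F. \<bar>b w - b v\<bar> < d) \<longrightarrow> w \<in> k"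
        using UN.IH[OF k(1)] v(1) k(2) by blast
      then show "\<exists>F \<delta>. finite F \<and> F \<subseteq> B \<and> \<delta> > 0 \<and> (\<forall>w\<in>cfun K. (\<forall>b\<in>F. \<bar>b w - b v\<bar> < \<delta>) \<longrightarrow> w \<in> \<Union>\<K>)"
        using k(1) by (intro exI[of _ F] exI[of _ d]) blast
    qed
  next
    case (Basis W)
    then obtain \<phi> U where W: "W = {f \<in> cfun K. \<phi> f \<in> U}" "\<phi> \<in> \<Phi>" "open U" by blast
    obtain F a where F: "finite F" "F \<subseteq> B" "\<forall>f\<in>cfun K. \<phi> f = (\<Sum>b\<in>F. a b * b f)" using span[OF W(2)] by blast
    show ?case
    proof (intro impI)
      assume v: "v \<in> cfun K" "v \<in> W"
      then have "\<phi> v \<in> U" by (simp add: W(1))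
      then obtain e where e: "e > 0" "ball (\<phi> v) e \<subseteq> U" using W(3) open_contains_ball by blast
      define A where "A = 1 + (\<Sum>b\<in>F. \<bar>a b\<bar>)"
      have A: "A > 0" "(\<Sum>b\<in>F. \<bar>a b\<bar>) < A" 
        using sum_nonneg[of F "\<lambda>b. \<bar>a b\<bar>", OF abs_ge_zero] unfolding A_def by linarith+
      have "w \<in> W" if w: "w \<in> cfun K" "\<And>b. b \<in> F \<Longrightarrow> \<bar>b w - b v\<bar> < e / A" for w
      proof -
        have "\<bar>\<phi> w - \<phi> v\<bar> = \<bar>\<Sum>b\<in>F. a b * (b w - b v)\<bar>"
          using F(3) w(1) v(1) by (simp add: right_diff_distrib sum_subtractf)
        also have "\<dots> \<le> (\<Sum>b\<in>F. \<bar>a b * (b w - b v)\<bar>)" by (rule sum_abs)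
        also have "\<dots> \<le> (\<Sum>b\<in>F. \<bar>a b\<bar> * (e / A))"
          unfolding abs_mult by (intro sum_mono mult_left_mono less_imp_le[OF w(2)]) auto
        also have "\<dots> = (\<Sum>b\<in>F. \<bar>a b\<bar>) * (e / A)" by (simp only: sum_distrib_right)
        also have "\<dots> < A * (e / A)" using A e(1) by (intro mult_strict_right_mono) auto
        also have "\<dots> = e" using A(1) by simp
        finally have "\<phi> w \<in> ball (\<phi> v) e" by (simp add: dist_real_def abs_minus_commute)
        then show ?thesis using e(2) w(1) W(1) by blast
      qed
      then show "\<exists>F \<delta>. finite F \<and> F \<subseteq> B \<and> \<delta> > 0 \<and> (\<forall>w\<in>cfun K. (\<forall>b\<in>F. \<bar>b w - b v\<bar> < \<delta>) \<longrightarrow> w \<in> W)"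
        using F(1,2) e(1) A(1) by (intro exI[of _ F] exI[of _ "e / A"]) simp
    qed
  qed
  show ?thesis
    unfolding generated_by_functionals_def ts
  proof (intro allI impI)
    fix W v assume W: "openin (functional_topology K \<Phi>) W" "v \<in> W"
    have "v \<in> cfun K" using openin_subset[OF W(1)] W(2) ts by blast
    moreover have "generate_topology_on {{f \<in> cfun K. \<phi> f \<in> U} |\<phi> U. \<phi> \<in> \<Phi> \<and> open U} W"
      using W(1) unfolding functional_topology_def by (rule openin_topology_generated_by)
    ultimately show "\<exists>F \<delta>. finite F \<and> F \<subseteq> B \<and> \<delta> > 0 \<and> (\<forall>w\<in>cfun K. (\<forall>b\<in>F. \<bar>b w - b v\<bar> < \<delta>) \<longrightarrow> w \<in> W)"
      using main W(2) by blast
  qed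
qed

definition ev_pair :: "('i \<Rightarrow> 'v \<Rightarrow> real) \<Rightarrow> bool \<times> 'i \<Rightarrow> 'v \<times> 'v \<Rightarrow> real" where
  "ev_pair ev ib v = ev (snd ib) (if fst ib then fst v else snd v)"

lemma finitely_free_pair:
  fixes ev :: "'i \<Rightarrow> 'v \<Rightarrow> real"
  assumes "finitely_free I ev V" shows "finitely_free (UNIV \<times> I) (ev_pair ev) (V \<times> V)"
  unfolding finitely_free_def
proof (intro allI impI)
  fix F :: "(bool \<times> 'i) set" and c :: "bool \<times> 'i \<Rightarrow> real" assume F: "finite F" "F \<subseteq> UNIV \<times> I"
  have "\<exists>v\<in>V. \<forall>b\<in>snd ` F. ev b v = c (i, b)" for i
    by (rule assms[unfolded finitely_free_def, rule_format]) (use F in auto)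
  then obtain v :: "bool \<Rightarrow> 'v" where v: "\<And>i. v i \<in> V" "\<And>i b. b \<in> snd ` F \<Longrightarrow> ev b (v i) = c (i, b)" by metis
  have "ev_pair ev ib (v True, v False) = c ib" if "ib \<in> F" for ib
  proof -
    have "snd ib \<in> snd ` F" using that by blast
    then show ?thesis using v(2)[of "snd ib" "fst ib"] by (cases ib; cases "fst ib") (simp_all add: ev_pair_def)
  qed
  then show "\<exists>v\<in>V \<times> V. \<forall>b\<in>F. ev_pair ev b v = c b" using v(1) by blast
qed

lemma generated_by_functionals_pair:
  assumes "generated_by_functionals Y I ev"
  shows "generated_by_functionals (prod_topology Y Y) (UNIV \<times> I) (ev_pair ev)"
  unfolding generated_by_functionals_def
proof (intro allI impI)
  fix W v assume W: "openin (prod_topology Y Y) W" "v \<in> W"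
  obtain f g where v: "v = (f, g)" by (cases v)
  obtain U1 U2 where U: "openin Y U1" "openin Y U2" "f \<in> U1" "g \<in> U2" "U1 \<times> U2 \<subseteq> W"
    using W unfolding v openin_prod_topology_alt by meson
  obtain F d where 1: "finite F" "F \<subseteq> I" "d > 0" "\<forall>w\<in>topspace Y. (\<forall>b\<in>F. \<bar>ev b w - ev b f\<bar> < d) \<longrightarrow> w \<in> U1"
    using assms[unfolded generated_by_functionals_def, rule_format, OF U(1,3)] by blast
  obtain G e where 2: "finite G" "G \<subseteq> I" "e > 0" "\<forall>w\<in>topspace Y. (\<forall>b\<in>G. \<bar>ev b w - ev b g\<bar> < e) \<longrightarrow> w \<in> U2"
    using assms[unfolded generated_by_functionals_def, rule_format, OF U(2,4)] by blast
  have "w \<in> W" if w: "w \<in> topspace (prod_topology Y Y)"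
    "\<forall>b\<in>{True} \<times> F \<union> {False} \<times> G. \<bar>ev_pair ev b w - ev_pair ev b v\<bar> < min d e" for w
  proof -
    have "fst w \<in> U1"
      using 1(4) w by (auto simp: ev_pair_def v ball_Un)
    moreover have "snd w \<in> U2"
      using 2(4) w by (auto simp: ev_pair_def v ball_Un)
    ultimately show ?thesis using U(5) by (cases w) auto
  qed
  then show "\<exists>F \<delta>. finite F \<and> F \<subseteq> UNIV \<times> I \<and> \<delta> > 0 \<and>
      (\<forall>w\<in>topspace (prod_topology Y Y). (\<forall>b\<in>F. \<bar>ev_pair ev b w - ev_pair ev b v\<bar> < \<delta>) \<longrightarrow> w \<in> W)"
    using 1(1-3) 2(1-3) by (intro exI[of _ "{True} \<times> F \<union> {False} \<times> G"] exI[of _ "min d e"]) auto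
qed

section \<open>A function space not homeomorphic to its square\<close>

text \<open>
  Boundedness of the functionals in \<open>\<Phi>\<close> turns uniform density into density for \<open>T\<close>; the evaluations in \<open>\<Phi>\<close>
  make the jump functionals continuous.
\<close>

locale rigid_function_space =
  fixes X :: "real set" and \<Phi> :: "((real \<times> nat \<Rightarrow> real) \<Rightarrow> real) set"
  assumes X: "X \<subseteq> {0<..<1}" and rigid: "gdelta_rigid X" and unc: "uncountable X"
    and \<Phi>_dual: "\<Phi> \<subseteq> cfun_dual (split_interval X)"
    and evals: "evaluations (split_interval X) \<subseteq> \<Phi>"
begin

abbreviation "K \<equiv> split_interval X"
abbreviation "T \<equiv> functional_topology K \<Phi>"

lemma K_nonempty: "topspace K \<noteq> {}" by (auto simp: topspace_split_interval)

lemma \<Phi>_nonempty: "\<Phi> \<noteq> {}"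
  using evals K_nonempty by (auto simp: evaluations_def)

lemma topspace_T: "topspace T = cfun K"
  by (rule topspace_functional_topology[OF \<Phi>_nonempty])

lemma continuous_map_eval:
  assumes "p \<in> topspace K" shows "continuous_map T euclideanreal (\<lambda>f. f p)"
  by (rule continuous_map_functional) (use assms evals in \<open>auto simp: evaluations_def\<close>)

lemma continuous_map_jump:
  assumes "y \<in> X" shows "continuous_map T euclideanreal (jump y)"
proof -
  have "(y, 0) \<in> topspace K" "(y, 1) \<in> topspace K" using assms X by (auto simp: topspace_split_interval)
  then have "continuous_map T euclideanreal (\<lambda>f. f (y, 1) - f (y, 0))"
    by (intro continuous_map_diff continuous_map_eval)
  then show ?thesis by (simp add: jump_def[abs_def])
qed

lemma closedin_jumps_within: "closedin T (jumps_within X S)"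
proof (cases "X - S = {}")
  case True
  then have "jumps_within X S = topspace T" by (auto simp: jumps_within_def topspace_T)
  then show ?thesis by simp
next
  case False
  have "jumps_within X S = (\<Inter>y\<in>X - S. {f \<in> topspace T. jump y f \<in> {0}})"
    using False by (auto simp: jumps_within_def topspace_T)
  moreover have "closedin T {f \<in> topspace T. jump y f \<in> {0}}" if "y \<in> X - S" for y
    by (rule closedin_continuous_map_preimage[OF continuous_map_jump]) (use that in auto)
  ultimately show ?thesis using closedin_INT[OF False, of T] by (simp only:)
qed

lemma free_basis:
  obtains B where "B \<subseteq> \<Phi>" "finitely_free B (\<lambda>b. b) (topspace T)" "generated_by_functionals T B (\<lambda>b. b)"
proof -
  obtain B where B: "B \<subseteq> \<Phi>" "finitely_free B (\<lambda>b. b) (cfun K)"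
    "\<And>\<phi>. \<phi> \<in> \<Phi> \<Longrightarrow> \<exists>F a. finite F \<and> F \<subseteq> B \<and> (\<forall>f\<in>cfun K. \<phi> f = (\<Sum>b\<in>F. a b * b f))"
    by (rule free_basis_exists[OF \<Phi>_dual]) blast
  show ?thesis
    by (rule that[OF B(1)]) (use B functional_topology_generated_by_basis[OF \<Phi>_nonempty B(3)] in \<open>simp_all add: topspace_T\<close>)
qed

lemma jumps_within_subset_closure:
  assumes S: "S \<subseteq> X"
  shows "jumps_within X S \<subseteq> T closure_of simple_funs X S"
proof
  fix f assume f: "f \<in> jumps_within X S"
  then have fK: "f \<in> cfun K" by (simp add: jumps_within_def)
  obtain B where B: "B \<subseteq> \<Phi>" "generated_by_functionals T B (\<lambda>b. b)" using free_basis by metis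
  show "f \<in> T closure_of simple_funs X S"
    unfolding in_closure_of
  proof (intro conjI allI impI)
    show "f \<in> topspace T" using fK by (simp add: topspace_T)
    fix W assume W: "f \<in> W \<and> openin T W"
    then obtain F \<delta> where F: "finite F" "F \<subseteq> B" "\<delta> > 0"
      "\<forall>w\<in>topspace T. (\<forall>b\<in>F. \<bar>b w - b f\<bar> < \<delta>) \<longrightarrow> w \<in> W"
      using B(2)[unfolded generated_by_functionals_def, rule_format, of W f] by blast
    have "\<forall>b\<in>F. \<exists>M>0. \<forall>u r. u \<in> cfun K \<longrightarrow> (\<forall>x\<in>topspace K. \<bar>u x\<bar> \<le> r) \<longrightarrow> \<bar>b u\<bar> \<le> r * M"
    proof
      fix b assume "b \<in> F"
      then have "b \<in> cfun_dual K" using F(2) B(1) \<Phi>_dual by blast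
      from dual_bounded[OF K_nonempty this] obtain M where
        "M > 0" "\<And>f b'. f \<in> cfun K \<Longrightarrow> (\<And>x. x \<in> topspace K \<Longrightarrow> \<bar>f x\<bar> \<le> b') \<Longrightarrow> \<bar>b f\<bar> \<le> b' * M" by metis
      then show "\<exists>M>0. \<forall>u r. u \<in> cfun K \<longrightarrow> (\<forall>x\<in>topspace K. \<bar>u x\<bar> \<le> r) \<longrightarrow> \<bar>b u\<bar> \<le> r * M" by blast
    qed
    then obtain M where M: "\<And>b. b \<in> F \<Longrightarrow> M b > 0"
      "\<And>b u r. b \<in> F \<Longrightarrow> u \<in> cfun K \<Longrightarrow> (\<And>x. x \<in> topspace K \<Longrightarrow> \<bar>u x\<bar> \<le> r) \<Longrightarrow> \<bar>b u\<bar> \<le> r * M b"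
      by metis
    define N where "N = 1 + (\<Sum>b\<in>F. M b)"
    have MN: "M b < N" if "b \<in> F" for b
      using member_le_sum[of b F M] that F(1) M(1) by (force simp: N_def intro: less_imp_le)
    have N: "N > 0" using sum_nonneg[of F M] M(1) by (force simp: N_def intro: less_imp_le)
    have "\<delta> / N > 0" using F(3) N by simp
    then obtain d where d: "d \<in> simple_funs X (S \<inter> X)" "\<And>p. p \<in> topspace K \<Longrightarrow> \<bar>f p - d p\<bar> \<le> \<delta> / N"
      using simple_funs_dense[OF X f] by metis
    have SX: "S \<inter> X = S" using S by blast
    have dK: "d \<in> cfun K" using simple_funs_in_cfun[OF X S] d(1) SX by auto
    have "\<bar>b d - b f\<bar> < \<delta>" if b: "b \<in> F" for b
    proof -
      let ?u = "add_scaled K d (-1) f"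
      have u: "?u \<in> cfun K" using dK fK by auto
      have bd: "b \<in> cfun_dual K" using b F(2) B(1) \<Phi>_dual by blast
      have "\<bar>b d - b f\<bar> = \<bar>b ?u\<bar>" using dual_add_scaled[OF bd dK fK, of "-1"] by simp
      also have "\<dots> \<le> \<delta> / N * M b"
        by (rule M(2)[OF b u]) (use d(2) in \<open>simp add: abs_minus_commute\<close>)
      also have "\<dots> < \<delta> / N * N" using MN[OF b] \<open>\<delta> / N > 0\<close> by (intro mult_strict_left_mono)
      also have "\<dots> = \<delta>" using N by simp
      finally show ?thesis .
    qed
    then have "d \<in> W" using F(4) dK by (simp add: topspace_T)
    then show "\<exists>y. y \<in> simple_funs X S \<and> y \<in> W" using d(1) SX by auto
  qed
qed

definition curve :: "(real \<times> nat \<Rightarrow> real) \<Rightarrow> real \<Rightarrow> real \<Rightarrow> real \<times> nat \<Rightarrow> real" where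
  "curve d c x = add_scaled K d c (step X x)"

lemma curve_in_cfun: "d \<in> cfun K \<Longrightarrow> x \<in> X \<Longrightarrow> curve d c x \<in> cfun K"
  unfolding curve_def by (intro add_scaled_in_cfun step_in_cfun X)

lemma countable_discontinuities_curve:
  assumes d: "d \<in> cfun K" and \<phi>: "\<phi> \<in> \<Phi>"
  shows "countable (discontinuities X (\<lambda>x. \<phi> (curve d c x)))"
proof (rule countable_subset)
  have \<phi>': "\<phi> \<in> cfun_dual K" using \<phi> \<Phi>_dual by blast
  show "countable (discontinuities X (\<lambda>x. \<phi> (step X x)))"
    by (rule countable_discontinuities_dual_step[OF X \<phi>'])
  have eq: "\<phi> (curve d c x) = \<phi> d + c * \<phi> (step X x)" if "x \<in> X" for x
    unfolding curve_def by (rule dual_add_scaled[OF \<phi>' d step_in_cfun[OF that X]])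
  show "discontinuities X (\<lambda>x. \<phi> (curve d c x)) \<subseteq> discontinuities X (\<lambda>x. \<phi> (step X x))"
  proof
    fix x assume x: "x \<in> discontinuities X (\<lambda>x. \<phi> (curve d c x))"
    then have xX: "x \<in> X" by (simp add: discontinuities_def)
    have "\<not> continuous (at x within X) (\<lambda>x. \<phi> (step X x))"
    proof
      assume "continuous (at x within X) (\<lambda>x. \<phi> (step X x))"
      then have "continuous (at x within X) (\<lambda>x. \<phi> d + c * \<phi> (step X x))"
        by (intro continuous_intros)
      then have "continuous (at x within X) (\<lambda>x. \<phi> (curve d c x))"
        unfolding continuous_within_eps_delta using eq xX by simp
      then show False using x by (simp add: discontinuities_def)
    qed
    then show "x \<in> discontinuities X (\<lambda>x. \<phi> (step X x))" using xX by (simp add: discontinuities_def)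
  qed
qed

text \<open>
  The first component of \<open>AB\<close> collects exceptional parameters of the curve, the second one exceptional jump
  points.
\<close>

definition tame :: "(real \<Rightarrow> real \<times> nat \<Rightarrow> real) \<Rightarrow> real set \<times> real set \<Rightarrow> bool" where
  "tame \<gamma> AB \<longleftrightarrow> countable (fst AB) \<and> countable (snd AB) \<and>
     (\<forall>x\<in>X - fst AB. \<forall>y\<in>X. jump y (\<gamma> x) \<noteq> 0 \<longrightarrow> y = x \<or> y \<in> snd AB)"

lemma tame_image_of_curve:
  assumes gen: "generated_by_functionals Y I ev" and free: "finitely_free I ev (topspace Y)"
    and \<theta>: "continuous_map Y T \<theta>" and \<gamma>: "\<And>x. x \<in> X \<Longrightarrow> \<gamma> x \<in> topspace Y"
    and cont: "\<And>b. b \<in> I \<Longrightarrow> countable (discontinuities X (\<lambda>x. ev b (\<gamma> x)))"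
  shows "\<exists>AB. tame (\<lambda>x. \<theta> (\<gamma> x)) AB"
proof -
  have "\<exists>A B. countable A \<and> countable B \<and>
    (\<forall>x\<in>X - A. \<forall>y\<in>X. jump y (\<theta> (\<gamma> x)) \<noteq> 0 \<longrightarrow> y = x \<or> y \<in> B)"
  proof (rule jumps_of_curve[OF X rigid])
    show "\<theta> (\<gamma> x) \<in> cfun K" if "x \<in> X" for x
      using continuous_map_image_subset_topspace[OF \<theta>] \<gamma>[OF that] by (auto simp: topspace_T)
    fix q :: real assume q: "0 \<le> q" "q \<le> 1"
    have "continuous_map T euclideanreal (\<lambda>f. f (q, 0))"
      by (rule continuous_map_eval) (use q in \<open>simp add: topspace_split_interval\<close>)
    from continuous_map_compose[OF \<theta> this]
    have "continuous_map Y euclideanreal (\<lambda>v. \<theta> v (q, 0))" by (simp add: comp_def)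
    then have "initially_continuous I ev (topspace Y) (\<lambda>v. \<theta> v (q, 0))"
      by (rule continuous_map_initially_continuous[OF gen])
    then show "countable (discontinuities X (\<lambda>x. \<theta> (\<gamma> x) (q, 0)))"
      by (rule initially_continuous_along_curve[OF _ free \<gamma> cont])
  qed
  then show ?thesis unfolding tame_def by fastforce
qed

lemma tame_image_single:
  assumes \<theta>: "continuous_map T T \<theta>" and d: "d \<in> cfun K"
  shows "\<exists>AB. tame (\<lambda>x. \<theta> (curve d c x)) AB"
proof -
  obtain B where B: "B \<subseteq> \<Phi>" "finitely_free B (\<lambda>b. b) (topspace T)" "generated_by_functionals T B (\<lambda>b. b)"
    using free_basis by metis
  show ?thesis
    by (rule tame_image_of_curve[OF B(3,2) \<theta>])
      (use B(1) d curve_in_cfun countable_discontinuities_curve in \<open>auto simp: topspace_T\<close>)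
qed

lemma tame_image_pair:
  assumes \<theta>: "continuous_map (prod_topology T T) T \<theta>" and d: "d \<in> cfun K" "d' \<in> cfun K"
  shows "\<exists>AB. tame (\<lambda>x. \<theta> (curve d c x, curve d' c' x)) AB"
proof -
  obtain B where B: "B \<subseteq> \<Phi>" "finitely_free B (\<lambda>b. b) (topspace T)" "generated_by_functionals T B (\<lambda>b. b)"
    using free_basis by metis
  show ?thesis
  proof (rule tame_image_of_curve[OF generated_by_functionals_pair[OF B(3)] _ \<theta>])
    show "finitely_free (UNIV \<times> B) (ev_pair (\<lambda>b. b)) (topspace (prod_topology T T))"
      using finitely_free_pair[OF B(2)] by simp
    show "(curve d c x, curve d' c' x) \<in> topspace (prod_topology T T)" if "x \<in> X" for x
      using that d curve_in_cfun by (simp add: topspace_T)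
    fix ib :: "bool \<times> ((real \<times> nat \<Rightarrow> real) \<Rightarrow> real)" assume ib: "ib \<in> UNIV \<times> B"
    then have "snd ib \<in> \<Phi>" using B(1) by auto
    then show "countable (discontinuities X (\<lambda>x. ev_pair (\<lambda>b. b) ib (curve d c x, curve d' c' x)))"
      using countable_discontinuities_curve d by (cases "fst ib") (simp_all add: ev_pair_def)
  qed
qed

lemma closure_maps_into_jumps_within:
  assumes \<theta>: "continuous_map Y T \<theta>" and D: "D \<subseteq> topspace Y" and im: "\<And>v. v \<in> D \<Longrightarrow> \<theta> v \<in> jumps_within X S"
    and M: "M \<subseteq> Y closure_of D" and v: "v \<in> M"
  shows "\<theta> v \<in> jumps_within X S"
proof -
  have "D \<subseteq> {v \<in> topspace Y. \<theta> v \<in> jumps_within X S}" using D im by blast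
  then have "Y closure_of D \<subseteq> {v \<in> topspace Y. \<theta> v \<in> jumps_within X S}"
    by (rule closure_of_minimal) (rule closedin_continuous_map_preimage[OF \<theta> closedin_jumps_within])
  then show ?thesis using M v by blast
qed

lemma simple_funs_insert_curve:
  assumes "d \<in> simple_funs X (insert x S)"
  obtains d' and c :: rat where "d' \<in> simple_funs X S" "d = curve d' (of_rat c) x"
  using simple_funs_insert[OF assms] unfolding curve_def by metis

text \<open>
  A countable \<open>S\<close> closed under the exceptional jump points of its own curves, as the union of the stages of a
  recursion; \<open>\<Gamma>\<close> only has to be finitary in \<open>S\<close>.
\<close>

lemma closing_off:
  assumes cnt: "\<And>S. countable S \<Longrightarrow> countable (\<Gamma> S)"
    and fin: "\<And>S \<gamma>. (\<And>n. S n \<subseteq> S (Suc n)) \<Longrightarrow> \<gamma> \<in> \<Gamma> (\<Union>n::nat. S n) \<Longrightarrow> \<exists>n. \<gamma> \<in> \<Gamma> (S n)"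
    and tame: "\<And>S \<gamma>. S \<subseteq> X \<Longrightarrow> \<gamma> \<in> \<Gamma> S \<Longrightarrow> \<exists>AB. tame \<gamma> AB"
  shows "\<exists>S A. S \<subseteq> X \<and> countable S \<and> countable A \<and>
    (\<forall>\<gamma>\<in>\<Gamma> S. \<forall>x\<in>X - A. \<forall>y\<in>X. jump y (\<gamma> x) \<noteq> 0 \<longrightarrow> y = x \<or> y \<in> S)"
proof -
  define ab where "ab \<gamma> = (SOME AB. tame \<gamma> AB)" for \<gamma>
  have ab: "tame \<gamma> (ab \<gamma>)" if "S \<subseteq> X" "\<gamma> \<in> \<Gamma> S" for \<gamma> S
    unfolding ab_def by (rule someI_ex[OF tame[OF that]])
  define S where "S = rec_nat {} (\<lambda>_ S. S \<union> X \<inter> (\<Union>\<gamma>\<in>\<Gamma> S. snd (ab \<gamma>)))"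
  have S0: "S 0 = {}" and SS: "S (Suc n) = S n \<union> X \<inter> (\<Union>\<gamma>\<in>\<Gamma> (S n). snd (ab \<gamma>))" for n
    by (simp_all add: S_def)
  have SX: "S n \<subseteq> X" for n by (induction n) (auto simp: S0 SS)
  have ctab: "countable (snd (ab \<gamma>))" "countable (fst (ab \<gamma>))" if "\<gamma> \<in> \<Gamma> (S n)" for \<gamma> n
    using ab[OF SX that] by (simp_all add: tame_def)
  have cS: "countable (S n)" for n
  proof (induction n)
    case (Suc n)
    have "countable (\<Union>\<gamma>\<in>\<Gamma> (S n). snd (ab \<gamma>))"
      by (rule countable_UN[OF cnt[OF Suc] ctab(1)])
    then show ?case using Suc unfolding SS by (intro countable_Un countable_Int2)
  qed (simp add: S0)
  let ?S = "\<Union>n. S n"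
  have lim: "\<exists>n. \<gamma> \<in> \<Gamma> (S n)" if "\<gamma> \<in> \<Gamma> ?S" for \<gamma>
    by (rule fin[OF _ that]) (auto simp: SS)
  have cSU: "countable ?S" by (rule countable_UN) (use cS in auto)
  have "?S \<subseteq> X" using SX by blast
  moreover have "countable (\<Union>\<gamma>\<in>\<Gamma> ?S. fst (ab \<gamma>))"
    by (rule countable_UN[OF cnt[OF cSU]]) (use lim ctab(2) in blast)
  moreover have "y = x \<or> y \<in> ?S"
    if \<gamma>: "\<gamma> \<in> \<Gamma> ?S" and x: "x \<in> X - (\<Union>\<gamma>\<in>\<Gamma> ?S. fst (ab \<gamma>))" and y: "y \<in> X" "jump y (\<gamma> x) \<noteq> 0" for \<gamma> x y
  proof -
    obtain n where n: "\<gamma> \<in> \<Gamma> (S n)" using lim[OF \<gamma>] by blast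
    have "x \<in> X - fst (ab \<gamma>)" using x \<gamma> by blast
    then have "y = x \<or> y \<in> snd (ab \<gamma>)" using ab[OF SX n] y unfolding tame_def by blast
    moreover have "y \<in> S (Suc n)" if "y \<in> snd (ab \<gamma>)" using that n y(1) unfolding SS by blast
    ultimately show ?thesis by blast
  qed
  ultimately show ?thesis using cSU
    by (intro exI[of _ ?S] exI[of _ "\<Union>\<gamma>\<in>\<Gamma> ?S. fst (ab \<gamma>)"] conjI ballI impI)
qed

text \<open>
  The images under \<open>h\<close> and \<open>k\<close> of the curves that run through the dense subset of \<open>jumps_within X (insert x S)\<close>
  and of its square as \<open>x\<close> varies.
\<close>

definition test_curves :: "((real \<times> nat \<Rightarrow> real) \<Rightarrow> (real \<times> nat \<Rightarrow> real) \<times> (real \<times> nat \<Rightarrow> real)) \<Rightarrow>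
    ((real \<times> nat \<Rightarrow> real) \<times> (real \<times> nat \<Rightarrow> real) \<Rightarrow> real \<times> nat \<Rightarrow> real) \<Rightarrow>
    real set \<Rightarrow> (real \<Rightarrow> real \<times> nat \<Rightarrow> real) set" where
  "test_curves h k S =
     (\<lambda>(d, c::rat) x. fst (h (curve d (of_rat c) x))) ` (simple_funs X S \<times> UNIV) \<union>
     (\<lambda>(d, c::rat) x. snd (h (curve d (of_rat c) x))) ` (simple_funs X S \<times> UNIV) \<union>
     (\<lambda>((d, c::rat), (d', c'::rat)) x. k (curve d (of_rat c) x, curve d' (of_rat c') x)) `
       ((simple_funs X S \<times> UNIV) \<times> (simple_funs X S \<times> UNIV))"

lemma test_curvesI:
  assumes "d \<in> simple_funs X S"
  shows "(\<lambda>x. fst (h (curve d (of_rat c) x))) \<in> test_curves h k S"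
    and "(\<lambda>x. snd (h (curve d (of_rat c) x))) \<in> test_curves h k S"
    and "d' \<in> simple_funs X S \<Longrightarrow> (\<lambda>x. k (curve d (of_rat c) x, curve d' (of_rat c') x)) \<in> test_curves h k S"
proof -
  show "(\<lambda>x. fst (h (curve d (of_rat c) x))) \<in> test_curves h k S"
    unfolding test_curves_def
    by (rule UnI1, rule UnI1, rule image_eqI[of _ _ "(d, c)"]) (use assms in simp_all)
  show "(\<lambda>x. snd (h (curve d (of_rat c) x))) \<in> test_curves h k S"
    unfolding test_curves_def
    by (rule UnI1, rule UnI2, rule image_eqI[of _ _ "(d, c)"]) (use assms in simp_all)
  show "(\<lambda>x. k (curve d (of_rat c) x, curve d' (of_rat c') x)) \<in> test_curves h k S"
    if "d' \<in> simple_funs X S"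
    unfolding test_curves_def
    by (rule UnI2, rule image_eqI[of _ _ "((d, c), (d', c'))"]) (use assms that in simp_all)
qed

lemma test_curvesE:
  assumes "\<gamma> \<in> test_curves h k S"
  obtains (1) d c where "d \<in> simple_funs X S" "\<gamma> = (\<lambda>x. fst (h (curve d (of_rat c) x)))"
  | (2) d c where "d \<in> simple_funs X S" "\<gamma> = (\<lambda>x. snd (h (curve d (of_rat c) x)))"
  | (3) d c d' c' where "d \<in> simple_funs X S" "d' \<in> simple_funs X S"
      "\<gamma> = (\<lambda>x. k (curve d (of_rat c) x, curve d' (of_rat c') x))"
  using assms unfolding test_curves_def by auto

lemma countable_test_curves: "countable S \<Longrightarrow> countable (test_curves h k S)"
  unfolding test_curves_def
  by (intro countable_Un countable_image countable_SIGMA countable_simple_funs countableI_type)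

lemma test_curves_UN:
  assumes mono: "\<And>n. S n \<subseteq> S (Suc n)" and \<gamma>: "\<gamma> \<in> test_curves h k (\<Union>n::nat. S n)"
  shows "\<exists>n. \<gamma> \<in> test_curves h k (S n)"
  using \<gamma>
proof (cases rule: test_curvesE)
  case (1 d c)
  obtain n where n: "d \<in> simple_funs X (S n)" by (rule simple_funs_UN[OF mono 1(1)])
  show ?thesis unfolding 1(2) using test_curvesI(1)[OF n] by blast
next
  case (2 d c)
  obtain n where n: "d \<in> simple_funs X (S n)" by (rule simple_funs_UN[OF mono 2(1)])
  show ?thesis unfolding 2(2) using test_curvesI(2)[OF n] by blast
next
  case (3 d c d' c')
  obtain n where n: "d \<in> simple_funs X (S n)" by (rule simple_funs_UN[OF mono 3(1)])
  obtain m where m: "d' \<in> simple_funs X (S m)" by (rule simple_funs_UN[OF mono 3(2)])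
  have le: "S i \<subseteq> S j" if "i \<le> j" for i j using lift_Suc_mono_le[of S, OF mono that] .
  have "d \<in> simple_funs X (S (max n m))" "d' \<in> simple_funs X (S (max n m))"
    using n m simple_funs_mono[OF le[of n "max n m"]] simple_funs_mono[OF le[of m "max n m"]] by auto
  then show ?thesis unfolding 3(3) using test_curvesI(3) by blast
qed

lemma tame_test_curve:
  assumes h: "continuous_map T (prod_topology T T) h" and k: "continuous_map (prod_topology T T) T k"
    and S: "S \<subseteq> X" and \<gamma>: "\<gamma> \<in> test_curves h k S"
  shows "\<exists>AB. tame \<gamma> AB"
proof -
  have DK: "d \<in> cfun K" if "d \<in> simple_funs X S" for d using simple_funs_in_cfun[OF X S] that by blast
  have h12: "continuous_map T T (\<lambda>f. fst (h f))" "continuous_map T T (\<lambda>f. snd (h f))"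
    using continuous_map_compose[OF h continuous_map_fst] continuous_map_compose[OF h continuous_map_snd]
    by (simp_all add: comp_def)
  show ?thesis using \<gamma>
  proof (cases rule: test_curvesE)
    case (1 d c)
    show ?thesis unfolding 1(2) by (rule tame_image_single[OF h12(1) DK[OF 1(1)]])
  next
    case (2 d c)
    show ?thesis unfolding 2(2) by (rule tame_image_single[OF h12(2) DK[OF 2(1)]])
  next
    case (3 d c d' c')
    show ?thesis unfolding 3(3) by (rule tame_image_pair[OF k DK[OF 3(1)] DK[OF 3(2)]])
  qed
qed

lemma curve_zero: "d \<in> cfun K \<Longrightarrow> curve d 0 x = d"
  unfolding curve_def add_scaled_def by (auto simp: cfun_def extensional_def)

lemma jumps_within_insert_iff:
  "f \<in> jumps_within X (insert x S) \<Longrightarrow> x \<notin> S \<Longrightarrow> x \<in> X \<Longrightarrow> f \<in> jumps_within X S \<longleftrightarrow> jump x f = 0"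
  by (auto simp: jumps_within_def)

lemma jumps_within_add_scaled:
  "f \<in> jumps_within X S \<Longrightarrow> g \<in> jumps_within X S \<Longrightarrow> add_scaled K f c g \<in> jumps_within X S"
  using X by (auto simp: jumps_within_def jump_add_scaled)

lemma continuous_map_add_scaled:
  assumes f: "f \<in> cfun K" and g: "g \<in> cfun K" and a: "continuous_map Y euclideanreal a"
  shows "continuous_map Y T (\<lambda>t. add_scaled K f (a t) g)"
proof (rule continuous_map_into_functional_topology[OF \<Phi>_nonempty])
  show "add_scaled K f (a t) g \<in> cfun K" for t using f g by auto
  fix \<phi> assume "\<phi> \<in> \<Phi>"
  then have "\<phi> (add_scaled K f (a t) g) = \<phi> f + a t * \<phi> g" for t
    using dual_add_scaled[OF _ f g] \<Phi>_dual by blast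
  then show "continuous_map Y euclideanreal (\<lambda>t. \<phi> (add_scaled K f (a t) g))"
    using a by (simp add: continuous_map_add continuous_map_real_mult_right)
qed

text \<open>
  A pair is joined by a segment, along which both jumps at \<open>x\<close> are constant, to the pair of multiples of
  the step at \<open>x\<close> with the same jumps; these pairs form a continuous image of the punctured plane.
\<close>

lemma connectedin_codimension_two:
  assumes x: "x \<in> X" "x \<notin> S"
  defines "E \<equiv> jumps_within X (insert x S)"
  shows "connectedin (prod_topology T T) {v \<in> E \<times> E. (jump x (fst v), jump x (snd v)) \<noteq> (0, 0)}"
    (is "connectedin _ ?M")
proof -
  let ?z = "\<lambda>p\<in>topspace K. 0::real"
  let ?s = "\<lambda>a. add_scaled K ?z a (step X x)"
  have zK: "?z \<in> cfun K" by (rule zero_in_cfun)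
  have sK: "step X x \<in> cfun K" by (rule step_in_cfun[OF x(1) X])
  have jz: "jump y ?z = 0" if "y \<in> X" for y using that X by (auto simp: jump_def topspace_split_interval)
  have zE: "?z \<in> E" using zK jz by (auto simp: E_def jumps_within_def)
  have sE: "step X x \<in> E" using sK jump_step[OF x(1) X] by (auto simp: E_def jumps_within_def)
  have EK: "f \<in> cfun K" if "f \<in> E" for f using that by (simp add: E_def jumps_within_def)
  have js: "jump x (?s a) = a" for a
    using jump_add_scaled[OF x(1) X, of ?z a "step X x"] jz[OF x(1)] jump_step[OF x(1) X x(1)] by simp
  have ssE: "?s a \<in> E" for a using zE sE unfolding E_def by (rule jumps_within_add_scaled)
  define Q where "Q = (\<lambda>ab. (?s (fst ab), ?s (snd ab))) ` (- {(0::real, 0::real)})"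
  have "connectedin euclidean (- {(0::real, 0::real)})"
    using connected_punctured_universe[of "(0::real, 0::real)"] by simp
  moreover have "continuous_map euclidean (prod_topology T T) (\<lambda>ab::real \<times> real. (?s (fst ab), ?s (snd ab)))"
    by (intro continuous_map_pairedI continuous_map_add_scaled zK sK) (auto intro: continuous_intros)
  ultimately have Q: "connectedin (prod_topology T T) Q"
    unfolding Q_def by (intro connectedin_continuous_map_image)
  have QM: "Q \<subseteq> ?M" using ssE js by (auto simp: Q_def)
  have seg: "\<exists>C. connectedin (prod_topology T T) C \<and> C \<subseteq> ?M \<and> v \<in> C \<and> Q \<subseteq> C" if v: "v \<in> ?M" for v
  proof -
    obtain f g where fg: "v = (f, g)" "f \<in> E" "g \<in> E" using v by auto
    let ?a = "jump x f" and ?b = "jump x g"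
    let ?p = "\<lambda>f t. add_scaled K f t (add_scaled K (?s (jump x f)) (-1) f)"
    have pE: "?p f t \<in> E" if "f \<in> E" for f t
    proof -
      have "add_scaled K (?s (jump x f)) (-1) f \<in> E"
        using ssE that unfolding E_def by (rule jumps_within_add_scaled)
      with that show ?thesis unfolding E_def by (rule jumps_within_add_scaled)
    qed
    have jp: "jump x (?p f t) = jump x f" for f t
      using jump_add_scaled[OF x(1) X] js by simp
    have p0: "?p f 0 = f" and p1: "?p f 1 = ?s (jump x f)" if f: "f \<in> E" for f
      by (rule cfun_eqI[OF EK[OF pE[OF f]]]; use EK[OF f] EK[OF ssE] in simp)+
    define C where "C = (\<lambda>t. (?p f t, ?p g t)) ` {0..1::real}"
    have cont: "continuous_map euclideanreal (prod_topology T T) (\<lambda>t. (?p f t, ?p g t))"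
      by (intro continuous_map_pairedI continuous_map_add_scaled add_scaled_in_cfun EK fg zK sK) (auto intro: continuous_intros)
    have "connectedin (prod_topology T T) C"
      unfolding C_def by (rule connectedin_continuous_map_image[OF cont]) simp
    moreover have "(?s ?a, ?s ?b) \<in> C \<inter> Q"
    proof
      show "(?s ?a, ?s ?b) \<in> C" unfolding C_def by (rule image_eqI[of _ _ 1]) (simp_all add: p1 fg)
      show "(?s ?a, ?s ?b) \<in> Q" unfolding Q_def using v fg(1) by (intro image_eqI[of _ _ "(?a, ?b)"]) auto
    qed
    ultimately have "connectedin (prod_topology T T) (C \<union> Q)" using Q by (intro connectedin_Un) auto
    moreover have "C \<subseteq> ?M" using pE[OF fg(2)] pE[OF fg(3)] v fg(1) by (auto simp: C_def jp)
    moreover have "v \<in> C" unfolding C_def fg(1) by (rule image_eqI[of _ _ 0]) (simp_all add: p0 fg)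
    ultimately show ?thesis using QM by (intro exI[of _ "C \<union> Q"]) auto
  qed
  define \<C> where "\<C> = {C. connectedin (prod_topology T T) C \<and> C \<subseteq> ?M \<and> Q \<subseteq> C}"
  have "(?s 1, ?s 0) \<in> Q" unfolding Q_def by (rule image_eqI[of _ _ "(1, 0)"]) auto
  then have "(?s 1, ?s 0) \<in> \<Inter>\<C>" unfolding \<C>_def by blast
  then have "connectedin (prod_topology T T) (\<Union>\<C>)"
    by (intro connectedin_Union) (auto simp: \<C>_def)
  moreover have "\<Union>\<C> = ?M"
  proof
    show "\<Union>\<C> \<subseteq> ?M" unfolding \<C>_def by blast
    show "?M \<subseteq> \<Union>\<C>" using seg unfolding \<C>_def by blast
  qed
  ultimately show ?thesis by simp
qed

text \<open>
  The homeomorphism and its inverse respect \<open>jumps_within X S\<close> and \<open>jumps_within X (insert x S)\<close> and their squares, since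
  they do so on dense subsets.  The jump functional at \<open>x\<close> then takes the values 1 and -1, but not 0, on the
  connected set \<open>k ` M\<close>.
\<close>

theorem not_homeomorphic_to_square: "\<not> T homeomorphic_space prod_topology T T"
proof
  assume "T homeomorphic_space prod_topology T T"
  then obtain h k where h: "continuous_map T (prod_topology T T) h" and k: "continuous_map (prod_topology T T) T k"
    and kh: "\<And>f. f \<in> cfun K \<Longrightarrow> k (h f) = f"
    and hk: "\<And>v. v \<in> cfun K \<times> cfun K \<Longrightarrow> h (k v) = v"
    unfolding homeomorphic_space_def homeomorphic_maps_def by (auto simp: topspace_T)
  obtain S A where S: "S \<subseteq> X" "countable S" "countable A" and
    SA: "\<And>\<gamma> x y. \<gamma> \<in> test_curves h k S \<Longrightarrow> x \<in> X - A \<Longrightarrow> y \<in> X \<Longrightarrow> jump y (\<gamma> x) \<noteq> 0 \<Longrightarrow> y = x \<or> y \<in> S"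
  proof -
    have "\<exists>S A. S \<subseteq> X \<and> countable S \<and> countable A \<and>
      (\<forall>\<gamma>\<in>test_curves h k S. \<forall>x\<in>X - A. \<forall>y\<in>X. jump y (\<gamma> x) \<noteq> 0 \<longrightarrow> y = x \<or> y \<in> S)"
    proof (rule closing_off)
      show "countable (test_curves h k S)" if "countable S" for S using that by (rule countable_test_curves)
      show "\<exists>n. \<gamma> \<in> test_curves h k (S n)"
        if "\<And>n. S n \<subseteq> S (Suc n)" "\<gamma> \<in> test_curves h k (\<Union>n::nat. S n)" for S \<gamma>
        using that by (rule test_curves_UN)
      show "\<exists>AB. tame \<gamma> AB" if "S \<subseteq> X" "\<gamma> \<in> test_curves h k S" for S \<gamma>
        using that by (rule tame_test_curve[OF h k])
    qed
    then show ?thesis using that by metis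
  qed
  obtain x where x: "x \<in> X" "x \<notin> S \<union> A"
    using uncountable_minus_nonempty[OF unc, of "S \<union> A"] S by auto
  (* The curves with c = 0 are constant; comparing x with x' shows that their values jump only in S. *)
  obtain x' where x': "x' \<in> X" "x' \<notin> insert x (S \<union> A)"
    using uncountable_minus_nonempty[OF unc, of "insert x (S \<union> A)"] S by auto
  let ?Sx = "insert x S"
  have Sx: "?Sx \<subseteq> X" using S x by simp
  have h12: "continuous_map T T (\<lambda>f. fst (h f))" "continuous_map T T (\<lambda>f. snd (h f))"
    using continuous_map_compose[OF h continuous_map_fst] continuous_map_compose[OF h continuous_map_snd]
    by (simp_all add: comp_def)
  have DK: "simple_funs X Z \<subseteq> topspace T" if "Z \<subseteq> X" for Z
    using simple_funs_in_cfun[OF X that] by (simp add: topspace_T)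
  have \<gamma>K: "\<gamma> z \<in> cfun K" if \<gamma>: "\<gamma> \<in> test_curves h k S" and z: "z \<in> X" for \<gamma> z
  proof -
    have D: "d \<in> cfun K" if "d \<in> simple_funs X S" for d using DK[OF S(1)] that by (auto simp: topspace_T)
    show ?thesis using \<gamma>
    proof (cases rule: test_curvesE)
      case (1 d c)
      show ?thesis unfolding 1(2)
        using continuous_map_image_subset_topspace[OF h12(1)] curve_in_cfun[OF D[OF 1(1)] z] by (auto simp: topspace_T)
    next
      case (2 d c)
      show ?thesis unfolding 2(2)
        using continuous_map_image_subset_topspace[OF h12(2)] curve_in_cfun[OF D[OF 2(1)] z] by (auto simp: topspace_T)
    next
      case (3 d c d' c')
      show ?thesis unfolding 3(3)
        using continuous_map_image_subset_topspace[OF k] curve_in_cfun[OF D[OF 3(1)] z] curve_in_cfun[OF D[OF 3(2)] z]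
        by (auto simp: topspace_T)
    qed
  qed
  have within_Sx: "\<gamma> x \<in> jumps_within X ?Sx" if "\<gamma> \<in> test_curves h k S" for \<gamma>
    using \<gamma>K[OF that x(1)] SA[OF that, of x] x by (auto simp: jumps_within_def)
  have within_S: "\<gamma> x \<in> jumps_within X S" if "\<gamma> \<in> test_curves h k S" "\<gamma> x' = \<gamma> x" for \<gamma>
    using \<gamma>K[OF that(1) x(1)] SA[OF that(1), of x] SA[OF that(1), of x'] x x' that(2)
    by (auto simp: jumps_within_def)
  have DT: "d \<in> cfun K" if "d \<in> simple_funs X S" for d using DK[OF S(1)] that by (auto simp: topspace_T)
  have prod_closure: "jumps_within X Z \<times> jumps_within X Z \<subseteq> prod_topology T T closure_of (simple_funs X Z \<times> simple_funs X Z)"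
    if "Z \<subseteq> X" for Z
    unfolding closure_of_Times using jumps_within_subset_closure[OF that] by (intro Sigma_mono)
  have h_Sx: "h f \<in> jumps_within X ?Sx \<times> jumps_within X ?Sx" if f: "f \<in> jumps_within X ?Sx" for f
  proof -
    have "fst (h d) \<in> jumps_within X ?Sx \<and> snd (h d) \<in> jumps_within X ?Sx" if d: "d \<in> simple_funs X ?Sx" for d
    proof -
      obtain d' and c :: rat where d': "d' \<in> simple_funs X S" "d = curve d' (of_rat c) x"
        by (rule simple_funs_insert_curve[OF d])
      show ?thesis unfolding d'(2)
        using within_Sx[OF test_curvesI(1)[OF d'(1)]] within_Sx[OF test_curvesI(2)[OF d'(1)]] by blast
    qed
    then have "fst (h f) \<in> jumps_within X ?Sx" "snd (h f) \<in> jumps_within X ?Sx"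
      using closure_maps_into_jumps_within[OF h12(1) DK[OF Sx] _ jumps_within_subset_closure[OF Sx] f]
        closure_maps_into_jumps_within[OF h12(2) DK[OF Sx] _ jumps_within_subset_closure[OF Sx] f] by blast+
    then show ?thesis by (simp add: mem_Times_iff)
  qed
  have h_S: "h f \<in> jumps_within X S \<times> jumps_within X S" if f: "f \<in> jumps_within X S" for f
  proof -
    have "fst (h d) \<in> jumps_within X S \<and> snd (h d) \<in> jumps_within X S" if d: "d \<in> simple_funs X S" for d
      using within_S[OF test_curvesI(1)[OF d, of h 0 k]] within_S[OF test_curvesI(2)[OF d, of h 0 k]]
      by (simp add: curve_zero[OF DT[OF d]])
    then have "fst (h f) \<in> jumps_within X S" "snd (h f) \<in> jumps_within X S"
      using closure_maps_into_jumps_within[OF h12(1) DK[OF S(1)] _ jumps_within_subset_closure[OF S(1)] f]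
        closure_maps_into_jumps_within[OF h12(2) DK[OF S(1)] _ jumps_within_subset_closure[OF S(1)] f] by blast+
    then show ?thesis by (simp add: mem_Times_iff)
  qed
  have DDK: "simple_funs X Z \<times> simple_funs X Z \<subseteq> topspace (prod_topology T T)" if "Z \<subseteq> X" for Z
    using DK[OF that] by auto
  have k_Sx: "k v \<in> jumps_within X ?Sx" if v: "v \<in> jumps_within X ?Sx \<times> jumps_within X ?Sx" for v
  proof (rule closure_maps_into_jumps_within[OF k DDK[OF Sx] _ prod_closure[OF Sx] v])
    fix w assume "w \<in> simple_funs X ?Sx \<times> simple_funs X ?Sx"
    then obtain d e where w: "w = (d, e)" "d \<in> simple_funs X ?Sx" "e \<in> simple_funs X ?Sx" by blast
    obtain d' and c :: rat where d': "d' \<in> simple_funs X S" "d = curve d' (of_rat c) x"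
      by (rule simple_funs_insert_curve[OF w(2)])
    obtain e' and c' :: rat where e': "e' \<in> simple_funs X S" "e = curve e' (of_rat c') x"
      by (rule simple_funs_insert_curve[OF w(3)])
    show "k w \<in> jumps_within X ?Sx" unfolding w(1) d'(2) e'(2)
      using within_Sx[OF test_curvesI(3)[OF d'(1) e'(1)]] by blast
  qed
  have k_S: "k v \<in> jumps_within X S" if v: "v \<in> jumps_within X S \<times> jumps_within X S" for v
  proof (rule closure_maps_into_jumps_within[OF k DDK[OF S(1)] _ prod_closure[OF S(1)] v])
    fix w assume "w \<in> simple_funs X S \<times> simple_funs X S"
    then obtain d e where w: "w = (d, e)" "d \<in> simple_funs X S" "e \<in> simple_funs X S" by blast
    show "k w \<in> jumps_within X S" unfolding w(1)
      using within_S[OF test_curvesI(3)[OF w(2,3), of k 0 0 h]]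
      by (simp add: curve_zero[OF DT[OF w(2)]] curve_zero[OF DT[OF w(3)]])
  qed
  define M where "M = {v \<in> jumps_within X ?Sx \<times> jumps_within X ?Sx. (jump x (fst v), jump x (snd v)) \<noteq> (0, 0)}"
  have xS: "x \<notin> S" using x by simp
  have "connectedin (prod_topology T T) M"
    unfolding M_def by (rule connectedin_codimension_two[OF x(1) xS])
  then have "connectedin T (k ` M)" by (rule connectedin_continuous_map_image[OF k])
  then have "connectedin euclideanreal (jump x ` k ` M)"
    by (rule connectedin_continuous_map_image[OF continuous_map_jump[OF x(1)]])
  then have conn: "connected (jump x ` k ` M)" by simp
  have JK: "f \<in> cfun K" if "f \<in> jumps_within X Z" for f Z using that by (simp add: jumps_within_def)
  have nz: "0 \<notin> jump x ` k ` M"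
  proof
    assume "0 \<in> jump x ` k ` M"
    then obtain v where v: "v \<in> M" "jump x (k v) = 0" by auto
    have vE: "v \<in> jumps_within X ?Sx \<times> jumps_within X ?Sx" using v(1) by (simp add: M_def)
    have "k v \<in> jumps_within X S"
      using jumps_within_insert_iff[OF k_Sx[OF vE] xS x(1)] v(2) by simp
    then have "h (k v) \<in> jumps_within X S \<times> jumps_within X S" by (rule h_S)
    moreover have "h (k v) = v" using vE JK by (intro hk) auto
    ultimately have "v \<in> jumps_within X S \<times> jumps_within X S" by simp
    then have "jump x (fst v) = 0" "jump x (snd v) = 0" using x xS by (auto simp: jumps_within_def)
    then show False using v(1) by (simp add: M_def)
  qed
  have hit: "jump x f \<in> jump x ` k ` M" if f: "f \<in> jumps_within X ?Sx" "jump x f \<noteq> 0" for f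
  proof -
    have "h f \<in> M" unfolding M_def
    proof (intro CollectI conjI)
      show hf: "h f \<in> jumps_within X ?Sx \<times> jumps_within X ?Sx" by (rule h_Sx[OF f(1)])
      show "(jump x (fst (h f)), jump x (snd (h f))) \<noteq> (0, 0)"
      proof
        assume "(jump x (fst (h f)), jump x (snd (h f))) = (0, 0)"
        then have "h f \<in> jumps_within X S \<times> jumps_within X S"
          using hf jumps_within_insert_iff[OF _ xS x(1)] by (auto simp: mem_Times_iff)
        then have "k (h f) \<in> jumps_within X S" by (rule k_S)
        then have "f \<in> jumps_within X S" using kh[OF JK[OF f(1)]] by simp
        then show False using f(2) x xS by (auto simp: jumps_within_def)
      qed
    qed
    then have "jump x (k (h f)) \<in> jump x ` k ` M" by blast
    then show ?thesis using kh[OF JK[OF f(1)]] by simp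
  qed
  have sE: "step X x \<in> jumps_within X ?Sx"
    using step_in_cfun[OF x(1) X] jump_step[OF x(1) X] by (auto simp: jumps_within_def)
  have js: "jump x (step X x) = 1" using jump_step[OF x(1) X x(1)] by simp
  have jm: "jump x (add_scaled K (step X x) (-2) (step X x)) = -1"
    using jump_add_scaled[OF x(1) X, of "step X x" "-2" "step X x"] js by simp
  have "1 \<in> jump x ` k ` M" using hit[OF sE] js by simp
  moreover have "-1 \<in> jump x ` k ` M" using hit[OF jumps_within_add_scaled[OF sE sE, of "-2"]] jm by simp
  ultimately have "{-1..1} \<subseteq> jump x ` k ` M" using conn connected_contains_Icc by blast
  then have "0 \<in> jump x ` k ` M" by (rule subsetD) simp
  then show False using nz by contradiction
qed

end

theorem theorem4p6:
  "\<exists>X \<subseteq> {0<..<1::real}.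
     \<not> C_w (split_interval X) homeomorphic_space
         prod_topology (C_w (split_interval X)) (C_w (split_interval X)) \<and>
     \<not> C_p (split_interval X) homeomorphic_space
         prod_topology (C_p (split_interval X)) (C_p (split_interval X))"
proof -
  obtain X :: "real set" where X: "X \<subseteq> {0<..<1}" "gdelta_rigid X" "uncountable X"
    by (rule gdelta_rigid_exists)
  note evals = evaluations_subset_cfun_dual[OF X(1)]
  interpret w: rigid_function_space X "cfun_dual (split_interval X)"
    by unfold_locales (use X evals in auto)
  interpret p: rigid_function_space X "evaluations (split_interval X)"
    by unfold_locales (use X evals in auto)
  have Cp: "C_p (split_interval X) = functional_topology (split_interval X) (evaluations (split_interval X))"
    by (rule C_p_eq_functional_topology[OF w.K_nonempty])
  show ?thesis
  proof (intro exI[of _ X] conjI)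
    show "X \<subseteq> {0<..<1}" by (rule X(1))
    show "\<not> C_w (split_interval X) homeomorphic_space
         prod_topology (C_w (split_interval X)) (C_w (split_interval X))"
      unfolding C_w_eq_functional_topology by (rule w.not_homeomorphic_to_square)
    show "\<not> C_p (split_interval X) homeomorphic_space
         prod_topology (C_p (split_interval X)) (C_p (split_interval X))"
      unfolding Cp by (rule p.not_homeomorphic_to_square)
  qed
qed

end
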